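(* Let $C$ be a constant such that the implication $$\| a\|\leq1\ \text{ and }\ b\geq0\ \implies\ \left\Vert ab^{\frac{1}{2}}-b^{\frac{1}{2}}a\right\Vert \leq C\left\Vert ab-ba\right\Vert ^{\frac{1}{2}}$$ holds for all square complex matrices $a$ and $b$ (of a common, arbitrary size). Then this implication holds for all bounded operators $a$ and $b$ on an arbitrary Hilbert space (equivalently, for all elements $a,b$ of an arbitrary $C^{*}$-algebra).
   Context: $\|\cdot\|$ is the operator norm (resp. $C^*$-norm), and $b\ge 0$ means positive semidefinite (resp. positive). *)

theory Defs
  imports "HOL-Analysis.Operator_Norm" "HOL-Library.Complex_Order" "Jordan_Normal_Form.Matrix"
begin

section \<open>Square complex matrices\<close>

definition cvec_norm :: "complex vec \<Rightarrow> real" where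
  "cvec_norm v = sqrt (Re (v \<bullet>c v))"

text \<open>The supremum is over the closed unit ball, so that it is taken over a nonempty set
  (and has the value 0) for matrices of size 0 as well.\<close>

definition mat_opnorm :: "complex mat \<Rightarrow> real" where
  "mat_opnorm A = Sup {cvec_norm (A *\<^sub>v v) | v. v \<in> carrier_vec (dim_col A) \<and> cvec_norm v \<le> 1}"

text \<open>For complex numbers, \<open>0 \<le> z\<close> is the order of \<^theory>\<open>HOL-Library.Complex_Order\<close>: it
  says that \<open>z\<close> is real and nonnegative. Over the complex field this already forces a
  matrix (or operator) with nonnegative quadratic form to be Hermitian.\<close>

definition mat_psd :: "complex mat \<Rightarrow> bool" where
  "mat_psd A \<longleftrightarrow> square_mat A \<and> (\<forall>v \<in> carrier_vec (dim_row A). 0 \<le> (A *\<^sub>v v) \<bullet>c v)"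

definition mat_sqrt :: "complex mat \<Rightarrow> complex mat" where
  "mat_sqrt B = (THE S. S \<in> carrier_mat (dim_row B) (dim_row B) \<and> mat_psd S \<and> S * S = B)"


section \<open>Complex Hilbert spaces and their bounded operators\<close>

class scaleC =
  fixes scaleC :: "complex \<Rightarrow> 'a \<Rightarrow> 'a" (infixr "*\<^sub>C" 75)

class complex_banach = banach + scaleC +
  assumes scaleC_add_right: "c *\<^sub>C (x + y) = c *\<^sub>C x + c *\<^sub>C y"
    and scaleC_add_left: "(c + d) *\<^sub>C x = c *\<^sub>C x + d *\<^sub>C x"
    and scaleC_scaleC: "c *\<^sub>C (d *\<^sub>C x) = (c * d) *\<^sub>C x"
    and scaleR_scaleC: "r *\<^sub>R x = complex_of_real r *\<^sub>C x"
    and norm_scaleC: "norm (c *\<^sub>C x) = cmod c * norm x"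

text \<open>The inner product is linear in its first argument, like \<open>\<bullet>c\<close> on vectors.\<close>

class complex_hilbert = complex_banach +
  fixes cinner :: "'a \<Rightarrow> 'a \<Rightarrow> complex"
  assumes cinner_commute: "cinner x y = cnj (cinner y x)"
    and cinner_add_left: "cinner (x + y) z = cinner x z + cinner y z"
    and cinner_scaleC_left: "cinner (c *\<^sub>C x) y = c * cinner x y"
    and cinner_ge_zero: "0 \<le> cinner x x"
    and norm_eq_sqrt_cinner: "norm x = sqrt (Re (cinner x x))"

definition bounded_clinear :: "('h::complex_hilbert \<Rightarrow> 'h) \<Rightarrow> bool" where
  "bounded_clinear f \<longleftrightarrow> bounded_linear f \<and> (\<forall>c x. f (c *\<^sub>C x) = c *\<^sub>C f x)"

definition op_positive :: "('h::complex_hilbert \<Rightarrow> 'h) \<Rightarrow> bool" where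
  "op_positive f \<longleftrightarrow> bounded_clinear f \<and> (\<forall>x. 0 \<le> cinner (f x) x)"

definition op_sqrt :: "('h::complex_hilbert \<Rightarrow> 'h) \<Rightarrow> ('h \<Rightarrow> 'h)" where
  "op_sqrt f = (THE s. op_positive s \<and> s \<circ> s = f)"


section \<open>C*-algebras\<close>

text \<open>Not assumed to be unital.\<close>

class cstar_algebra = complex_banach + real_normed_algebra +
  fixes star :: "'a \<Rightarrow> 'a"
  assumes scaleC_mult_left: "(c *\<^sub>C x) * y = c *\<^sub>C (x * y)"
    and scaleC_mult_right: "x * (c *\<^sub>C y) = c *\<^sub>C (x * y)"
    and star_star: "star (star x) = x"
    and star_add: "star (x + y) = star x + star y"
    and star_scaleC: "star (c *\<^sub>C x) = cnj c *\<^sub>C star x"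
    and star_mult: "star (x * y) = star y * star x"
    and cstar_identity: "norm (star x * x) = (norm x)\<^sup>2"

text \<open>The pair \<open>(x, c)\<close> stands for the element \<open>x + c 1\<close> of the unitization, whose unit is
  \<open>(0, 1)\<close>. The spectrum of an element is taken in the unitization; if the algebra already
  has a unit, this adds at most the point 0 to the usual spectrum, which does not matter
  for positivity.\<close>

definition unitization_mult ::
  "('a::cstar_algebra) \<times> complex \<Rightarrow> 'a \<times> complex \<Rightarrow> 'a \<times> complex" where
  "unitization_mult p q =
     (fst p * fst q + snd q *\<^sub>C fst p + snd p *\<^sub>C fst q, snd p * snd q)"

definition cstar_spectrum :: "'a::cstar_algebra \<Rightarrow> complex set" where
  "cstar_spectrum x =
     {z. \<not> (\<exists>p. unitization_mult (x, - z) p = (0, 1) \<and> unitization_mult p (x, - z) = (0, 1))}"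

definition cstar_positive :: "'a::cstar_algebra \<Rightarrow> bool" where
  "cstar_positive x \<longleftrightarrow> star x = x \<and> (\<forall>z \<in> cstar_spectrum x. 0 \<le> z)"

definition cstar_sqrt :: "'a::cstar_algebra \<Rightarrow> 'a" where
  "cstar_sqrt b = (THE s. cstar_positive s \<and> s * s = b)"

end

theory Submission
  imports Defs "HOL-Analysis.Bounded_Linear_Function" "HOL-Computational_Algebra.Formal_Power_Series"
begin

text \<open>Let \<open>s\<close> be the square root of \<open>b\<close>, scaled to \<open>0 \<le> s \<le> 1\<close>, and let \<open>x\<close>, \<open>y\<close> be vectors. The
  Bernstein operators \<open>B\<^sub>i = (n choose i) s\<^sup>i (1 - s)\<^sup>n\<^sup>-\<^sup>i\<close> are positive with sum \<open>1\<close> and variance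
  \<open>\<Sum>\<^sub>i B\<^sub>i (s - i/n)\<^sup>2 = s (1 - s) / n\<close>. Hence the map \<open>V\<close> that sends the \<open>i\<close>-th basis vector of
  \<open>\<complex>\<^sup>n\<^sup>+\<^sup>1\<close> to \<open>B\<^sub>i x\<close>, divided by the square root of \<open>\<langle>B\<^sub>i x, x\<rangle>\<close>, is a contraction whose image of
  the unit ball contains \<open>x\<close> if \<open>x\<close> is in the unit ball, and \<open>s V - V d\<close> has norm at most
  \<open>1 / sqrt n\<close> for the diagonal matrix \<open>d\<close> with entries \<open>i/n\<close>. With the analogous map \<open>W\<close> for \<open>y\<close>,
  the matrices \<open>W\<^sup>* a V\<close> and \<open>d\<^sup>2\<close> satisfy the hypothesis of the implication, and up to
  \<open>O(1 / sqrt n)\<close> their commutators are the compressions of \<open>a b - b a\<close> and \<open>a s - s a\<close>.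

  Only a positive semidefinite form is needed, without completeness. In a C*-algebra it is the form
  \<open>\<phi>(v\<^sup>* u)\<close> of a state \<open>\<phi>\<close> of the unitization with \<open>\<phi>(z\<^sup>* z) = \<parallel>z\<parallel>\<^sup>2\<close> for \<open>z = a s - s a\<close>.\<close>

text \<open>The obstacle is that square roots do not survive compression: the root of a compressed
  \<open>b\<close> is in general not the compression of its root. The discretization must make
  \<open>s\<close> and \<open>s\<^sup>2\<close> approximately diagonal at the same time, so that the
  hypothesis for the matrix \<open>d\<^sup>2\<close> speaks about \<open>d\<close> and hence about
  \<open>s\<close>. Spectral projections of \<open>s\<close> would do this, but a C*-algebra need
  not contain them; Bernstein operators are polynomials in \<open>s\<close>, and moving factors
  across the form derives their positivity from \<open>0 \<le> s \<le> 1\<close>. The nodes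
  \<open>i/n\<close> are distinct and nonnegative, so the root of \<open>d\<^sup>2\<close> is
  \<open>d\<close> by an elementary argument. Since \<open>n\<close> tends to infinity for fixed
  \<open>x\<close> and \<open>y\<close>, one constant has to serve all matrix sizes.

  The roots of \<open>b\<close> are definite descriptions, so existence and uniqueness have to be
  proved. Existence comes from the power series of \<open>sqrt (1 - t)\<close> on the closed unit
  ball, uniqueness from the fact that its sum commutes with whatever commutes with \<open>t\<close>.
  In a C*-algebra, uniqueness and the forms of states also rest on the positivity of
  \<open>star x * x\<close>.\<close>

unbundle no vec_syntax and no fps_syntax
hide_const (open) Finite_Cartesian_Product.mat Finite_Cartesian_Product.vec
hide_type (open) Finite_Cartesian_Product.vec

section \<open>Matrices\<close>

abbreviation l2norm :: "nat \<Rightarrow> (nat \<Rightarrow> complex) \<Rightarrow> real" where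
  "l2norm N c \<equiv> L2_set (\<lambda>i. cmod (c i)) {..<N}"

text \<open>Norm estimates for matrices all go through this form: \<open>mat_opnorm_le\<close> and
  \<open>mat_form_le_opnorm\<close> translate between bounds for it and \<open>mat_opnorm\<close>.
  Coefficient families are plain functions, which suits sums over Bernstein operators.\<close>

abbreviation mat_form :: "nat \<Rightarrow> complex mat \<Rightarrow> (nat \<Rightarrow> complex) \<Rightarrow> (nat \<Rightarrow> complex) \<Rightarrow> complex" where
  "mat_form N M c d \<equiv> (\<Sum>j<N. \<Sum>k<N. M $$ (j, k) * c k * cnj (d j))"

lemma cvec_norm_eq_L2_set: "cvec_norm v = L2_set (\<lambda>i. cmod (v $ i)) {..<dim_vec v}"
proof -
  have "v \<bullet>c v = (\<Sum>i<dim_vec v. complex_of_real ((cmod (v $ i))\<^sup>2))"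
    unfolding scalar_prod_def
    by (intro sum.cong) (auto simp: lessThan_atLeast0 complex_mult_cnj cmod_power2)
  then show ?thesis
    by (simp add: cvec_norm_def L2_set_def flip: of_real_sum)
qed

lemma norm_sum_mult_le_L2_set:
  fixes f g :: "'i \<Rightarrow> complex"
  shows "cmod (\<Sum>i\<in>I. f i * g i) \<le> L2_set (\<lambda>i. cmod (f i)) I * L2_set (\<lambda>i. cmod (g i)) I"
proof -
  have "cmod (\<Sum>i\<in>I. f i * g i) \<le> (\<Sum>i\<in>I. \<bar>cmod (f i)\<bar> * \<bar>cmod (g i)\<bar>)"
    by (rule order_trans[OF norm_sum]) (simp add: norm_mult)
  also have "\<dots> \<le> L2_set (\<lambda>i. cmod (f i)) I * L2_set (\<lambda>i. cmod (g i)) I"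
    by (rule L2_set_mult_ineq)
  finally show ?thesis .
qed

lemma mult_mat_vec_index_sum:
  assumes "M \<in> carrier_mat N N" "v \<in> carrier_vec N" "j < N"
  shows "(M *\<^sub>v v) $ j = (\<Sum>k<N. M $$ (j, k) * v $ k)"
  using assms by (auto simp: scalar_prod_def lessThan_atLeast0 intro!: sum.cong)

lemma mat_form_eq:
  assumes "M \<in> carrier_mat N N" "v \<in> carrier_vec N"
  shows "mat_form N M (\<lambda>i. v $ i) d = (\<Sum>j<N. (M *\<^sub>v v) $ j * cnj (d j))"
  using assms by (simp add: mult_mat_vec_index_sum sum_distrib_right del: index_mult_mat_vec)

lemma mat_form_cong:
  assumes "\<And>i. i < N \<Longrightarrow> c i = c' i" "\<And>i. i < N \<Longrightarrow> d i = d' i"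
  shows "mat_form N M c d = mat_form N M c' d'"
  using assms by (intro sum.cong) auto

text \<open>The choice \<open>d = M v\<close> in the form bound gives
  \<open>|M v|\<^sup>2 \<le> K |v| |M v|\<close>, and one factor cancels.\<close>

lemma mat_opnorm_le:
  assumes M: "M \<in> carrier_mat N N" and K: "K \<ge> 0"
    and form: "\<And>c d. cmod (mat_form N M c d) \<le> K * l2norm N c * l2norm N d"
  shows "mat_opnorm M \<le> K"
  unfolding mat_opnorm_def
proof (rule cSup_least)
  have "0\<^sub>v N \<in> carrier_vec (dim_col M)" using M by auto
  moreover have "cvec_norm (0\<^sub>v N) \<le> 1" by (simp add: cvec_norm_eq_L2_set L2_set_def)
  ultimately show "{cvec_norm (M *\<^sub>v v) |v. v \<in> carrier_vec (dim_col M) \<and> cvec_norm v \<le> 1} \<noteq> {}"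
    by blast
next
  fix r assume "r \<in> {cvec_norm (M *\<^sub>v v) |v. v \<in> carrier_vec (dim_col M) \<and> cvec_norm v \<le> 1}"
  then obtain v where r: "r = cvec_norm (M *\<^sub>v v)" and v: "v \<in> carrier_vec N" "cvec_norm v \<le> 1"
    using M by auto
  let ?w = "\<lambda>j. (M *\<^sub>v v) $ j"
  have r': "r = l2norm N ?w"
    using M by (simp add: r cvec_norm_eq_L2_set)
  have vn: "l2norm N (\<lambda>i. v $ i) \<le> 1"
    using v by (simp add: cvec_norm_eq_L2_set)
  have "mat_form N M (\<lambda>i. v $ i) ?w = (\<Sum>j<N. ?w j * cnj (?w j))"
    by (rule mat_form_eq[OF M v(1)])
  also have "\<dots> = (\<Sum>j<N. complex_of_real ((cmod (?w j))\<^sup>2))"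
    by (simp add: complex_mult_cnj cmod_power2)
  also have "\<dots> = complex_of_real (r\<^sup>2)"
    by (simp add: r' L2_set_def sum_nonneg)
  finally have "r\<^sup>2 \<le> K * l2norm N (\<lambda>i. v $ i) * l2norm N ?w"
    using form[of "\<lambda>i. v $ i" ?w] by (simp add: norm_power)
  also have "\<dots> \<le> K * 1 * r"
    unfolding r'[symmetric] using K vn r' by (intro mult_mono) (auto simp: L2_set_nonneg)
  finally have "r * r \<le> K * r" by (simp add: power2_eq_square)
  moreover have "r \<ge> 0" by (simp add: r')
  ultimately show "r \<le> K" using K
    by (cases "r = 0") (auto simp: mult_le_cancel_right)
qed

lemma mat_form_le_opnorm:
  assumes M: "M \<in> carrier_mat N N"
    and c: "l2norm N c \<le> 1" and d: "l2norm N d \<le> 1"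
  shows "cmod (mat_form N M c d) \<le> mat_opnorm M"
proof -
  let ?S = "{cvec_norm (M *\<^sub>v v) |v. v \<in> carrier_vec (dim_col M) \<and> cvec_norm v \<le> 1}"
  \<comment> \<open>The supremum dominates its set only if the set is bounded; the sum of the moduli
    of all entries is a crude bound.\<close>
  have bdd: "bdd_above ?S"
  proof (rule bdd_aboveI)
    fix r assume "r \<in> ?S"
    then obtain v where r: "r = cvec_norm (M *\<^sub>v v)" and v: "v \<in> carrier_vec N" "cvec_norm v \<le> 1"
      using M by auto
    have vk: "cmod (v $ k) \<le> 1" if "k < N" for k
      using member_le_L2_set[of "{..<N}" k "\<lambda>i. cmod (v $ i)"] v that by (simp add: cvec_norm_eq_L2_set)
    have "r \<le> (\<Sum>j<N. \<bar>cmod ((M *\<^sub>v v) $ j)\<bar>)"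
      using M L2_set_le_sum[of "{..<N}" "\<lambda>j. cmod ((M *\<^sub>v v) $ j)"]
      by (simp add: r cvec_norm_eq_L2_set del: index_mult_mat_vec)
    also have "\<dots> \<le> (\<Sum>j<N. \<Sum>k<N. cmod (M $$ (j, k)))"
    proof (rule sum_mono)
      fix j assume j: "j \<in> {..<N}"
      have "\<bar>cmod ((M *\<^sub>v v) $ j)\<bar> \<le> (\<Sum>k<N. cmod (M $$ (j, k) * v $ k))"
        using j mult_mat_vec_index_sum[OF M v(1), of j] by (simp add: norm_sum)
      also have "\<dots> \<le> (\<Sum>k<N. cmod (M $$ (j, k)))"
        using vk by (intro sum_mono) (auto simp: norm_mult intro: mult_left_le)
      finally show "\<bar>cmod ((M *\<^sub>v v) $ j)\<bar> \<le> (\<Sum>k<N. cmod (M $$ (j, k)))" .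
    qed
    finally show "r \<le> (\<Sum>j<N. \<Sum>k<N. cmod (M $$ (j, k)))" .
  qed
  let ?v = "vec N c"
  have v: "?v \<in> carrier_vec N" by simp
  have "cvec_norm ?v = l2norm N c"
    unfolding cvec_norm_eq_L2_set by (intro L2_set_cong) auto
  then have mem: "cvec_norm (M *\<^sub>v ?v) \<in> ?S" using M c by fastforce
  have "mat_form N M c d = mat_form N M (\<lambda>i. ?v $ i) d"
    by (rule mat_form_cong) auto
  also have "\<dots> = (\<Sum>j<N. (M *\<^sub>v ?v) $ j * cnj (d j))"
    by (rule mat_form_eq[OF M v])
  finally have "cmod (mat_form N M c d) \<le> l2norm N (\<lambda>j. (M *\<^sub>v ?v) $ j) * l2norm N d"
    using norm_sum_mult_le_L2_set[of "\<lambda>j. (M *\<^sub>v ?v) $ j" "\<lambda>j. cnj (d j)" "{..<N}"] by simp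
  also have "\<dots> = cvec_norm (M *\<^sub>v ?v) * l2norm N d"
    using M by (simp add: cvec_norm_eq_L2_set)
  also have "\<dots> \<le> cvec_norm (M *\<^sub>v ?v) * 1"
    using d by (intro mult_left_mono) (auto simp: cvec_norm_eq_L2_set)
  also have "\<dots> \<le> mat_opnorm M"
    unfolding mat_opnorm_def using cSup_upper[OF mem bdd] by simp
  finally show ?thesis .
qed

section \<open>Real diagonal matrices and their square roots\<close>

definition real_diag_mat :: "nat \<Rightarrow> (nat \<Rightarrow> real) \<Rightarrow> complex mat" where
  "real_diag_mat N g = mat N N (\<lambda>(i, j). if i = j then complex_of_real (g i) else 0)"

lemma real_diag_mat_carrier [simp]: "real_diag_mat N g \<in> carrier_mat N N"
  by (simp add: real_diag_mat_def)

lemma real_diag_mat_dim [simp]: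
  "dim_row (real_diag_mat N g) = N" "dim_col (real_diag_mat N g) = N"
  by (simp_all add: real_diag_mat_def)

lemma mult_mat_index_sum:
  assumes "A \<in> carrier_mat N N" "B \<in> carrier_mat N N" "j < N" "k < N"
  shows "(A * B) $$ (j, k) = (\<Sum>i<N. A $$ (j, i) * B $$ (i, k))"
  using assms by (auto simp: scalar_prod_def lessThan_atLeast0 intro!: sum.cong)

lemma mult_real_diag_mat_index:
  assumes "A \<in> carrier_mat N N" "j < N" "k < N"
  shows "(A * real_diag_mat N g) $$ (j, k) = A $$ (j, k) * g k"
proof -
  have "(A * real_diag_mat N g) $$ (j, k) = (\<Sum>i<N. if i = k then A $$ (j, k) * g k else 0)"
    unfolding mult_mat_index_sum[OF assms(1) real_diag_mat_carrier assms(2,3)]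
    using assms by (intro sum.cong) (auto simp: real_diag_mat_def)
  then show ?thesis using assms by (simp add: sum.delta)
qed

lemma real_diag_mat_mult_index:
  assumes "A \<in> carrier_mat N N" "j < N" "k < N"
  shows "(real_diag_mat N g * A) $$ (j, k) = g j * A $$ (j, k)"
proof -
  have "(real_diag_mat N g * A) $$ (j, k) = (\<Sum>i<N. if i = j then g j * A $$ (j, k) else 0)"
    unfolding mult_mat_index_sum[OF real_diag_mat_carrier assms]
    using assms by (intro sum.cong) (auto simp: real_diag_mat_def)
  then show ?thesis using assms by (simp add: sum.delta)
qed

lemma mat_psd_real_diag_mat:
  assumes "\<And>i. i < N \<Longrightarrow> 0 \<le> g i"
  shows "mat_psd (real_diag_mat N g)"
  unfolding mat_psd_def
proof (intro conjI ballI)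
  fix v :: "complex vec" assume "v \<in> carrier_vec (dim_row (real_diag_mat N g))"
  then have v: "v \<in> carrier_vec N" by simp
  have "(real_diag_mat N g *\<^sub>v v) $ j = g j * v $ j" if "j < N" for j
  proof -
    have "(real_diag_mat N g *\<^sub>v v) $ j = (\<Sum>k<N. if k = j then g j * v $ j else 0)"
      unfolding mult_mat_vec_index_sum[OF real_diag_mat_carrier v that]
      using that by (intro sum.cong) (auto simp: real_diag_mat_def)
    then show ?thesis using that by (simp add: sum.delta)
  qed
  then have "(real_diag_mat N g *\<^sub>v v) \<bullet>c v = (\<Sum>j<N. complex_of_real (g j * (cmod (v $ j))\<^sup>2))"
    unfolding scalar_prod_def using v
    by (intro sum.cong)
      (auto simp: lessThan_atLeast0 complex_mult_cnj cmod_power2 mult.assoc simp del: index_mult_mat_vec)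
  also have "\<dots> \<ge> 0"
    using assms by (auto intro!: sum_nonneg simp: less_eq_complex_def)
  finally show "0 \<le> (real_diag_mat N g *\<^sub>v v) \<bullet>c v" .
qed simp

lemma mat_psd_diag_nonneg:
  assumes "mat_psd S" "S \<in> carrier_mat N N" "j < N"
  shows "0 \<le> S $$ (j, j)"
proof -
  have "(S *\<^sub>v unit_vec N j) \<bullet>c unit_vec N j = S $$ (j, j)"
  proof -
    have "conjugate (unit_vec N j :: complex vec) = unit_vec N j"
      using assms(3) by (intro eq_vecI) (auto simp: unit_vec_def)
    then show ?thesis using assms(2,3) by simp
  qed
  then show ?thesis using assms unfolding mat_psd_def by (metis carrier_matD(1) unit_vec_carrier)
qed

text \<open>A root \<open>S\<close> commutes with its square, a diagonal matrix with distinct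
  entries, so \<open>S\<close> is diagonal; being positive semidefinite, it has the nonnegative
  roots of \<open>(g i)\<^sup>2\<close> on the diagonal.\<close>

lemma mat_sqrt_real_diag_mat:
  assumes g: "\<And>i. i < N \<Longrightarrow> 0 \<le> g i" and inj: "inj_on g {..<N}"
  shows "mat_sqrt (real_diag_mat N (\<lambda>i. (g i)\<^sup>2)) = real_diag_mat N g"
  unfolding mat_sqrt_def
proof (rule the_equality)
  let ?D = "real_diag_mat N (\<lambda>i. (g i)\<^sup>2)"
  show "real_diag_mat N g \<in> carrier_mat (dim_row ?D) (dim_row ?D) \<and> mat_psd (real_diag_mat N g)
    \<and> real_diag_mat N g * real_diag_mat N g = ?D"
  proof (intro conjI)
    show "real_diag_mat N g * real_diag_mat N g = ?D"
      by (rule eq_matI)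
        (auto simp: real_diag_mat_mult_index[OF real_diag_mat_carrier] power2_eq_square
          simp del: index_mult_mat(1),
         auto simp: real_diag_mat_def power2_eq_square)
  qed (simp_all add: mat_psd_real_diag_mat g)
  fix S assume "S \<in> carrier_mat (dim_row ?D) (dim_row ?D) \<and> mat_psd S \<and> S * S = ?D"
  then have S: "S \<in> carrier_mat N N" and psd: "mat_psd S" and SS: "S * S = ?D"
    by auto
  have comm: "S * ?D = ?D * S"
    unfolding SS[symmetric] by (simp add: assoc_mult_mat[OF S S S])
  have off: "S $$ (j, k) = 0" if "j < N" "k < N" "j \<noteq> k" for j k
  proof -
    have "S $$ (j, k) * (g k)\<^sup>2 = (g j)\<^sup>2 * S $$ (j, k)"
      using mult_real_diag_mat_index[OF S that(1,2)] real_diag_mat_mult_index[OF S that(1,2)] comm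
      by (metis of_real_power)
    then have "S $$ (j, k) = 0 \<or> complex_of_real ((g k)\<^sup>2) = complex_of_real ((g j)\<^sup>2)"
      by (auto simp: mult.commute)
    moreover have "(g k)\<^sup>2 \<noteq> (g j)\<^sup>2"
      using g[of j] g[of k] inj that by (auto simp: power2_eq_iff inj_on_def)
    ultimately show ?thesis using of_real_eq_iff by blast
  qed
  have dg: "S $$ (j, j) = g j" if j: "j < N" for j
  proof -
    have "complex_of_real ((g j)\<^sup>2) = (S * S) $$ (j, j)"
      using j by (simp add: SS real_diag_mat_def)
    also have "\<dots> = (\<Sum>i<N. if i = j then S $$ (j, j) * S $$ (j, j) else 0)"
      unfolding mult_mat_index_sum[OF S S j j] using off j by (intro sum.cong) auto
    finally have "complex_of_real ((g j)\<^sup>2) = (S $$ (j, j))\<^sup>2"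
      using j by (simp add: power2_eq_square)
    moreover obtain r where r: "S $$ (j, j) = complex_of_real r" "r \<ge> 0"
      using mat_psd_diag_nonneg[OF psd S j]
      by (metis complex_is_Real_iff less_eq_complex_def of_real_Re zero_complex.simps)
    ultimately have "(g j)\<^sup>2 = r\<^sup>2" by (metis of_real_eq_iff of_real_power)
    then show ?thesis using r g[OF j] by (simp add: power2_eq_iff_nonneg)
  qed
  show "S = real_diag_mat N g"
    using S off dg by (intro eq_matI) (auto simp: real_diag_mat_def)
qed

section \<open>The hypothesis and its case of a diagonal matrix\<close>

definition matrix_commutator_bound :: "real \<Rightarrow> bool" where
  "matrix_commutator_bound C \<longleftrightarrow> (\<forall>(n::nat) a b. a \<in> carrier_mat n n \<longrightarrow> b \<in> carrier_mat n n \<longrightarrow>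
      mat_opnorm a \<le> 1 \<longrightarrow> mat_psd b \<longrightarrow>
      mat_opnorm (a * mat_sqrt b - mat_sqrt b * a) \<le> C * sqrt (mat_opnorm (a * b - b * a)))"

definition diag_commutator :: "nat \<Rightarrow> complex mat \<Rightarrow> (nat \<Rightarrow> real) \<Rightarrow> complex mat" where
  "diag_commutator N a g = a * real_diag_mat N g - real_diag_mat N g * a"

lemma diag_commutator_carrier:
  "a \<in> carrier_mat N N \<Longrightarrow> diag_commutator N a g \<in> carrier_mat N N"
  unfolding diag_commutator_def by (metis minus_carrier_mat mult_carrier_mat real_diag_mat_carrier)

lemma diag_commutator_index:
  assumes "a \<in> carrier_mat N N" "j < N" "k < N"
  shows "diag_commutator N a g $$ (j, k) = a $$ (j, k) * (g k - g j)"
  using assms mult_real_diag_mat_index[OF assms] real_diag_mat_mult_index[OF assms]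
  by (simp add: diag_commutator_def algebra_simps del: index_mult_mat(1))

lemma mat_form_diag_commutator:
  assumes "a \<in> carrier_mat N N"
  shows "mat_form N (diag_commutator N a g) c d
    = mat_form N a (\<lambda>k. g k * c k) d - mat_form N a c (\<lambda>j. g j * d j)"
  unfolding sum_subtractf[symmetric]
  using assms by (intro sum.cong) (auto simp: diag_commutator_index algebra_simps)

lemma matrix_commutator_bound_diag:
  assumes "matrix_commutator_bound C" "a \<in> carrier_mat N N" "mat_opnorm a \<le> 1"
    and g: "\<And>i. i < N \<Longrightarrow> 0 \<le> g i" "inj_on g {..<N}"
  shows "mat_opnorm (diag_commutator N a g)
    \<le> C * sqrt (mat_opnorm (diag_commutator N a (\<lambda>i. (g i)\<^sup>2)))"
proof -
  have "mat_psd (real_diag_mat N (\<lambda>i. (g i)\<^sup>2))" by (simp add: mat_psd_real_diag_mat)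
  then show ?thesis
    using assms(1-3) mat_sqrt_real_diag_mat[OF g] unfolding matrix_commutator_bound_def
    by (metis diag_commutator_def real_diag_mat_carrier)
qed

text \<open>Needed to replace the commutator norm under the root by an upper bound. One instance
  with nonzero commutators decides the sign: the matrix unit at position \<open>(0, 1)\<close>
  against the diagonal matrix with entries 0 and 1.\<close>

lemma matrix_commutator_bound_nonneg:
  assumes "matrix_commutator_bound C"
  shows "0 \<le> C"
proof -
  define a :: "complex mat" where "a = mat 2 2 (\<lambda>(j, k). if j = 0 \<and> k = 1 then 1 else 0)"
  define g :: "nat \<Rightarrow> real" where "g = real"
  have a: "a \<in> carrier_mat 2 2" by (simp add: a_def)
  have two: "{..<2::nat} = {0, 1}" by auto
  have form: "mat_form 2 a c d = c 1 * cnj (d 0)" for c d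
    by (simp add: a_def two)
  have le: "cmod (mat_form 2 a c d) \<le> 1 * l2norm 2 c * l2norm 2 d" for c d
    using member_le_L2_set[of "{..<2}" 1 "\<lambda>i. cmod (c i)"] member_le_L2_set[of "{..<2}" 0 "\<lambda>i. cmod (d i)"]
    by (simp add: form norm_mult mult_mono del: One_nat_def)
  have "mat_opnorm a \<le> 1" by (rule mat_opnorm_le[OF a _ le]) simp
  moreover have "inj_on g {..<2}" by (simp add: g_def inj_on_def)
  ultimately have bd: "mat_opnorm (diag_commutator 2 a g)
      \<le> C * sqrt (mat_opnorm (diag_commutator 2 a (\<lambda>i. (g i)\<^sup>2)))"
    using assms a by (intro matrix_commutator_bound_diag) (auto simp: g_def)
  define c d :: "nat \<Rightarrow> complex" where "c = (\<lambda>i. if i = 1 then 1 else 0)"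
    and "d = (\<lambda>i. if i = 0 then 1 else 0)"
  have nrm: "l2norm 2 c \<le> 1" "l2norm 2 d \<le> 1" by (simp_all add: c_def d_def two L2_set_def)
  have pos: "1 \<le> mat_opnorm (diag_commutator 2 a h)" if "h 1 = 1" "h 0 = 0" for h
  proof -
    have "mat_form 2 (diag_commutator 2 a h) c d = 1"
      unfolding mat_form_diag_commutator[OF a] form by (simp add: c_def d_def that that[unfolded One_nat_def])
    then show ?thesis
      using mat_form_le_opnorm[OF diag_commutator_carrier[OF a] nrm, of h] by simp
  qed
  have "1 \<le> C * sqrt (mat_opnorm (diag_commutator 2 a (\<lambda>i. (g i)\<^sup>2)))"
    using bd pos[of g] by (simp add: g_def)
  moreover have "1 \<le> sqrt (mat_opnorm (diag_commutator 2 a (\<lambda>i. (g i)\<^sup>2)))"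
    using pos[of "\<lambda>i. (g i)\<^sup>2"] by (simp add: g_def)
  ultimately show ?thesis
    by (smt (verit) mult_nonpos_nonneg)
qed

section \<open>Semi-inner products\<close>

text \<open>Continuity is left out on purpose: estimates are made in the seminorm of a form, which
  need not be comparable with the norm of the type.\<close>

definition clinear_map :: "('v::complex_banach \<Rightarrow> 'v) \<Rightarrow> bool" where
  "clinear_map f \<longleftrightarrow> (\<forall>x y. f (x + y) = f x + f y) \<and> (\<forall>c x. f (c *\<^sub>C x) = c *\<^sub>C f x)"

lemma clinear_map_linear: "clinear_map f \<Longrightarrow> linear f"
  by (rule linearI) (auto simp: clinear_map_def scaleR_scaleC)

lemma scaleC_zero_right [simp]: "c *\<^sub>C (0::'a::complex_banach) = 0"
  using scaleC_add_right[of c 0 "0::'a"] by simp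

lemma scaleC_zero_left [simp]: "0 *\<^sub>C (x::'a::complex_banach) = 0"
  using scaleC_add_left[of 0 0 x] by simp

lemma scaleC_one [simp]: "1 *\<^sub>C (x::'a::complex_banach) = x"
  using scaleR_scaleC[of 1 x] by simp

lemma scaleC_minus_right: "c *\<^sub>C (- x) = - (c *\<^sub>C (x::'a::complex_banach))"
  using scaleC_add_right[of c x "- x"] by (simp add: add_eq_0_iff)

lemma scaleC_diff_right: "c *\<^sub>C (x - y) = c *\<^sub>C x - c *\<^sub>C (y::'a::complex_banach)"
  using scaleC_add_right[of c x "- y"] by (simp add: scaleC_minus_right)

lemma scaleC_minus_left: "(- c) *\<^sub>C x = - (c *\<^sub>C (x::'a::complex_banach))"
  using scaleC_add_left[of c "- c" x] by (simp add: add_eq_0_iff)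

lemma scaleC_scaleR: "c *\<^sub>C (r *\<^sub>R x) = r *\<^sub>R (c *\<^sub>C (x::'a::complex_banach))"
  by (simp add: scaleR_scaleC scaleC_scaleC mult.commute)

lemma bounded_linear_scaleC: "bounded_linear (\<lambda>x. c *\<^sub>C x :: 'a::complex_banach)"
proof
  show "\<exists>K. \<forall>x. norm (c *\<^sub>C x :: 'a) \<le> norm x * K"
    by (intro exI[of _ "cmod c"]) (simp add: norm_scaleC mult.commute)
qed (simp_all add: scaleC_add_right scaleC_scaleR)

text \<open>The type class only supplies the vector space operations. The locale covers the inner
  product of a Hilbert space, the forms of states, and the auxiliary forms
  \<open>ip (bern n i x) y\<close> and \<open>cinner (f x) y\<close>.\<close>

locale csemi_inner =
  fixes ip :: "'v::complex_banach \<Rightarrow> 'v \<Rightarrow> complex"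
  assumes ip_commute: "ip x y = cnj (ip y x)"
    and ip_add_left: "ip (x + y) z = ip x z + ip y z"
    and ip_scaleC_left: "ip (c *\<^sub>C x) y = c * ip x y"
    and ip_ge_zero: "0 \<le> Re (ip x x)"
begin

lemma ip_add_right: "ip x (y + z) = ip x y + ip x z"
  by (metis complex_cnj_add ip_add_left ip_commute)

lemma ip_scaleC_right: "ip x (c *\<^sub>C y) = cnj c * ip x y"
  by (metis complex_cnj_mult ip_scaleC_left ip_commute)

lemma ip_scaleR_left: "ip (r *\<^sub>R x) y = of_real r * ip x y"
  by (simp add: scaleR_scaleC ip_scaleC_left)

lemma ip_scaleR_right: "ip x (r *\<^sub>R y) = of_real r * ip x y"
  by (simp add: scaleR_scaleC ip_scaleC_right)

lemma ip_zero_left [simp]: "ip 0 y = 0"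
  using ip_scaleC_left[of 0 0 y] by simp

lemma ip_zero_right [simp]: "ip y 0 = 0"
  using ip_scaleC_right[of y 0 0] by simp

lemma ip_minus_left: "ip (- x) y = - ip x y"
  using ip_scaleR_left[of "-1" x y] by simp

lemma ip_minus_right: "ip x (- y) = - ip x y"
  using ip_scaleR_right[of x "-1" y] by simp

lemma ip_diff_left: "ip (x - y) z = ip x z - ip y z"
  using ip_add_left[of x "- y" z] by (simp add: ip_minus_left)

lemma ip_diff_right: "ip x (y - z) = ip x y - ip x z"
  using ip_add_right[of x y "- z"] by (simp add: ip_minus_right)

lemma ip_sum_left: "ip (sum f A) y = (\<Sum>i\<in>A. ip (f i) y)"
  by (induction A rule: infinite_finite_induct) (auto simp: ip_add_left)

lemma ip_sum_right: "ip y (sum f A) = (\<Sum>i\<in>A. ip y (f i))"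
  by (induction A rule: infinite_finite_induct) (auto simp: ip_add_right)

lemma ip_self: "ip x x = of_real (Re (ip x x))"
proof -
  have "ip x x = cnj (ip x x)" by (rule ip_commute)
  then have "Im (ip x x) = 0" by (metis complex_cnj_cancel_iff complex_is_Real_iff Reals_cnj_iff)
  then show ?thesis by (simp add: complex_eq_iff)
qed

definition sn :: "'v \<Rightarrow> real" where
  "sn x = sqrt (Re (ip x x))"

lemma sn_nonneg [simp]: "0 \<le> sn x"
  by (simp add: sn_def ip_ge_zero)

lemma sn_squared: "(sn x)\<^sup>2 = Re (ip x x)"
  by (simp add: sn_def ip_ge_zero)

lemma cauchy_schwarz: "cmod (ip x y) \<le> sn x * sn y"
proof -
  let ?p = "Re (ip x x)" and ?q = "Re (ip y y)" and ?z = "ip x y"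
  \<comment> \<open>This is the form at \<open>x - t z y\<close> with \<open>z = ip x y\<close>, as
    a quadratic polynomial in the real number \<open>t\<close>.\<close>
  have quad: "0 \<le> ?p - 2 * t * (cmod ?z)\<^sup>2 + t\<^sup>2 * (cmod ?z)\<^sup>2 * ?q" for t :: real
  proof -
    define c where "c = - complex_of_real t * ?z"
    have "ip (x + c *\<^sub>C y) (x + c *\<^sub>C y) = ip x x + cnj c * ?z + c * cnj ?z + c * cnj c * ip y y"
      using ip_commute[of y x]
      by (simp add: ip_add_left ip_add_right ip_scaleC_left ip_scaleC_right algebra_simps)
    then have "Re (ip (x + c *\<^sub>C y) (x + c *\<^sub>C y))
        = ?p + Re (cnj c * ?z) + Re (c * cnj ?z) + Re (c * cnj c * ip y y)"
      by (simp only: plus_complex.simps)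
    moreover have "Re (cnj c * ?z) = - t * (cmod ?z)\<^sup>2" "Re (c * cnj ?z) = - t * (cmod ?z)\<^sup>2"
      unfolding cmod_power2 by (simp_all add: c_def power2_eq_square algebra_simps)
    moreover have "Re (c * cnj c * ip y y) = t\<^sup>2 * (cmod ?z)\<^sup>2 * ?q"
    proof -
      have "c * cnj c = of_real (t\<^sup>2 * (cmod ?z)\<^sup>2)"
        unfolding complex_mult_cnj cmod_power2 by (simp add: c_def power2_eq_square algebra_simps)
      then show ?thesis by simp
    qed
    ultimately show ?thesis using ip_ge_zero[of "x + c *\<^sub>C y"] by linarith
  qed
  have "(cmod ?z)\<^sup>2 \<le> ?p * ?q"
  \<comment> \<open>The form may be degenerate. For \<open>?q = 0\<close> the polynomial is affine
    in \<open>t\<close>, and a large \<open>t\<close> refutes a nonzero \<open>ip x y\<close>;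
    otherwise its minimum is at \<open>1 / ?q\<close>.\<close>
  proof (cases "?q = 0")
    case True
    have "(cmod ?z)\<^sup>2 = 0"
    proof (rule ccontr)
      assume "(cmod ?z)\<^sup>2 \<noteq> 0"
      then show False using quad[of "(?p + 1) / (cmod ?z)\<^sup>2"] True ip_ge_zero[of x] by simp
    qed
    then show ?thesis using True by simp
  next
    case False
    then have q: "?q > 0" using ip_ge_zero[of y] by simp
    show ?thesis using quad[of "1 / ?q"] q by (simp add: field_simps power2_eq_square)
  qed
  then have "(cmod ?z)\<^sup>2 \<le> (sn x * sn y)\<^sup>2" by (simp add: power_mult_distrib sn_squared)
  then show ?thesis by (rule power2_le_imp_le) simp
qed

lemma sn_scaleC: "sn (c *\<^sub>C x) = cmod c * sn x"
proof -
  have Re_of_real_mult: "Re (complex_of_real r * z) = r * Re z" for r z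
    by simp
  have "c * cnj c = complex_of_real ((cmod c)\<^sup>2)" by (simp add: complex_mult_cnj cmod_power2)
  moreover have "ip (c *\<^sub>C x) (c *\<^sub>C x) = (c * cnj c) * ip x x"
    by (simp only: ip_scaleC_left ip_scaleC_right mult_ac)
  ultimately have "Re (ip (c *\<^sub>C x) (c *\<^sub>C x)) = (cmod c)\<^sup>2 * Re (ip x x)"
    by (simp only: Re_of_real_mult)
  then show ?thesis by (simp add: sn_def real_sqrt_mult)
qed

text \<open>Testing with \<open>h = x\<close> is enough. The maps built from Bernstein operators are
  estimated through their pairings, so the bounds below arrive in this form.\<close>

lemma sn_leI:
  assumes "\<And>h. cmod (ip x h) \<le> K * sn h" "0 \<le> K"
  shows "sn x \<le> K"
proof -
  have "cmod (ip x x) = (sn x)\<^sup>2"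
    using ip_ge_zero[of x] by (subst ip_self) (simp only: norm_of_real sn_squared abs_of_nonneg)
  then have "sn x * sn x \<le> K * sn x"
    using assms(1)[of x] by (simp add: power2_eq_square)
  then show ?thesis
    using assms(2) sn_nonneg[of x] by (cases "sn x = 0") (auto simp: mult_le_cancel_right)
qed

end

section \<open>Positivity of products of a positive contraction and its complement\<close>

locale pos_contraction = csemi_inner +
  fixes S :: "'a::complex_banach \<Rightarrow> 'a"
  assumes S_clinear: "clinear_map S"
    and S_hermitian: "ip (S x) y = ip x (S y)"
    and S_pos: "0 \<le> Re (ip (S x) x)"
    and S_le: "Re (ip (S x) x) \<le> Re (ip x x)"
begin

definition R :: "'a \<Rightarrow> 'a" where
  "R x = x - S x"

lemma S_linear: "linear S"
  by (rule clinear_map_linear[OF S_clinear])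

lemma S_scaleC: "S (c *\<^sub>C x) = c *\<^sub>C S x"
  using S_clinear by (simp add: clinear_map_def)

lemmas S_simps = linear_add[OF S_linear] linear_diff[OF S_linear] linear_cmul[OF S_linear]
  linear_0[OF S_linear] S_scaleC

lemma R_clinear: "clinear_map R"
  by (simp add: clinear_map_def R_def S_simps scaleC_diff_right)

lemma R_linear: "linear R"
  by (rule clinear_map_linear[OF R_clinear])

lemma R_hermitian: "ip (R x) y = ip x (R y)"
  by (simp add: R_def ip_diff_left ip_diff_right S_hermitian)

lemma S_plus_R: "S x + R x = x"
  by (simp add: R_def)

lemma R_pos: "0 \<le> Re (ip (R x) x)"
  using S_le[of x] by (simp add: R_def ip_diff_left)

lemma S_R_commute: "S (R x) = R (S x)"
  by (simp add: R_def S_simps)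

text \<open>Since \<open>S + R = 1\<close>, the product \<open>S R\<close> equals
  \<open>S R S + R S R\<close>, a sum of two positive maps; no square root of \<open>S\<close> is
  involved.\<close>

lemma SR_pos: "0 \<le> Re (ip (S (R x)) x)"
proof -
  have "ip (S (R x)) x = ip (S (R x)) (S x + R x)" by (simp add: S_plus_R)
  also have "\<dots> = ip (R (S x)) (S x) + ip (S (R x)) (R x)" by (simp add: ip_add_right S_R_commute)
  finally show ?thesis using R_pos[of "S x"] S_pos[of "R x"] by simp
qed

text \<open>The square of \<open>sn (S x)\<close> is the form of \<open>S - S R\<close> at
  \<open>x\<close>, which lies below that of \<open>S\<close> by \<open>SR_pos\<close>.\<close>

lemma sn_S_le: "sn (S x) \<le> sn x"
proof -
  have "ip (S (R x)) x = ip (S x) x - ip (S x) (S x)"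
    by (simp add: R_def S_simps ip_diff_left S_hermitian)
  then have "Re (ip (S x) (S x)) \<le> Re (ip x x)" using SR_pos[of x] S_le[of x] by simp
  then show ?thesis by (simp add: sn_def)
qed

lemma S_Rpow: "S ((R ^^ j) x) = (R ^^ j) (S x)"
  by (induction j arbitrary: x) (auto simp: S_R_commute)

lemma R_Spow: "R ((S ^^ i) x) = (S ^^ i) (R x)"
  by (induction i arbitrary: x) (auto simp flip: S_R_commute)

lemma Spow_clinear: "clinear_map (S ^^ i)"
  using S_clinear by (induction i) (auto simp: clinear_map_def)

lemma Rpow_clinear: "clinear_map (R ^^ i)"
  using R_clinear by (induction i) (auto simp: clinear_map_def)

lemma Spow_hermitian: "ip ((S ^^ i) x) y = ip x ((S ^^ i) y)"
  by (induction i arbitrary: x y) (auto simp: S_hermitian funpow_swap1)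

lemma Rpow_hermitian: "ip ((R ^^ i) x) y = ip x ((R ^^ i) y)"
  by (induction i arbitrary: x y) (auto simp: R_hermitian funpow_swap1)

lemma Spow_Rpow: "(S ^^ i) ((R ^^ j) x) = (R ^^ j) ((S ^^ i) x)"
  by (induction i arbitrary: x) (auto simp: S_Rpow)

text \<open>Moving one factor \<open>S\<close> or \<open>R\<close> to the other side of the form
  lowers its exponent by two. What remains are the four maps \<open>1\<close>, \<open>S\<close>,
  \<open>R\<close> and \<open>S R\<close>.\<close>

lemma Spow_Rpow_pos: "0 \<le> Re (ip ((S ^^ i) ((R ^^ j) x)) x)"
proof (induction i arbitrary: x rule: less_induct)
  case (less i)
  show ?case
  proof (cases "i \<ge> 2")
    case True
    then obtain i' where i: "i = Suc (Suc i')" by (metis add_2_eq_Suc le_Suc_ex)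
    have "(S ^^ i) ((R ^^ j) x) = S ((S ^^ i') (S ((R ^^ j) x)))"
      by (simp add: i funpow_swap1)
    then have "ip ((S ^^ i) ((R ^^ j) x)) x = ip ((S ^^ i') (S ((R ^^ j) x))) (S x)"
      by (simp only: S_hermitian)
    also have "\<dots> = ip ((S ^^ i') ((R ^^ j) (S x))) (S x)" by (simp add: S_Rpow)
    finally show ?thesis using less.IH[of i' "S x"] i by simp
  next
    case False
    then have i: "i = 0 \<or> i = 1" by auto
    show ?thesis
    proof (induction j arbitrary: x rule: less_induct)
      case (less j)
      show ?case
      proof (cases "j \<ge> 2")
        case True
        then obtain j' where j: "j = Suc (Suc j')" by (metis add_2_eq_Suc le_Suc_ex)
        have "ip ((S ^^ i) ((R ^^ j) x)) x = ip (R ((S ^^ i) ((R ^^ j') (R x)))) x"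
          by (simp add: j R_Spow funpow_swap1)
        also have "\<dots> = ip ((S ^^ i) ((R ^^ j') (R x))) (R x)" by (rule R_hermitian)
        finally show ?thesis using less.IH[of j' "R x"] j by simp
      next
        case False
        then have "j = 0 \<or> j = 1" by auto
        with i show ?thesis using ip_ge_zero[of x] S_pos[of x] R_pos[of x] SR_pos[of x] by auto
      qed
    qed
  qed
qed

section \<open>Bernstein operators and their binomial moments\<close>

definition bern :: "nat \<Rightarrow> nat \<Rightarrow> 'a \<Rightarrow> 'a" where
  "bern n i x = real (n choose i) *\<^sub>R (S ^^ i) ((R ^^ (n - i)) x)"

lemma bern_clinear: "clinear_map (bern n i)"
  using Spow_clinear[of i] Rpow_clinear[of "n - i"]
  by (auto simp: clinear_map_def bern_def scaleR_add_right scaleC_scaleR)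

lemma bern_hermitian: "ip (bern n i x) y = ip x (bern n i y)"
  by (simp add: bern_def ip_scaleR_left ip_scaleR_right Spow_hermitian Rpow_hermitian Spow_Rpow)

lemma bern_pos: "0 \<le> Re (ip (bern n i x) x)"
  using Spow_Rpow_pos[of i "n - i" x] by (simp add: bern_def ip_scaleR_left)

text \<open>Pascal's rule. It holds beyond \<open>i = n\<close> too, since the vanishing binomial
  coefficient makes the truncated difference \<open>n - i\<close> harmless.\<close>

lemma bern_Suc_Suc: "bern (Suc n) (Suc i) x = S (bern n i x) + R (bern n (Suc i) x)"
proof (cases "Suc i \<le> n")
  case True
  then have "n - i = Suc (n - Suc i)" by simp
  then have "R ((S ^^ Suc i) ((R ^^ (n - Suc i)) x)) = (S ^^ Suc i) ((R ^^ (n - i)) x)"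
    by (simp add: R_Spow flip: S_R_commute)
  then show ?thesis
    by (simp add: bern_def S_simps linear_cmul[OF R_linear] scaleR_left_distrib)
next
  case False
  then show ?thesis
    by (simp add: bern_def binomial_eq_0 S_simps linear_0[OF R_linear])
qed

lemma bern_Suc_0: "bern (Suc n) 0 x = R (bern n 0 x)"
  by (simp add: bern_def)

text \<open>One more Bernoulli trial, with \<open>S\<close> as success and \<open>R\<close> as
  failure probability: success shifts the argument of the weight \<open>g\<close>. The moments below
  follow by induction with the weights \<open>1\<close>, \<open>i\<close> and
  \<open>i\<^sup>2\<close>.\<close>

lemma bern_sum_Suc:
  "(\<Sum>i\<le>Suc n. g i *\<^sub>R bern (Suc n) i x)
    = S (\<Sum>i\<le>n. g (Suc i) *\<^sub>R bern n i x) + R (\<Sum>i\<le>n. g i *\<^sub>R bern n i x)"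
proof -
  have "(\<Sum>i\<le>n. g i *\<^sub>R R (bern n i x)) = (\<Sum>i\<le>Suc n. g i *\<^sub>R R (bern n i x))"
    by (simp add: bern_def binomial_eq_0 linear_0[OF R_linear])
  also have "\<dots> = g 0 *\<^sub>R bern (Suc n) 0 x + (\<Sum>i\<le>n. g (Suc i) *\<^sub>R R (bern n (Suc i) x))"
    by (simp add: sum.atMost_Suc_shift bern_Suc_0 del: sum.atMost_Suc)
  finally show ?thesis
    by (simp add: sum.atMost_Suc_shift bern_Suc_Suc linear_sum[OF S_linear] linear_sum[OF R_linear]
        linear_cmul[OF R_linear] S_simps scaleR_add_right sum.distrib del: sum.atMost_Suc)
qed

lemma bern_sum_one: "(\<Sum>i\<le>n. bern n i x) = x"
proof (induction n)
  case 0
  show ?case by (simp add: bern_def)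
next
  case (Suc n)
  then show ?case using bern_sum_Suc[of "\<lambda>_. 1" n x] by (simp add: S_plus_R del: sum.atMost_Suc)
qed

lemma bern_sum_id: "(\<Sum>i\<le>n. real i *\<^sub>R bern n i x) = real n *\<^sub>R S x"
proof (induction n)
  case 0
  show ?case by (simp add: bern_def)
next
  case (Suc n)
  have "(\<Sum>i\<le>n. real (Suc i) *\<^sub>R bern n i x) = real n *\<^sub>R S x + x"
    by (simp add: scaleR_left_distrib sum.distrib Suc bern_sum_one add.commute)
  then have "(\<Sum>i\<le>Suc n. real i *\<^sub>R bern (Suc n) i x) = S (real n *\<^sub>R S x + x) + R (real n *\<^sub>R S x)"
    unfolding bern_sum_Suc Suc by simp
  also have "\<dots> = (S (real n *\<^sub>R S x) + R (real n *\<^sub>R S x)) + S x"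
    by (simp add: S_simps)
  finally show ?case by (simp only: S_plus_R) (simp add: scaleR_left_distrib add.commute)
qed

text \<open>The second moment \<open>n (n - 1) p\<^sup>2 + n p\<close> of the binomial distribution,
  with \<open>S\<close> in place of \<open>p\<close>.\<close>

lemma bern_sum_square:
  "(\<Sum>i\<le>n. (real i)\<^sup>2 *\<^sub>R bern n i x) = (real n * (real n - 1)) *\<^sub>R S (S x) + real n *\<^sub>R S x"
proof (induction n)
  case 0
  show ?case by (simp add: bern_def)
next
  case (Suc n)
  let ?q = "(real n * (real n - 1)) *\<^sub>R S (S x) + real n *\<^sub>R S x"
  have "(real (Suc i))\<^sup>2 *\<^sub>R bern n i x
      = (real i)\<^sup>2 *\<^sub>R bern n i x + (2 *\<^sub>R (real i *\<^sub>R bern n i x) + bern n i x)" for i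
    by (simp add: power2_eq_square algebra_simps)
  then have "(\<Sum>i\<le>n. (real (Suc i))\<^sup>2 *\<^sub>R bern n i x) = ?q + (2 *\<^sub>R (real n *\<^sub>R S x) + x)"
    by (simp only: sum.distrib Suc bern_sum_one bern_sum_id scaleR_sum_right[symmetric])
  then have "(\<Sum>i\<le>Suc n. (real i)\<^sup>2 *\<^sub>R bern (Suc n) i x)
      = S (?q + (2 *\<^sub>R (real n *\<^sub>R S x) + x)) + R ?q"
    unfolding bern_sum_Suc Suc by simp
  also have "\<dots> = (S ?q + R ?q) + (2 *\<^sub>R (real n *\<^sub>R S (S x)) + S x)"
    by (simp add: S_simps)
  finally have sum: "(\<Sum>i\<le>Suc n. (real i)\<^sup>2 *\<^sub>R bern (Suc n) i x)
      = ?q + (2 *\<^sub>R (real n *\<^sub>R S (S x)) + S x)"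
    by (simp only: S_plus_R)
  have coef: "real (Suc n) * (real (Suc n) - 1) = real n * (real n - 1) + 2 * real n"
    by (simp add: algebra_simps)
  show ?case unfolding sum coef by (simp add: scaleR_left_distrib add_ac)
qed

section \<open>The approximately intertwining map from coefficient families to vectors\<close>

definition bern_coef :: "nat \<Rightarrow> 'a \<Rightarrow> nat \<Rightarrow> real" where
  "bern_coef n x i = sqrt (Re (ip (bern n i x) x))"

text \<open>\<open>bern n i\<close> is Hermitian and positive, hence defines a semi-inner product of
  its own. In particular a vanishing coefficient makes \<open>bern n i x\<close> orthogonal to every
  vector.\<close>

lemma bern_cauchy_schwarz: "cmod (ip (bern n i x) y) \<le> bern_coef n x i * bern_coef n y i"
proof -
  interpret B: csemi_inner "\<lambda>x y. ip (bern n i x) y"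
  proof
    fix x y z c
    show "ip (bern n i x) y = cnj (ip (bern n i y) x)"
      by (metis bern_hermitian ip_commute)
    show "ip (bern n i (x + y)) z = ip (bern n i x) z + ip (bern n i y) z"
      using bern_clinear[of n i] by (simp add: clinear_map_def ip_add_left)
    show "ip (bern n i (c *\<^sub>C x)) y = c * ip (bern n i x) y"
      using bern_clinear[of n i] by (simp add: clinear_map_def ip_scaleC_left)
  qed (rule bern_pos)
  show ?thesis using B.cauchy_schwarz[of x y] by (simp add: B.sn_def bern_coef_def)
qed

text \<open>Division by zero makes the vector vanish when its coefficient is zero, which is harmless:
  then \<open>bern n i x\<close> is a null vector of the form.\<close>

definition bern_vec :: "nat \<Rightarrow> 'a \<Rightarrow> nat \<Rightarrow> 'a" where
  "bern_vec n x i = (1 / bern_coef n x i) *\<^sub>R bern n i x"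

text \<open>The map \<open>V\<close> of the overview, or \<open>W\<close> when it is formed from
  \<open>y\<close>.\<close>

definition synth :: "nat \<Rightarrow> 'a \<Rightarrow> (nat \<Rightarrow> complex) \<Rightarrow> 'a" where
  "synth n x c = (\<Sum>i\<le>n. c i *\<^sub>C bern_vec n x i)"

lemma bern_coef_nonneg: "0 \<le> bern_coef n x i"
  by (simp add: bern_coef_def bern_pos)

lemma bern_coef_squared: "(bern_coef n x i)\<^sup>2 = Re (ip (bern n i x) x)"
  by (simp add: bern_coef_def bern_pos)

lemma cmod_ip_bern_vec_le: "cmod (ip (bern_vec n x i) y) \<le> bern_coef n y i"
proof (cases "bern_coef n x i = 0")
  case True
  then show ?thesis by (simp add: bern_vec_def bern_coef_nonneg)
next
  case False
  then have "bern_coef n x i > 0" using bern_coef_nonneg[of n x i] by simp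
  then show ?thesis
    using bern_cauchy_schwarz[of n i x y]
    by (simp add: bern_vec_def ip_scaleR_left norm_mult norm_divide field_simps)
qed

text \<open>The vector \<open>k i\<close> may vary with the index, so that one estimate serves both
  the contraction property (\<open>k i = h\<close>) and the intertwining error
  (\<open>k i = (i/n) h - S h\<close>).\<close>

lemma row_bound:
  "cmod (\<Sum>i\<le>n. c i * ip (bern_vec n x i) (k i))
    \<le> l2norm (Suc n) c * sqrt (\<Sum>i\<le>n. Re (ip (bern n i (k i)) (k i)))"
proof -
  have "cmod (\<Sum>i\<le>n. c i * ip (bern_vec n x i) (k i)) \<le> L2_set (\<lambda>i. cmod (c i)) {..n}
      * L2_set (\<lambda>i. cmod (ip (bern_vec n x i) (k i))) {..n}"
    by (rule norm_sum_mult_le_L2_set)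
  also have "\<dots> \<le> L2_set (\<lambda>i. cmod (c i)) {..n} * L2_set (\<lambda>i. bern_coef n (k i) i) {..n}"
    by (intro mult_left_mono L2_set_mono cmod_ip_bern_vec_le) auto
  finally show ?thesis by (simp add: L2_set_def bern_coef_squared lessThan_Suc_atMost)
qed

lemma ip_synth: "ip (synth n x c) h = (\<Sum>i\<le>n. c i * ip (bern_vec n x i) h)"
  by (simp add: synth_def ip_sum_left ip_scaleC_left)

lemma sn_synth_le: "sn (synth n x c) \<le> l2norm (Suc n) c"
proof (rule sn_leI)
  fix h
  have "(\<Sum>i\<le>n. Re (ip (bern n i h) h)) = Re (ip (\<Sum>i\<le>n. bern n i h) h)"
    by (simp add: ip_sum_left)
  then have "(\<Sum>i\<le>n. Re (ip (bern n i h) h)) = (sn h)\<^sup>2"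
    by (simp add: bern_sum_one sn_squared)
  then show "cmod (ip (synth n x c) h) \<le> l2norm (Suc n) c * sn h"
    using row_bound[of c n x "\<lambda>_. h"] by (simp add: ip_synth)
qed simp

lemma bern_variance:
  assumes "n > 0"
  shows "(\<Sum>i\<le>n. ip (bern n i ((real i / real n) *\<^sub>R h - S h)) ((real i / real n) *\<^sub>R h - S h))
    = of_real (1 / real n) * (ip (S h) h - ip (S h) (S h))"
proof -
  let ?r = "\<lambda>i. real i / real n"
  have lin: "bern n i (u - v) = bern n i u - bern n i v" "bern n i (r *\<^sub>R u) = r *\<^sub>R bern n i u" for i u v r
    using clinear_map_linear[OF bern_clinear[of n i]] by (simp_all add: linear_diff linear_cmul)
  have "ip (bern n i (?r i *\<^sub>R h - S h)) (?r i *\<^sub>R h - S h)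
      = ip ((?r i)\<^sup>2 *\<^sub>R bern n i h) h - ip (?r i *\<^sub>R bern n i h) (S h) - ip (?r i *\<^sub>R bern n i (S h)) h
        + ip (bern n i (S h)) (S h)" for i
    by (simp add: lin ip_diff_left ip_diff_right ip_scaleR_left ip_scaleR_right power2_eq_square
        right_diff_distrib)
  then have "(\<Sum>i\<le>n. ip (bern n i (?r i *\<^sub>R h - S h)) (?r i *\<^sub>R h - S h))
      = ip (\<Sum>i\<le>n. (?r i)\<^sup>2 *\<^sub>R bern n i h) h - ip (\<Sum>i\<le>n. ?r i *\<^sub>R bern n i h) (S h)
        - ip (\<Sum>i\<le>n. ?r i *\<^sub>R bern n i (S h)) h + ip (\<Sum>i\<le>n. bern n i (S h)) (S h)"
    by (simp only: ip_sum_left sum_subtractf sum.distrib)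
  moreover have r1: "(\<Sum>i\<le>n. ?r i *\<^sub>R bern n i u) = S u" for u
  proof -
    have "(\<Sum>i\<le>n. ?r i *\<^sub>R bern n i u) = (1 / real n) *\<^sub>R (\<Sum>i\<le>n. real i *\<^sub>R bern n i u)"
      by (simp add: scaleR_sum_right)
    then show ?thesis using assms by (simp add: bern_sum_id)
  qed
  moreover have "(\<Sum>i\<le>n. (?r i)\<^sup>2 *\<^sub>R bern n i h) = S (S h) - (1 / real n) *\<^sub>R S (S h) + (1 / real n) *\<^sub>R S h"
  proof -
    have "(\<Sum>i\<le>n. (?r i)\<^sup>2 *\<^sub>R bern n i h) = (1 / (real n)\<^sup>2) *\<^sub>R (\<Sum>i\<le>n. (real i)\<^sup>2 *\<^sub>R bern n i h)"
      by (simp add: scaleR_sum_right power_divide)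
    also have "\<dots> = ((real n * (real n - 1)) / (real n)\<^sup>2) *\<^sub>R S (S h) + (real n / (real n)\<^sup>2) *\<^sub>R S h"
      by (simp add: bern_sum_square scaleR_add_right)
    also have "(real n * (real n - 1)) / (real n)\<^sup>2 = 1 - 1 / real n"
      using assms by (simp add: power2_eq_square field_simps)
    also have "real n / (real n)\<^sup>2 = 1 / real n"
      using assms by (simp add: power2_eq_square)
    finally show ?thesis by (simp add: scaleR_left_diff_distrib)
  qed
  ultimately show ?thesis
    by (simp add: r1 bern_sum_one ip_add_left ip_diff_left ip_scaleR_left S_hermitian right_diff_distrib)
qed

text \<open>The intertwining error \<open>V d - S V\<close>, where \<open>d\<close> is the diagonal
  matrix with entries \<open>i/n\<close>.\<close>

definition synth_defect :: "nat \<Rightarrow> 'a \<Rightarrow> (nat \<Rightarrow> complex) \<Rightarrow> 'a" where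
  "synth_defect n x c = synth n x (\<lambda>i. of_real (real i / real n) * c i) - S (synth n x c)"

text \<open>Moving \<open>S\<close> across the form turns the pairing with \<open>h\<close> into a
  row with the vectors \<open>(i/n) h - S h\<close>. The sum in \<open>row_bound\<close> is then the
  Bernstein variance, at most \<open>(sn h)\<^sup>2 / n\<close>.\<close>

lemma sn_synth_defect_le:
  assumes "n > 0"
  shows "sn (synth_defect n x c) \<le> l2norm (Suc n) c / sqrt n"
proof (rule sn_leI)
  fix h
  let ?k = "\<lambda>i. (real i / real n) *\<^sub>R h - S h"
  have "ip (synth_defect n x c) h = (\<Sum>i\<le>n. c i * ip (bern_vec n x i) (?k i))"
    by (simp add: synth_defect_def ip_diff_left ip_diff_right S_hermitian ip_synth sum_subtractf
        right_diff_distrib ip_scaleR_right mult.assoc mult.left_commute)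
  then have "cmod (ip (synth_defect n x c) h) \<le> l2norm (Suc n) c * sqrt (\<Sum>i\<le>n. Re (ip (bern n i (?k i)) (?k i)))"
    using row_bound[of c n x ?k] by simp
  also have "(\<Sum>i\<le>n. Re (ip (bern n i (?k i)) (?k i))) = (1 / real n) * (Re (ip (S h) h) - Re (ip (S h) (S h)))"
    using arg_cong[OF bern_variance[OF assms, of h], of Re] by simp
  also have "l2norm (Suc n) c * sqrt \<dots> \<le> l2norm (Suc n) c * sqrt ((1 / real n) * (sn h)\<^sup>2)"
    using S_le[of h] ip_ge_zero[of "S h"]
    by (intro mult_left_mono real_sqrt_le_mono) (auto simp: sn_squared L2_set_nonneg)
  finally show "cmod (ip (synth_defect n x c) h) \<le> l2norm (Suc n) c / sqrt n * sn h"
    by (simp add: real_sqrt_divide)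
qed simp

lemma synth_mult:
  "synth n x (\<lambda>i. of_real (real i / real n) * c i) = S (synth n x c) + synth_defect n x c"
  by (simp add: synth_defect_def)

lemma l2norm_bern_coef: "l2norm (Suc n) (\<lambda>i. of_real (bern_coef n x i)) = sn x"
proof -
  have "(\<Sum>i\<le>n. Re (ip (bern n i x) x)) = Re (ip (\<Sum>i\<le>n. bern n i x) x)"
    by (simp add: ip_sum_left)
  then show ?thesis
    by (simp add: L2_set_def lessThan_Suc_atMost bern_coef_squared sn_def bern_sum_one)
qed

lemma sn_eq_zeroI:
  assumes "\<And>h. ip x h = 0"
  shows "sn x = 0"
  using assms by (simp add: sn_def)

text \<open>The coefficients cancel the normalization in \<open>bern_vec\<close>, and the Bernstein
  operators sum to the identity. Where a coefficient is zero a term is lost, but only a null vector.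
  With \<open>l2norm_bern_coef\<close> this represents \<open>x\<close> by a family of norm
  \<open>sn x\<close>.\<close>

lemma sn_synth_bern_coef: "sn (synth n x (\<lambda>i. of_real (bern_coef n x i)) - x) = 0"
proof (rule sn_eq_zeroI)
  fix h
  have "of_real (bern_coef n x i) * ip (bern_vec n x i) h = ip (bern n i x) h" for i
  proof (cases "bern_coef n x i = 0")
    case True
    then show ?thesis using bern_cauchy_schwarz[of n i x h] by simp
  next
    case False
    then show ?thesis by (simp add: bern_vec_def ip_scaleR_left)
  qed
  then have "ip (synth n x (\<lambda>i. of_real (bern_coef n x i))) h = ip (\<Sum>i\<le>n. bern n i x) h"
    by (simp add: ip_synth ip_sum_left)
  then show "ip (synth n x (\<lambda>i. of_real (bern_coef n x i)) - x) h = 0"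
    by (simp add: bern_sum_one ip_diff_left)
qed

lemma l2norm_fraction_le:
  assumes "n > 0"
  shows "l2norm (Suc n) (\<lambda>i. of_real (real i / real n) * c i) \<le> l2norm (Suc n) c"
proof (rule L2_set_mono)
  fix i assume "i \<in> {..<Suc n}"
  then have "real i / real n \<le> 1" using assms by simp
  then have "real i / real n * cmod (c i) \<le> 1 * cmod (c i)" by (rule mult_right_mono) simp
  then show "cmod (of_real (real i / real n) * c i) \<le> cmod (c i)" by (simp add: norm_mult norm_divide)
qed simp

end

section \<open>Compression to matrices and the limit of large size\<close>

locale contraction_pair = pos_contraction ip S for ip :: "'a::complex_banach \<Rightarrow> 'a \<Rightarrow> complex" and S +
  fixes A :: "'a \<Rightarrow> 'a"
  assumes A_clinear: "clinear_map A"
    and A_contraction: "sn (A x) \<le> sn x"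
begin

lemma A_linear: "linear A"
  by (rule clinear_map_linear[OF A_clinear])

lemma A_scaleC: "A (c *\<^sub>C x) = c *\<^sub>C A x"
  using A_clinear by (simp add: clinear_map_def)

text \<open>The matrix of \<open>W\<^sup>* A V\<close>: columns belong to \<open>x\<close>, rows to
  \<open>y\<close>.\<close>

definition compressed :: "nat \<Rightarrow> 'a \<Rightarrow> 'a \<Rightarrow> complex mat" where
  "compressed n x y = mat (Suc n) (Suc n) (\<lambda>(j, k). ip (A (bern_vec n x k)) (bern_vec n y j))"

lemma compressed_carrier: "compressed n x y \<in> carrier_mat (Suc n) (Suc n)"
  by (simp add: compressed_def)

lemma mat_form_compressed:
  "mat_form (Suc n) (compressed n x y) c d = ip (A (synth n x c)) (synth n y d)"
proof -
  have "mat_form (Suc n) (compressed n x y) c d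
      = (\<Sum>j\<le>n. \<Sum>k\<le>n. ip (A (bern_vec n x k)) (bern_vec n y j) * c k * cnj (d j))"
    unfolding lessThan_Suc_atMost by (intro sum.cong) (auto simp: compressed_def)
  also have "\<dots> = ip (A (synth n x c)) (synth n y d)"
    by (simp add: synth_def linear_sum[OF A_linear] A_scaleC ip_sum_left ip_sum_right
        ip_scaleC_left ip_scaleC_right sum_distrib_left mult.assoc mult.left_commute mult.commute)
  finally show ?thesis .
qed

lemma cmod_ip_A_le:
  assumes "sn x \<le> p" "sn y \<le> q"
  shows "cmod (ip (A x) y) \<le> p * q"
proof -
  have "cmod (ip (A x) y) \<le> sn (A x) * sn y" by (rule cauchy_schwarz)
  also have "\<dots> \<le> p * q"
  proof (rule mult_mono)
    show "0 \<le> p" using assms(1) sn_nonneg[of x] by linarith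
    show "sn (A x) \<le> p" using assms(1) A_contraction[of x] by linarith
  qed (use assms in auto)
  finally show ?thesis .
qed

lemma compressed_opnorm: "mat_opnorm (compressed n x y) \<le> 1"
  by (rule mat_opnorm_le[OF compressed_carrier])
    (auto simp: mat_form_compressed simp del: sum.lessThan_Suc intro!: cmod_ip_A_le sn_synth_le)

text \<open>For \<open>M = W\<^sup>* A V\<close> this reads \<open>M d - d M = W\<^sup>* (A S - S A)
  V + W\<^sup>* A (V d - S V) - (W d - S W)\<^sup>* A V\<close>.\<close>

lemma mat_form_compressed_commutator:
  "mat_form (Suc n) (diag_commutator (Suc n) (compressed n x y) (\<lambda>i. real i / real n)) c d
    = ip (A (S (synth n x c)) - S (A (synth n x c))) (synth n y d)
      + (ip (A (synth_defect n x c)) (synth n y d) - ip (A (synth n x c)) (synth_defect n y d))"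
  unfolding mat_form_diag_commutator[OF compressed_carrier] mat_form_compressed synth_mult
  by (simp add: linear_add[OF A_linear] ip_add_left ip_add_right ip_diff_left S_hermitian)

lemma commutator_defect_le:
  assumes "n > 0" "l2norm (Suc n) c \<le> p" "l2norm (Suc n) d \<le> q"
  shows "cmod (ip (A (synth_defect n x c)) (synth n y d) - ip (A (synth n x c)) (synth_defect n y d))
    \<le> 2 * p * q / sqrt n"
proof -
  have "sn (synth_defect n x c) \<le> p / sqrt n" "sn (synth_defect n y d) \<le> q / sqrt n"
    using sn_synth_defect_le[OF assms(1)] assms(2,3) by (meson divide_right_mono order_trans real_sqrt_ge_zero of_nat_0_le_iff)+
  moreover have "sn (synth n x c) \<le> p" "sn (synth n y d) \<le> q"
    using sn_synth_le assms(2,3) order_trans by blast+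
  ultimately have "cmod (ip (A (synth_defect n x c)) (synth n y d)) \<le> (p / sqrt n) * q"
    "cmod (ip (A (synth n x c)) (synth_defect n y d)) \<le> p * (q / sqrt n)"
    by (blast intro: cmod_ip_A_le)+
  then show ?thesis
    using norm_triangle_ineq4[of "ip (A (synth_defect n x c)) (synth n y d)" "ip (A (synth n x c)) (synth_defect n y d)"]
    by simp
qed

text \<open>Here \<open>V d\<^sup>2 - S\<^sup>2 V = S (V d - S V) + (V d - S V) d\<close>, and
  likewise for \<open>W\<close>. The four error terms, each of order \<open>1 / sqrt n\<close>,
  explain the \<open>4\<close> in the next bound.\<close>

lemma mat_form_compressed_commutator_square:
  "mat_form (Suc n) (diag_commutator (Suc n) (compressed n x y) (\<lambda>i. (real i / real n)\<^sup>2)) c d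
    = ip (A (S (S (synth n x c))) - S (S (A (synth n x c)))) (synth n y d)
      + ((ip (A (S (synth_defect n x c))) (synth n y d)
          + ip (A (synth_defect n x (\<lambda>i. of_real (real i / real n) * c i))) (synth n y d))
       - (ip (A (synth n x c)) (S (synth_defect n y d))
          + ip (A (synth n x c)) (synth_defect n y (\<lambda>i. of_real (real i / real n) * d i))))"
proof -
  have sq: "(\<lambda>i. complex_of_real ((real i / real n)\<^sup>2) * c i)
      = (\<lambda>i. of_real (real i / real n) * (of_real (real i / real n) * c i))" for c
    by (simp add: power2_eq_square mult.assoc)
  show ?thesis
    unfolding mat_form_diag_commutator[OF compressed_carrier] mat_form_compressed sq synth_mult
    by (simp add: linear_add[OF A_linear] S_simps ip_add_left ip_add_right ip_diff_left S_hermitian)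
qed

lemma compressed_commutator_square_opnorm:
  assumes n: "n > 0" and m: "0 \<le> m" "\<And>u. sn (A (S (S u)) - S (S (A u))) \<le> m * sn u"
  shows "mat_opnorm (diag_commutator (Suc n) (compressed n x y) (\<lambda>i. (real i / real n)\<^sup>2)) \<le> m + 4 / sqrt n"
proof (rule mat_opnorm_le[OF diag_commutator_carrier[OF compressed_carrier]])
  show "0 \<le> m + 4 / sqrt n" using m by simp
  fix c d
  let ?p = "l2norm (Suc n) c" and ?q = "l2norm (Suc n) d"
  let ?c = "\<lambda>i. of_real (real i / real n) * c i" and ?d = "\<lambda>i. of_real (real i / real n) * d i"
  have p: "0 \<le> ?p" "0 \<le> ?q" by (rule L2_set_nonneg)+
  have def_le: "sn (synth_defect n x c) \<le> ?p / sqrt n" "sn (synth_defect n y d) \<le> ?q / sqrt n"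
    by (rule sn_synth_defect_le[OF n])+
  have S_def_le: "sn (S (synth_defect n x c)) \<le> ?p / sqrt n" "sn (S (synth_defect n y d)) \<le> ?q / sqrt n"
    by (rule order_trans[OF sn_S_le def_le(1)], rule order_trans[OF sn_S_le def_le(2)])
  have "sn (synth_defect n x ?c) \<le> l2norm (Suc n) ?c / sqrt n"
    "sn (synth_defect n y ?d) \<le> l2norm (Suc n) ?d / sqrt n"
    by (rule sn_synth_defect_le[OF n])+
  then have def_le': "sn (synth_defect n x ?c) \<le> ?p / sqrt n" "sn (synth_defect n y ?d) \<le> ?q / sqrt n"
    using l2norm_fraction_le[OF n, of c] l2norm_fraction_le[OF n, of d]
    by (meson divide_right_mono order_trans real_sqrt_ge_zero of_nat_0_le_iff)+
  have syn: "sn (synth n x c) \<le> ?p" "sn (synth n y d) \<le> ?q" by (rule sn_synth_le)+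
  have "cmod (ip (A (S (S (synth n x c))) - S (S (A (synth n x c)))) (synth n y d))
      \<le> sn (A (S (S (synth n x c))) - S (S (A (synth n x c)))) * sn (synth n y d)"
    by (rule cauchy_schwarz)
  also have "\<dots> \<le> (m * ?p) * ?q"
  proof (rule mult_mono)
    show "sn (A (S (S (synth n x c))) - S (S (A (synth n x c)))) \<le> m * ?p"
      by (rule order_trans[OF m(2)]) (rule mult_left_mono[OF syn(1) m(1)])
  qed (use syn m p in auto)
  finally have 1: "cmod (ip (A (S (S (synth n x c))) - S (S (A (synth n x c)))) (synth n y d)) \<le> m * ?p * ?q" .
  have 2: "cmod (ip (A (S (synth_defect n x c))) (synth n y d)) \<le> (?p / sqrt n) * ?q"
    "cmod (ip (A (synth_defect n x ?c)) (synth n y d)) \<le> (?p / sqrt n) * ?q"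
    "cmod (ip (A (synth n x c)) (S (synth_defect n y d))) \<le> ?p * (?q / sqrt n)"
    "cmod (ip (A (synth n x c)) (synth_defect n y ?d)) \<le> ?p * (?q / sqrt n)"
    using def_le' S_def_le syn by (blast intro: cmod_ip_A_le)+
  have tri: "cmod (a + ((b1 + b2) - (c1 + c2))) \<le> cmod a + cmod b1 + cmod b2 + cmod c1 + cmod c2"
    for a b1 b2 c1 c2 :: complex
    by (smt (verit) norm_triangle_ineq norm_triangle_ineq4)
  have "cmod (mat_form (Suc n) (diag_commutator (Suc n) (compressed n x y) (\<lambda>i. (real i / real n)\<^sup>2)) c d)
      \<le> m * ?p * ?q + (?p / sqrt n) * ?q + (?p / sqrt n) * ?q + ?p * (?q / sqrt n) + ?p * (?q / sqrt n)"
    unfolding mat_form_compressed_commutator_square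
    by (rule order_trans[OF tri]) (use 1 2 in linarith)
  also have "\<dots> = (m + 4 / sqrt n) * ?p * ?q"
    using n by (simp add: field_simps)
  finally show "cmod (mat_form (Suc n) (diag_commutator (Suc n) (compressed n x y) (\<lambda>i. (real i / real n)\<^sup>2)) c d)
      \<le> (m + 4 / sqrt n) * ?p * ?q" .
qed

lemma sn_add_null:
  assumes "sn y = 0" shows "ip (x + y) z = ip x z" "ip z (x + y) = ip z x"
proof -
  have "ip y z = 0" "ip z y = 0"
    using cauchy_schwarz[of y z] cauchy_schwarz[of z y] assms by simp_all
  then show "ip (x + y) z = ip x z" "ip z (x + y) = ip z x"
    by (simp_all add: ip_add_left ip_add_right)
qed

lemma commutator_approx:
  fixes n :: nat
  assumes C: "matrix_commutator_bound C" and n: "n > 0"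
    and m: "0 \<le> m" "\<And>u. sn (A (S (S u)) - S (S (A u))) \<le> m * sn u"
    and xy: "sn x \<le> 1" "sn y \<le> 1"
  shows "cmod (ip (A (S x) - S (A x)) y) \<le> C * sqrt (m + 4 / sqrt n) + 2 / sqrt n"
proof -
  let ?\<sigma> = "\<lambda>i. real i / real n"
  let ?c = "\<lambda>i. complex_of_real (bern_coef n x i)" and ?d = "\<lambda>i. complex_of_real (bern_coef n y i)"
  let ?X = "synth n x ?c" and ?Y = "synth n y ?d"
  let ?M = "diag_commutator (Suc n) (compressed n x y)"
  have cd: "l2norm (Suc n) ?c \<le> 1" "l2norm (Suc n) ?d \<le> 1"
    unfolding l2norm_bern_coef by (rule xy)+
  have "inj_on ?\<sigma> {..<Suc n}" using n by (auto simp: inj_on_def)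
  then have "mat_opnorm (?M ?\<sigma>) \<le> C * sqrt (mat_opnorm (?M (\<lambda>i. (?\<sigma> i)\<^sup>2)))"
    using C by (intro matrix_commutator_bound_diag compressed_carrier compressed_opnorm) auto
  also have "\<dots> \<le> C * sqrt (m + 4 / sqrt n)"
    using compressed_commutator_square_opnorm[OF n m] matrix_commutator_bound_nonneg[OF C]
    by (intro mult_left_mono real_sqrt_le_mono) auto
  finally have "cmod (mat_form (Suc n) (?M ?\<sigma>) ?c ?d) \<le> C * sqrt (m + 4 / sqrt n)"
    using mat_form_le_opnorm[OF diag_commutator_carrier[OF compressed_carrier] cd] order_trans by blast
  moreover have "cmod (ip (A (synth_defect n x ?c)) ?Y - ip (A ?X) (synth_defect n y ?d)) \<le> 2 / sqrt n"
    using commutator_defect_le[OF n cd, of x y] by simp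
  moreover have "ip (A (S ?X) - S (A ?X)) ?Y = mat_form (Suc n) (?M ?\<sigma>) ?c ?d
      - (ip (A (synth_defect n x ?c)) ?Y - ip (A ?X) (synth_defect n y ?d))"
    unfolding mat_form_compressed_commutator by simp
  ultimately have *: "cmod (ip (A (S ?X) - S (A ?X)) ?Y) \<le> C * sqrt (m + 4 / sqrt n) + 2 / sqrt n"
    by (simp only: order_trans[OF norm_triangle_ineq4 add_mono])
  \<comment> \<open>\<open>?X\<close> and \<open>x\<close> differ by a null vector. Neither
    \<open>A\<close> nor \<open>S\<close> increases \<open>sn\<close>, so images of null vectors are
    null and drop out of every pairing.\<close>
  define u where "u = ?X - x"
  have X: "?X = x + u" by (simp add: u_def)
  have u: "sn u = 0" unfolding u_def by (rule sn_synth_bern_coef)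
  have "sn (A v) = 0" "sn (S v) = 0" if "sn v = 0" for v
    using A_contraction[of v] sn_S_le[of v] sn_nonneg[of "A v"] sn_nonneg[of "S v"] that by linarith+
  then have null: "sn (A (S u)) = 0" "sn (S (A u)) = 0" using u by auto
  have "ip (A (S ?X) - S (A ?X)) z = ip (A (S x) - S (A x)) z" for z
    unfolding X by (simp add: linear_add[OF A_linear] S_simps ip_diff_left sn_add_null null)
  moreover have "ip z ?Y = ip z y" for z
    using sn_add_null(2)[OF sn_synth_bern_coef[of n y], of z y] by simp
  ultimately show ?thesis using * by simp
qed

text \<open>\<open>x\<close>, \<open>y\<close> and \<open>m\<close> stay fixed while the matrix size
  grows, so only the errors change in \<open>commutator_approx\<close>, and they tend to
  zero.\<close>

lemma commutator_bound:
  assumes C: "matrix_commutator_bound C"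
    and m: "0 \<le> m" "\<And>u. sn (A (S (S u)) - S (S (A u))) \<le> m * sn u"
    and xy: "sn x \<le> 1" "sn y \<le> 1"
  shows "cmod (ip (A (S x) - S (A x)) y) \<le> C * sqrt m"
proof (rule tendsto_lowerbound)
  have "(\<lambda>n. 1 / sqrt (real n)) \<longlonglongrightarrow> 0"
    by (intro tendsto_divide_0[OF tendsto_const] filterlim_at_top_imp_at_infinity
        filterlim_compose[OF sqrt_at_top filterlim_real_sequentially])
  then have "(\<lambda>n. C * sqrt (m + 4 * (1 / sqrt (real n))) + 2 * (1 / sqrt (real n)))
      \<longlonglongrightarrow> C * sqrt (m + 4 * 0) + 2 * 0"
    by (intro tendsto_intros)
  then show "(\<lambda>n. C * sqrt (m + 4 / sqrt (real n)) + 2 / sqrt (real n)) \<longlonglongrightarrow> C * sqrt m"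
    by simp
  show "\<forall>\<^sub>F n in sequentially. cmod (ip (A (S x) - S (A x)) y) \<le> C * sqrt (m + 4 / sqrt (real n)) + 2 / sqrt (real n)"
    using eventually_gt_at_top[of 0] by eventually_elim (rule commutator_approx[OF C _ m xy])
qed simp

end

text \<open>Both sides are homogeneous of degree one in \<open>S\<close>: passing to
  \<open>S / L\<close> replaces \<open>m\<close> by \<open>m / L\<^sup>2\<close>, and the root gives
  back the factor \<open>1 / L\<close>.\<close>

lemma (in csemi_inner) scaled_commutator_bound:
  assumes C: "matrix_commutator_bound C"
    and A: "clinear_map A" "\<And>x. sn (A x) \<le> sn x"
    and S: "clinear_map S" "\<And>x y. ip (S x) y = ip x (S y)" "\<And>x. 0 \<le> Re (ip (S x) x)"
    and L: "\<And>x. Re (ip (S x) x) \<le> L * Re (ip x x)" "0 < L"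
    and m: "0 \<le> m" "\<And>u. sn (A (S (S u)) - S (S (A u))) \<le> m * sn u"
    and xy: "sn x \<le> 1" "sn y \<le> 1"
  shows "cmod (ip (A (S x) - S (A x)) y) \<le> C * sqrt m"
proof -
  let ?T = "\<lambda>x. (1 / L) *\<^sub>R S x"
  have Alin: "linear A" and Slin: "linear S" using A S clinear_map_linear by auto
  note simps = linear_cmul[OF Alin] linear_cmul[OF Slin] ip_scaleR_left ip_scaleR_right
  interpret contraction_pair ip ?T A
  proof
    show "clinear_map ?T"
      using S(1) by (simp add: clinear_map_def scaleR_add_right scaleC_scaleR)
    fix x y
    show "ip (?T x) y = ip x (?T y)" by (simp add: simps S(2))
    show "0 \<le> Re (ip (?T x) x)" "Re (ip (?T x) x) \<le> Re (ip x x)"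
      using S(3)[of x] L(1)[of x] L(2) by (simp_all add: simps field_simps)
  qed (rule A)+
  have sc: "sn (r *\<^sub>R v) = \<bar>r\<bar> * sn v" for r v
    by (simp add: scaleR_scaleC sn_scaleC)
  have "cmod (ip (A (?T x) - ?T (A x)) y) \<le> C * sqrt (m / L\<^sup>2)"
  proof (rule commutator_bound[OF C _ _ xy])
    show "0 \<le> m / L\<^sup>2" using m by simp
    fix u
    have "A (?T (?T u)) - ?T (?T (A u)) = (1 / L\<^sup>2) *\<^sub>R (A (S (S u)) - S (S (A u)))"
      by (simp add: simps power2_eq_square scaleR_diff_right)
    then have "sn (A (?T (?T u)) - ?T (?T (A u))) = (1 / L\<^sup>2) * sn (A (S (S u)) - S (S (A u)))"
      by (simp add: sc)
    also have "\<dots> \<le> (1 / L\<^sup>2) * (m * sn u)"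
      by (intro mult_left_mono m) simp
    finally show "sn (A (?T (?T u)) - ?T (?T (A u))) \<le> m / L\<^sup>2 * sn u" by simp
  qed
  moreover have "A (?T x) - ?T (A x) = (1 / L) *\<^sub>R (A (S x) - S (A x))"
    by (simp add: simps scaleR_diff_right)
  then have "cmod (ip (A (?T x) - ?T (A x)) y) = (1 / L) * cmod (ip (A (S x) - S (A x)) y)"
    using L(2) by (simp add: ip_scaleR_left norm_mult norm_divide)
  moreover have "C * sqrt (m / L\<^sup>2) = (1 / L) * (C * sqrt m)"
    using L(2) by (simp add: real_sqrt_divide)
  ultimately have "(1 / L) * cmod (ip (A (S x) - S (A x)) y) \<le> (1 / L) * (C * sqrt m)" by simp
  then show ?thesis using L(2) by (simp add: divide_le_cancel)
qed

section \<open>The binomial series of the square root\<close>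

text \<open>The Taylor coefficients of \<open>sqrt (1 - t)\<close> at zero; all but the first are
  nonpositive.\<close>

definition sqrt_coeff :: "nat \<Rightarrow> real" where
  "sqrt_coeff k = ((1/2) gchoose k) * (-1) ^ k"

lemma sqrt_coeff_0 [simp]: "sqrt_coeff 0 = 1"
  by (simp add: sqrt_coeff_def)

lemma sqrt_coeff_Suc: "real (Suc k) * sqrt_coeff (Suc k) = (real k - 1/2) * sqrt_coeff k"
proof -
  have "real (Suc k) * ((1/2) gchoose Suc k) = (1/2 - real k) * ((1/2) gchoose k)"
    using gbinomial_absorption[of k "1/2 :: real"] gbinomial_absorb_comp[of "1/2 :: real" k] by simp
  then have "real (Suc k) * ((1/2) gchoose Suc k) * (-1) ^ Suc k = (1/2 - real k) * ((1/2) gchoose k) * (-1) ^ Suc k"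
    by simp
  then show ?thesis by (simp add: sqrt_coeff_def algebra_simps)
qed

lemma sqrt_coeff_Suc_nonpos: "sqrt_coeff (Suc k) \<le> 0"
proof (induction k)
  case 0
  show ?case using sqrt_coeff_Suc[of 0] by simp
next
  case (Suc k)
  have "real (Suc (Suc k)) * sqrt_coeff (Suc (Suc k)) \<le> 0"
    unfolding sqrt_coeff_Suc[of "Suc k"] using Suc by (intro mult_nonneg_nonpos) auto
  then show ?case by (simp add: mult_le_0_iff)
qed

text \<open>Both sides are the coefficient of \<open>t^n\<close> in
  \<open>(1 - t) powr (-1/2)\<close>: partial sums come from dividing the series by
  \<open>1 - t\<close>, the right side from differentiating it. The formula shows that the partial
  sums are nonnegative.\<close>

lemma sum_sqrt_coeff: "(\<Sum>k\<le>n. sqrt_coeff k) = - 2 * real (Suc n) * sqrt_coeff (Suc n)"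
proof (induction n)
  case 0
  show ?case using sqrt_coeff_Suc[of 0] by simp
next
  case (Suc n)
  then show ?case using sqrt_coeff_Suc[of "Suc n"] by (simp add: algebra_simps)
qed

text \<open>This gives absolute convergence on the closed unit ball. The boundary cannot be spared:
  \<open>1 - t\<close> is invertible whenever \<open>norm t < 1\<close>, while the elements whose
  roots are wanted may be singular.\<close>

lemma sum_abs_sqrt_coeff_le: "(\<Sum>k<n. \<bar>sqrt_coeff (Suc k)\<bar>) \<le> 1"
proof -
  have "0 \<le> (\<Sum>k\<le>n. sqrt_coeff k)"
    unfolding sum_sqrt_coeff by (intro mult_nonpos_nonpos sqrt_coeff_Suc_nonpos) simp
  also have "(\<Sum>k\<le>n. sqrt_coeff k) = 1 + (\<Sum>k<n. sqrt_coeff (Suc k))"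
    by (simp add: sum.atMost_shift)
  also have "\<dots> = 1 - (\<Sum>k<n. \<bar>sqrt_coeff (Suc k)\<bar>)"
    by (simp add: abs_of_nonpos sqrt_coeff_Suc_nonpos sum_negf)
  finally show ?thesis by simp
qed

lemma summable_abs_sqrt_coeff_Suc: "summable (\<lambda>k. \<bar>sqrt_coeff (Suc k)\<bar>)"
  by (rule summableI_nonneg_bounded[OF _ sum_abs_sqrt_coeff_le]) simp

lemma suminf_abs_sqrt_coeff_Suc: "(\<Sum>k. \<bar>sqrt_coeff (Suc k)\<bar>) \<le> 1"
  by (rule suminf_le_const[OF summable_abs_sqrt_coeff_Suc sum_abs_sqrt_coeff_le])

lemma summable_abs_sqrt_coeff: "summable (\<lambda>k. \<bar>sqrt_coeff k\<bar>)"
  using summable_abs_sqrt_coeff_Suc summable_Suc_iff[of "\<lambda>k. \<bar>sqrt_coeff k\<bar>"] by blast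

text \<open>Vandermonde's identity for \<open>1/2 + 1/2 = 1\<close>: the square of the series is
  \<open>1 - t\<close>.\<close>

lemma sqrt_coeff_convolution:
  "(\<Sum>i\<le>k. sqrt_coeff i * sqrt_coeff (k - i)) = (if k = 0 then 1 else if k = 1 then -1 else 0)"
proof -
  have "(\<Sum>i\<le>k. sqrt_coeff i * sqrt_coeff (k - i))
      = (\<Sum>i\<le>k. ((1/2) gchoose i) * ((1/2) gchoose (k - i))) * (-1) ^ k"
    unfolding sum_distrib_right
  proof (rule sum.cong)
    fix i assume "i \<in> {..k}"
    then have "(-1 :: real) ^ k = (-1) ^ i * (-1) ^ (k - i)" by (simp flip: power_add)
    then show "sqrt_coeff i * sqrt_coeff (k - i) = ((1/2) gchoose i) * ((1/2) gchoose (k - i)) * (-1) ^ k"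
      by (simp add: sqrt_coeff_def)
  qed simp
  also have "\<dots> = ((1/2 + 1/2) gchoose k) * (-1) ^ k"
    using gbinomial_Vandermonde[of "1/2 :: real" "1/2" k] by (simp add: atLeast0AtMost)
  also have "\<dots> = real (1 choose k) * (-1) ^ k"
    using binomial_gbinomial[of 1 k, where 'a = real] by simp
  finally show ?thesis by (cases k) (auto simp: binomial_eq_0)
qed

text \<open>The sort fits unital algebras as well as the operators on a possibly zero space. On the
  latter \<open>1 = 0\<close>, which is why bounds below contain \<open>norm 1\<close> in place of
  1.\<close>

definition sqrt_series :: "'p::{banach, real_normed_algebra, monoid_mult} \<Rightarrow> 'p" where
  "sqrt_series t = (\<Sum>k. sqrt_coeff k *\<^sub>R t ^ k)"

context
  fixes t :: "'p::{banach, real_normed_algebra, monoid_mult}"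
  assumes t: "norm t \<le> 1"
begin

lemma norm_power_le_norm_one: "norm (t ^ k) \<le> norm (1::'p)"
proof (induction k)
  case (Suc k)
  have "norm (t ^ Suc k) \<le> norm t * norm (t ^ k)" by (simp add: norm_mult_ineq)
  also have "\<dots> \<le> 1 * norm (t ^ k)" using t by (intro mult_right_mono) auto
  finally show ?case using Suc by simp
qed simp

lemma summable_norm_sqrt_series: "summable (\<lambda>k. norm (sqrt_coeff k *\<^sub>R t ^ k))"
proof (rule summable_comparison_test')
  show "summable (\<lambda>k. \<bar>sqrt_coeff k\<bar> * norm (1::'p))"
    by (rule summable_mult2[OF summable_abs_sqrt_coeff])
  show "norm (norm (sqrt_coeff k *\<^sub>R t ^ k)) \<le> \<bar>sqrt_coeff k\<bar> * norm (1::'p)" for k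
    by (simp add: mult_left_mono norm_power_le_norm_one)
qed

lemma summable_sqrt_series: "summable (\<lambda>k. sqrt_coeff k *\<^sub>R t ^ k)"
  by (rule summable_norm_cancel[OF summable_norm_sqrt_series])

lemma sqrt_series_square: "sqrt_series t * sqrt_series t = 1 - t"
proof -
  have "(\<Sum>i\<le>k. (sqrt_coeff i *\<^sub>R t ^ i) * (sqrt_coeff (k - i) *\<^sub>R t ^ (k - i)))
      = (if k = 0 then 1 else if k = 1 then - t else 0)" for k
  proof -
    have "(\<Sum>i\<le>k. (sqrt_coeff i *\<^sub>R t ^ i) * (sqrt_coeff (k - i) *\<^sub>R t ^ (k - i)))
        = (\<Sum>i\<le>k. (sqrt_coeff i * sqrt_coeff (k - i)) *\<^sub>R t ^ k)"
      by (intro sum.cong) (auto simp flip: power_add)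
    also have "\<dots> = (\<Sum>i\<le>k. sqrt_coeff i * sqrt_coeff (k - i)) *\<^sub>R t ^ k"
      by (simp add: scaleR_sum_left)
    finally show ?thesis by (simp add: sqrt_coeff_convolution)
  qed
  then have "(\<lambda>k. if k = 0 then 1 else if k = 1 then - t else 0) sums (sqrt_series t * sqrt_series t)"
    using Cauchy_product_sums[OF summable_norm_sqrt_series summable_norm_sqrt_series]
    by (simp add: sqrt_series_def)
  moreover have "(\<lambda>k. if k = 0 then 1 else if k = 1 then - t else 0)
      sums (\<Sum>k\<in>{0, 1::nat}. if k = 0 then 1 else if k = 1 then - t else 0)"
    by (rule sums_finite) auto
  ultimately show ?thesis by (simp add: sums_unique2)
qed

lemma bounded_linear_sqrt_series:
  assumes "bounded_linear F"
  shows "(\<lambda>k. sqrt_coeff k *\<^sub>R F (t ^ k)) sums F (sqrt_series t)"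
proof -
  interpret bounded_linear F by fact
  show ?thesis
    using sums[OF summable_sums[OF summable_sqrt_series]] by (simp add: scaleR sqrt_series_def)
qed

lemma sqrt_series_commute:
  assumes "y * t = t * y"
  shows "y * sqrt_series t = sqrt_series t * y"
proof -
  have "y * t ^ k = t ^ k * y" for k
    by (induction k) (simp, metis assms mult.assoc power_Suc)
  then show ?thesis
    using bounded_linear_sqrt_series[OF bounded_linear_mult_right[of y]]
      bounded_linear_sqrt_series[OF bounded_linear_mult_left[of y]] sums_unique2 by simp
qed

text \<open>Since \<open>norm 1 = 1\<close> in a unital C*-algebra, the root \<open>s\<close> of
  \<open>1 - t\<close> satisfies \<open>norm (1 - s) \<le> 1\<close> there. The series can then be
  applied to \<open>1 - s\<close>, so \<open>s\<close> is itself a square.\<close>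

lemma norm_one_diff_sqrt_series: "norm (1 - sqrt_series t) \<le> norm (1::'p)"
proof -
  have "sqrt_series t = 1 + (\<Sum>k. sqrt_coeff (Suc k) *\<^sub>R t ^ Suc k)"
    using suminf_split_head[OF summable_sqrt_series] by (simp add: sqrt_series_def)
  moreover have "norm (\<Sum>k. sqrt_coeff (Suc k) *\<^sub>R t ^ Suc k) \<le> (\<Sum>k. \<bar>sqrt_coeff (Suc k)\<bar> * norm (1::'p))"
    by (intro norm_suminf_le summable_mult2 summable_abs_sqrt_coeff_Suc)
      (auto simp: norm_power_le_norm_one simp del: power_Suc intro!: mult_left_mono)
  moreover have "(\<Sum>k. \<bar>sqrt_coeff (Suc k)\<bar> * norm (1::'p)) \<le> 1 * norm (1::'p)"
    using suminf_mult2[OF summable_abs_sqrt_coeff_Suc, of "norm (1::'p)"] suminf_abs_sqrt_coeff_Suc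
    by (metis mult_right_mono norm_ge_zero)
  ultimately show ?thesis by simp
qed

text \<open>The coefficients after the first are nonpositive with sum at least -1, so they subtract
  at most \<open>F 1\<close> from the leading term \<open>F 1\<close>.\<close>

lemma sqrt_series_functional_nonneg:
  assumes F: "bounded_linear (F :: 'p \<Rightarrow> real)" and F_le: "\<And>k. F (t ^ k) \<le> F 1" and F_1: "0 \<le> F 1"
  shows "0 \<le> F (sqrt_series t)"
proof -
  have "(\<lambda>k. sqrt_coeff k * F (t ^ k)) sums F (sqrt_series t)"
    using bounded_linear_sqrt_series[OF F] by simp
  then show ?thesis
  proof (rule LIMSEQ_le_const[OF sums_def[THEN iffD1]])
    show "\<exists>N. \<forall>n\<ge>N. 0 \<le> (\<Sum>k<n. sqrt_coeff k * F (t ^ k))"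
    proof (intro exI[of _ 1] allI impI)
      fix n :: nat assume "n \<ge> 1"
      then obtain m where n: "n = Suc m" by (metis Suc_le_D One_nat_def)
      have "(\<Sum>k<n. sqrt_coeff k * F (t ^ k)) = F 1 + (\<Sum>k<m. sqrt_coeff (Suc k) * F (t ^ Suc k))"
        unfolding n by (subst sum.lessThan_Suc_shift) simp
      moreover have "(\<Sum>k<m. sqrt_coeff (Suc k) * F (t ^ Suc k)) \<ge> (\<Sum>k<m. sqrt_coeff (Suc k) * F 1)"
        by (intro sum_mono mult_left_mono_neg F_le sqrt_coeff_Suc_nonpos)
      moreover have "(\<Sum>k<m. sqrt_coeff (Suc k) * F 1) = - ((\<Sum>k<m. \<bar>sqrt_coeff (Suc k)\<bar>) * F 1)"
        by (simp add: sum_distrib_right abs_of_nonpos sqrt_coeff_Suc_nonpos flip: sum_negf)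
      moreover have "(\<Sum>k<m. \<bar>sqrt_coeff (Suc k)\<bar>) * F 1 \<le> 1 * F 1"
        by (intro mult_right_mono sum_abs_sqrt_coeff_le F_1)
      ultimately show "0 \<le> (\<Sum>k<n. sqrt_coeff k * F (t ^ k))" by linarith
    qed
  qed
qed

end

section \<open>Square roots of positive operators on a Hilbert space\<close>

text \<open>A copy of the bounded operators on which composition is the multiplication of a type
  class. The class is \<^class>\<open>monoid_mult\<close> and not \<^class>\<open>ring_1\<close>, since \<open>0 = 1\<close> on the zero space.\<close>

typedef (overloaded) 'h bop = "UNIV :: ('h::real_normed_vector \<Rightarrow>\<^sub>L 'h) set"
  morphisms blinfun_of_bop bop_of_blinfun ..

setup_lifting type_definition_bop

instantiation bop :: (real_normed_vector) real_normed_algebra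
begin

lift_definition norm_bop :: "'a bop \<Rightarrow> real" is norm .
lift_definition minus_bop :: "'a bop \<Rightarrow> 'a bop \<Rightarrow> 'a bop" is "(-)" .
lift_definition uminus_bop :: "'a bop \<Rightarrow> 'a bop" is uminus .
lift_definition zero_bop :: "'a bop" is 0 .
lift_definition plus_bop :: "'a bop \<Rightarrow> 'a bop \<Rightarrow> 'a bop" is "(+)" .
lift_definition scaleR_bop :: "real \<Rightarrow> 'a bop \<Rightarrow> 'a bop" is "(*\<^sub>R)" .
lift_definition times_bop :: "'a bop \<Rightarrow> 'a bop \<Rightarrow> 'a bop" is "(o\<^sub>L)" .

definition dist_bop :: "'a bop \<Rightarrow> 'a bop \<Rightarrow> real" where
  "dist_bop a b = norm (a - b)"

definition uniformity_bop :: "('a bop \<times> 'a bop) filter" where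
  "uniformity_bop = (INF e\<in>{0 <..}. principal {(x, y). dist x y < e})"

definition open_bop :: "'a bop set \<Rightarrow> bool" where
  "open_bop S = (\<forall>x\<in>S. \<forall>\<^sub>F (x', y) in uniformity. x' = x \<longrightarrow> y \<in> S)"

definition sgn_bop :: "'a bop \<Rightarrow> 'a bop" where
  "sgn_bop x = inverse (norm x) *\<^sub>R x"

instance
proof
  fix a b c :: "'a bop" and r s :: real
  show "dist a b = norm (a - b)" by (rule dist_bop_def)
  show "(uniformity :: ('a bop \<times> 'a bop) filter) = (INF e\<in>{0 <..}. principal {(x, y). dist x y < e})"
    by (rule uniformity_bop_def)
  show "open S = (\<forall>x\<in>S. \<forall>\<^sub>F (x', y) in uniformity. x' = x \<longrightarrow> y \<in> S)" for S :: "'a bop set"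
    by (rule open_bop_def)
  show "sgn a = inverse (norm a) *\<^sub>R a" by (rule sgn_bop_def)
  show "a + b + c = a + (b + c)" "a + b = b + a" "0 + a = a" "- a + a = 0" "a - b = a + - b"
    by (transfer; simp)+
  show "r *\<^sub>R (a + b) = r *\<^sub>R a + r *\<^sub>R b" "(r + s) *\<^sub>R a = r *\<^sub>R a + s *\<^sub>R a"
    "r *\<^sub>R s *\<^sub>R a = (r * s) *\<^sub>R a" "1 *\<^sub>R a = a"
    by (transfer; simp add: algebra_simps)+
  show "(norm a = 0) = (a = 0)" "norm (a + b) \<le> norm a + norm b" "norm (r *\<^sub>R a) = \<bar>r\<bar> * norm a"
    by (transfer; simp add: norm_triangle_ineq)+
  show "a * b * c = a * (b * c)"
    by (transfer, rule blinfun_eqI, simp)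
  show "(a + b) * c = a * c + b * c" "a * (b + c) = a * b + a * c"
    "r *\<^sub>R a * b = r *\<^sub>R (a * b)" "a * r *\<^sub>R b = r *\<^sub>R (a * b)"
    by (transfer, rule blinfun_eqI, simp add: blinfun.bilinear_simps)+
  show "norm (a * b) \<le> norm a * norm b"
    by transfer (rule norm_blinfun_compose)
qed

end

instantiation bop :: (real_normed_vector) monoid_mult
begin

lift_definition one_bop :: "'a bop" is id_blinfun .

instance
proof
  fix a :: "'a bop"
  show "1 * a = a" "a * 1 = a" by (transfer, rule blinfun_eqI, simp)+
qed

end

instance bop :: (banach) banach
proof
  fix X :: "nat \<Rightarrow> 'a bop" assume X: "Cauchy X"
  have dist_eq: "dist (blinfun_of_bop a) (blinfun_of_bop b) = dist a b" for a b :: "'a bop"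
    by (simp add: dist_norm norm_bop.rep_eq minus_bop.rep_eq)
  from X have "Cauchy (\<lambda>n. blinfun_of_bop (X n))"
    unfolding Cauchy_def dist_eq .
  then obtain L where "(\<lambda>n. blinfun_of_bop (X n)) \<longlonglongrightarrow> L"
    using Cauchy_convergent convergent_def by blast
  then have "X \<longlonglongrightarrow> bop_of_blinfun L"
    unfolding tendsto_iff dist_eq[symmetric] by (simp add: bop_of_blinfun_inverse)
  then show "convergent X" by (auto simp: convergent_def)
qed

definition bop_apply :: "'h::real_normed_vector bop \<Rightarrow> 'h \<Rightarrow> 'h" where
  "bop_apply B = blinfun_apply (blinfun_of_bop B)"

definition bop :: "('h::real_normed_vector \<Rightarrow> 'h) \<Rightarrow> 'h bop" where
  "bop f = bop_of_blinfun (Blinfun f)"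

lemma bop_apply_bop: "bounded_linear f \<Longrightarrow> bop_apply (bop f) = f"
  by (simp add: bop_apply_def bop_def bop_of_blinfun_inverse bounded_linear_Blinfun_apply)

lemma bop_eqI: "(\<And>x. bop_apply A x = bop_apply B x) \<Longrightarrow> A = B"
  unfolding bop_apply_def by (metis blinfun_eqI blinfun_of_bop_inject)

lemma bop_apply_simps [simp]:
  "bop_apply (A * B) x = bop_apply A (bop_apply B x)"
  "bop_apply (A - B) x = bop_apply A x - bop_apply B x"
  "bop_apply (r *\<^sub>R A) x = r *\<^sub>R bop_apply A x"
  "bop_apply 1 x = x"
  by (simp_all add: bop_apply_def times_bop.rep_eq minus_bop.rep_eq scaleR_bop.rep_eq one_bop.rep_eq
      blinfun.bilinear_simps)

lemma bop_apply_power: "bop_apply (A ^ k) x = (bop_apply A ^^ k) x"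
  by (induction k) auto

lemma norm_bop_apply: "norm (bop_apply A x) \<le> norm A * norm x"
  by (simp add: bop_apply_def norm_bop.rep_eq norm_blinfun)

lemma norm_bop_le: "0 \<le> K \<Longrightarrow> (\<And>x. norm (bop_apply A x) \<le> K * norm x) \<Longrightarrow> norm A \<le> K"
  by (simp add: bop_apply_def norm_bop.rep_eq norm_blinfun_bound)

lemma bounded_linear_bop_apply: "bounded_linear (bop_apply A)"
  by (simp add: bop_apply_def blinfun.bounded_linear_right)

lemma bounded_linear_bop_apply_left: "bounded_linear (\<lambda>A. bop_apply A x)"
proof
  show "bop_apply (A + B) x = bop_apply A x + bop_apply B x" for A B
    by (simp add: bop_apply_def plus_bop.rep_eq blinfun.bilinear_simps)
  show "\<exists>K. \<forall>A. norm (bop_apply A x) \<le> norm A * K" using norm_bop_apply by blast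
qed simp

section \<open>Positive operators and their roots\<close>

lemma csemi_inner_cinner: "csemi_inner (cinner :: 'h::complex_hilbert \<Rightarrow> 'h \<Rightarrow> complex)"
  using cinner_ge_zero by unfold_locales
    (rule cinner_commute, auto simp: cinner_add_left cinner_scaleC_left less_eq_complex_def)

interpretation hilbert: csemi_inner "cinner :: 'h::complex_hilbert \<Rightarrow> 'h \<Rightarrow> complex"
  by (rule csemi_inner_cinner)

lemma hilbert_sn [simp]: "csemi_inner.sn cinner x = norm x"
  by (simp add: hilbert.sn_def norm_eq_sqrt_cinner)

lemma cinner_self: "Re (cinner x x) = (norm x)\<^sup>2"
  using hilbert.sn_squared[of x] by simp

lemma bounded_clinear_clinear_map: "bounded_clinear f \<Longrightarrow> clinear_map f"
  by (auto simp: bounded_clinear_def clinear_map_def linear_simps)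

text \<open>Polarization: the form is real on the diagonal; evaluation at \<open>x + y\<close> and
  at \<open>i x + y\<close> compares the imaginary and the real parts of the two sides.\<close>

lemma op_positive_hermitian:
  assumes "op_positive f"
  shows "cinner (f x) y = cinner x (f y)"
proof -
  have cl: "clinear_map f" using assms by (simp add: op_positive_def bounded_clinear_clinear_map)
  have Im0: "Im (cinner (f u) u) = 0" for u
    using assms by (simp add: op_positive_def less_eq_complex_def)
  have "Im (cinner (f x) y + cinner (f y) x) = 0" for x y
    using Im0[of "x + y"] Im0[of x] Im0[of y] cl
    by (simp add: clinear_map_def hilbert.ip_add_left hilbert.ip_add_right)
  from this[of x y] this[of "\<i> *\<^sub>C x" y] have "cinner (f x) y = cnj (cinner (f y) x)"
    using cl by (simp add: clinear_map_def hilbert.ip_scaleC_left hilbert.ip_scaleC_right complex_eq_iff)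
  then show ?thesis by (metis cinner_commute)
qed

text \<open>Cauchy-Schwarz for the semi-inner product \<open>cinner (f x) y\<close>, at
  \<open>y = f x\<close>.\<close>

lemma op_positive_null:
  assumes f: "op_positive f" and x: "Re (cinner (f x) x) = 0"
  shows "f x = 0"
proof -
  have cl: "clinear_map f" using f by (simp add: op_positive_def bounded_clinear_clinear_map)
  interpret F: csemi_inner "\<lambda>x y. cinner (f x) y"
  proof
    show "cinner (f x) y = cnj (cinner (f y) x)" for x y
      by (metis op_positive_hermitian[OF f] cinner_commute)
    show "0 \<le> Re (cinner (f x) x)" for x
      using f by (simp add: op_positive_def less_eq_complex_def)
  qed (use cl in \<open>auto simp: clinear_map_def hilbert.ip_add_left hilbert.ip_scaleC_left\<close>)
  have "cinner (f x) (f x) = 0"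
    using F.cauchy_schwarz[of x "f x"] x by (simp add: F.sn_def)
  then show ?thesis using cinner_self[of "f x"] by simp
qed

text \<open>For \<open>b = L (1 - t)\<close> the form of \<open>t\<close> lies between zero and the
  inner product, and \<open>sqrt L\<close> times the series at \<open>t\<close> is a root. The
  commutation clause carries the uniqueness proof.\<close>

lemma op_positive_sqrt_exists:
  fixes b :: "'h::complex_hilbert \<Rightarrow> 'h"
  assumes b: "op_positive b"
  shows "\<exists>s. op_positive s \<and> s \<circ> s = b \<and> (\<forall>s'. bounded_linear s' \<longrightarrow> s' \<circ> b = b \<circ> s' \<longrightarrow> s' \<circ> s = s \<circ> s')"
proof -
  have blin: "bounded_linear b" and cl: "clinear_map b"
    using b by (simp_all add: op_positive_def bounded_clinear_def bounded_clinear_clinear_map)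
  \<comment> \<open>The summand 1 keeps \<open>L\<close> positive when \<open>b\<close> is
    zero.\<close>
  define L where "L = onorm b + 1"
  have L: "L > 0" using onorm_pos_le[OF blin] by (simp add: L_def)
  define t where "t = (\<lambda>x. x - (1 / L) *\<^sub>R b x)"
  have tlin: "bounded_linear t" unfolding t_def
    by (intro bounded_linear_sub bounded_linear_ident bounded_linear_scaleR_right[THEN bounded_linear_compose] blin)
  have tcl: "clinear_map t"
    using cl by (simp add: clinear_map_def t_def scaleC_diff_right scaleC_scaleR scaleR_add_right)
  have b_form: "0 \<le> Re (cinner (b x) x)" for x
    using b by (simp add: op_positive_def less_eq_complex_def)
  have b_le: "Re (cinner (b x) x) \<le> L * (norm x)\<^sup>2" for x
  proof -
    have "Re (cinner (b x) x) \<le> norm (b x) * norm x"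
      using hilbert.cauchy_schwarz[of "b x" x] complex_Re_le_cmod[of "cinner (b x) x"] by simp
    also have "\<dots> \<le> (onorm b * norm x) * norm x"
      by (intro mult_right_mono onorm[OF blin]) simp
    also have "\<dots> \<le> L * (norm x)\<^sup>2" by (simp add: L_def power2_eq_square algebra_simps)
    finally show ?thesis .
  qed
  have t_form: "Re (cinner (t x) x) = (norm x)\<^sup>2 - Re (cinner (b x) x) / L" for x
    by (simp add: t_def hilbert.ip_diff_left hilbert.ip_scaleR_left cinner_self)
  interpret T: pos_contraction cinner t
  proof
    show "cinner (t x) y = cinner x (t y)" for x y
      by (simp add: t_def hilbert.ip_diff_left hilbert.ip_diff_right hilbert.ip_scaleR_left
          hilbert.ip_scaleR_right op_positive_hermitian[OF b])
    show "0 \<le> Re (cinner (t x) x)" "Re (cinner (t x) x) \<le> Re (cinner x x)" for x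
      using b_form[of x] b_le[of x] L by (simp_all add: t_form cinner_self field_simps)
  qed (rule tcl)
  define T where "T = bop t"
  have T: "bop_apply T = t" by (simp add: T_def bop_apply_bop tlin)
  \<comment> \<open>The bounds on the form of \<open>t\<close> become a norm bound by
    \<open>sn_S_le\<close>, because the seminorm of \<open>cinner\<close> is the norm.\<close>
  have nT: "norm T \<le> 1"
    using T.sn_S_le by (intro norm_bop_le) (simp_all add: T)
  define Q where "Q = sqrt L *\<^sub>R sqrt_series T"
  have QQ: "Q * Q = L *\<^sub>R (1 - T)"
    using L by (simp add: Q_def sqrt_series_square[OF nT])
  define s where "s = bop_apply Q"
  have ss: "s \<circ> s = b"
  proof
    fix x
    have "(s \<circ> s) x = bop_apply (Q * Q) x" by (simp add: s_def)
    also have "\<dots> = b x" using L unfolding QQ by (simp add: T t_def)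
    finally show "(s \<circ> s) x = b x" .
  qed
  have comm: "s' \<circ> s = s \<circ> s'" if "bounded_linear s'" "s' \<circ> b = b \<circ> s'" for s'
  proof -
    have s': "bop_apply (bop s') = s'" by (rule bop_apply_bop[OF that(1)])
    have "s' (b x) = b (s' x)" for x using that(2) by (metis comp_apply)
    then have "bop s' * T = T * bop s'"
      using that(1) by (intro bop_eqI) (simp add: s' T t_def linear_simps)
    then have "bop s' * sqrt_series T = sqrt_series T * bop s'"
      by (rule sqrt_series_commute[OF nT])
    then have "bop s' * Q = Q * bop s'" by (simp add: Q_def)
    then have "bop_apply (bop s' * Q) x = bop_apply (Q * bop s') x" for x by simp
    then show ?thesis by (simp add: s' s_def fun_eq_iff)
  qed
  have slin: "bounded_linear s" by (simp add: s_def bounded_linear_bop_apply)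
  \<comment> \<open>Elements of \<open>bop\<close> are only real linear. Complex linearity of
    \<open>s\<close> follows because multiplication by \<open>c\<close> commutes with
    \<open>b\<close>.\<close>
  from comm[OF bounded_linear_scaleC] have "(\<lambda>x. c *\<^sub>C x) \<circ> s = s \<circ> (\<lambda>x. c *\<^sub>C x)" for c
    using cl by (simp add: comp_def clinear_map_def)
  then have scl: "bounded_clinear s"
    using slin by (simp add: bounded_clinear_def comp_def) metis
  have cs: "cmod (cinner y x) \<le> norm y * norm x" for x y :: 'h
    using hilbert.cauchy_schwarz[of y x] by simp
  have lin_cinner: "bounded_linear (\<lambda>y. Re (cinner y x))" "bounded_linear (\<lambda>y. Im (cinner y x))" for x :: 'h
    by (auto intro!: bounded_linear_intro[of _ "norm x"]
        simp: hilbert.ip_add_left hilbert.ip_scaleR_left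
        intro: order_trans[OF abs_Re_le_cmod cs] order_trans[OF abs_Im_le_cmod cs])
  have Re_s: "0 \<le> Re (cinner (s x) x)" for x
  proof -
    have "0 \<le> Re (cinner (bop_apply (sqrt_series T) x) x)"
    proof (rule sqrt_series_functional_nonneg[OF nT, where F = "\<lambda>B. Re (cinner (bop_apply B x) x)"])
      show "bounded_linear (\<lambda>B. Re (cinner (bop_apply B x) x))"
        by (rule bounded_linear_compose[OF lin_cinner(1) bounded_linear_bop_apply_left])
      fix k
      have "norm ((t ^^ k) x) \<le> norm x"
      proof (induction k)
        case (Suc k)
        then show ?case using T.sn_S_le[of "(t ^^ k) x"] by simp
      qed simp
      then have "norm ((t ^^ k) x) * norm x \<le> norm x * norm x" by (rule mult_right_mono) simp
      then show "Re (cinner (bop_apply (T ^ k) x) x) \<le> Re (cinner (bop_apply 1 x) x)"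
        using hilbert.cauchy_schwarz[of "(t ^^ k) x" x] complex_Re_le_cmod[of "cinner ((t ^^ k) x) x"]
        by (simp add: bop_apply_power T cinner_self power2_eq_square)
    qed (simp add: cinner_self)
    then show ?thesis using L by (simp add: s_def Q_def hilbert.ip_scaleR_left)
  qed
  \<comment> \<open>The order on complex numbers also demands a real value. It is real for every
    power of \<open>t\<close>, as these are Hermitian, and hence for the series.\<close>
  have Im_s: "Im (cinner (s x) x) = 0" for x
  proof -
    have "Im (cinner ((t ^^ k) x) x) = 0" for k
      using T.Spow_hermitian[of k x x] cinner_commute[of x "(t ^^ k) x"]
      by (simp add: complex_eq_iff)
    moreover have "(\<lambda>k. sqrt_coeff k *\<^sub>R Im (cinner (bop_apply (T ^ k) x) x))
        sums Im (cinner (bop_apply (sqrt_series T) x) x)"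
      by (rule bounded_linear_sqrt_series[OF nT bounded_linear_compose[OF lin_cinner(2) bounded_linear_bop_apply_left]])
    ultimately have "(\<lambda>k. 0) sums Im (cinner (bop_apply (sqrt_series T) x) x)"
      by (simp add: bop_apply_power T)
    then have "Im (cinner (bop_apply (sqrt_series T) x) x) = 0"
      by (rule sums_unique2[OF _ sums_zero])
    then show ?thesis by (simp add: s_def Q_def hilbert.ip_scaleR_left)
  qed
  have "op_positive s"
    using scl Re_s Im_s by (simp add: op_positive_def less_eq_complex_def)
  then show ?thesis using ss comm by blast
qed

text \<open>For \<open>y = (s - s') x\<close>, commutation gives \<open>(s + s') y = 0\<close>. By
  positivity both \<open>s y\<close> and \<open>s' y\<close> vanish, and then
  \<open>cinner y y = cinner x ((s - s') y) = 0\<close>.\<close>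

lemma op_positive_sqrt_unique:
  assumes s: "op_positive s" and s': "op_positive s'" and comm: "s' \<circ> s = s \<circ> s'" and eq: "s \<circ> s = s' \<circ> s'"
  shows "s = s'"
proof
  fix x
  have lin: "linear s" "linear s'"
    using s s' by (simp_all add: op_positive_def bounded_clinear_def bounded_linear.linear)
  define y where "y = s x - s' x"
  have "s y + s' y = 0"
    using comm eq unfolding y_def by (simp add: lin[THEN linear_diff] fun_eq_iff)
  then have "Re (cinner (s y) y) + Re (cinner (s' y) y) = 0"
    by (metis hilbert.ip_add_left hilbert.ip_zero_left plus_complex.simps(1) zero_complex.simps(1))
  moreover have "0 \<le> Re (cinner (s y) y)" "0 \<le> Re (cinner (s' y) y)"
    using s s' by (simp_all add: op_positive_def less_eq_complex_def)
  ultimately have null: "s y = 0" "s' y = 0"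
    using op_positive_null[OF s, of y] op_positive_null[OF s', of y] by auto
  have "cinner y y = cinner x (s y) - cinner x (s' y)"
    by (simp add: y_def hilbert.ip_diff_left hilbert.ip_diff_right lin[THEN linear_diff]
        op_positive_hermitian[OF s] op_positive_hermitian[OF s'])
  then have "(norm y)\<^sup>2 = 0" using cinner_self[of y] null by simp
  then show "s x = s' x" by (simp add: y_def)
qed

lemma op_sqrt:
  assumes "op_positive b"
  shows op_positive_op_sqrt: "op_positive (op_sqrt b)" and op_sqrt_square: "op_sqrt b \<circ> op_sqrt b = b"
proof -
  obtain s where s: "op_positive s" "s \<circ> s = b"
    and comm: "\<And>s'. bounded_linear s' \<Longrightarrow> s' \<circ> b = b \<circ> s' \<Longrightarrow> s' \<circ> s = s \<circ> s'"
    using op_positive_sqrt_exists[OF assms] by blast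
  have unique: "s' = s" if s': "op_positive s'" "s' \<circ> s' = b" for s'
  proof -
    have "s' \<circ> s = s \<circ> s'"
      using s' by (intro comm) (auto simp: op_positive_def bounded_clinear_def comp_assoc)
    then show ?thesis using op_positive_sqrt_unique[OF s(1) s'(1)] s s' by simp
  qed
  have "op_sqrt b = s" unfolding op_sqrt_def
  proof (rule the_equality)
    show "op_positive s \<and> s \<circ> s = b" using s by blast
    show "s' = s" if "op_positive s' \<and> s' \<circ> s' = b" for s' using unique that by blast
  qed
  then show "op_positive (op_sqrt b)" "op_sqrt b \<circ> op_sqrt b = b" using s by simp_all
qed

theorem hilbert_commutator_bound:
  fixes a b :: "'h::complex_hilbert \<Rightarrow> 'h"
  assumes C: "matrix_commutator_bound C"
    and a: "bounded_clinear a" "onorm a \<le> 1" and b: "op_positive b"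
  shows "onorm (\<lambda>x. a (op_sqrt b x) - op_sqrt b (a x)) \<le> C * sqrt (onorm (\<lambda>x. a (b x) - b (a x)))"
proof -
  define s where "s = op_sqrt b"
  have s: "op_positive s" and ss: "s (s x) = b x" for x
    using op_positive_op_sqrt[OF b] op_sqrt_square[OF b] by (simp_all add: s_def fun_eq_iff)
  have lin: "bounded_linear a" "bounded_linear s" "bounded_linear b"
    using a s b by (simp_all add: op_positive_def bounded_clinear_def)
  define m where "m = onorm (\<lambda>x. a (b x) - b (a x))"
  have blin: "bounded_linear (\<lambda>x. a (b x) - b (a x))"
    using lin by (intro bounded_linear_sub) (auto intro: bounded_linear_compose)
  have m: "0 \<le> m" unfolding m_def by (rule onorm_pos_le[OF blin])
  let ?z = "\<lambda>x. a (s x) - s (a x)"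
  have zlin: "linear ?z"
    using lin by (intro bounded_linear.linear bounded_linear_sub) (auto intro: bounded_linear_compose)
  have unit: "cmod (cinner (?z x) y) \<le> C * sqrt m" if "norm x \<le> 1" "norm y \<le> 1" for x y
  proof (rule hilbert.scaled_commutator_bound[OF C, where L = "onorm s + 1" and S = s and A = a])
    show "clinear_map a" "clinear_map s"
      using a s by (simp_all add: op_positive_def bounded_clinear_clinear_map)
    show "csemi_inner.sn cinner (a x) \<le> csemi_inner.sn cinner x" for x
    proof -
      have "norm (a x) \<le> onorm a * norm x" by (rule onorm[OF lin(1)])
      also have "\<dots> \<le> 1 * norm x" by (intro mult_right_mono a) simp
      finally show ?thesis by simp
    qed
    show "cinner (s x) y = cinner x (s y)" for x y by (rule op_positive_hermitian[OF s])
    show "0 \<le> Re (cinner (s x) x)" for x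
      using s by (simp add: op_positive_def less_eq_complex_def)
    show "Re (cinner (s x) x) \<le> (onorm s + 1) * Re (cinner x x)" for x
    proof -
      have "Re (cinner (s x) x) \<le> norm (s x) * norm x"
        using hilbert.cauchy_schwarz[of "s x" x] complex_Re_le_cmod[of "cinner (s x) x"] by simp
      also have "\<dots> \<le> (onorm s * norm x) * norm x"
        by (intro mult_right_mono onorm lin) simp
      also have "\<dots> \<le> (onorm s + 1) * (norm x)\<^sup>2" by (simp add: power2_eq_square algebra_simps)
      finally show ?thesis by (simp add: cinner_self)
    qed
    show "0 < onorm s + 1" using onorm_pos_le[OF lin(2)] by simp
    show "csemi_inner.sn cinner (a (s (s u)) - s (s (a u))) \<le> m * csemi_inner.sn cinner u" for u
      unfolding ss m_def hilbert_sn by (rule onorm[OF blin])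
  qed (use m that in simp_all)
  have "onorm ?z \<le> C * sqrt m"
  proof (rule onorm_bound)
    show "0 \<le> C * sqrt m" using m matrix_commutator_bound_nonneg[OF C] by simp
    fix x
    show "norm (?z x) \<le> C * sqrt m * norm x"
    proof (cases "?z x = 0")
      case True
      then show ?thesis using m matrix_commutator_bound_nonneg[OF C] by simp
    next
      case False
      then have x: "x \<noteq> 0" using linear_0[OF zlin] by auto
      define z where "z = ?z x"
      have z: "z \<noteq> 0" using False by (simp add: z_def)
      \<comment> \<open>Pairing \<open>z\<close> with its own direction recovers
        \<open>norm z\<close>, so the bound on pairings of unit vectors suffices.\<close>
      let ?x = "(1 / norm x) *\<^sub>R x" and ?y = "(1 / norm z) *\<^sub>R z"
      have "cmod (cinner (?z ?x) ?y) \<le> C * sqrt m"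
        using x z by (intro unit) simp_all
      moreover have "?z ?x = (1 / norm x) *\<^sub>R z" unfolding z_def by (rule linear_cmul[OF zlin])
      moreover have "cmod (cinner z z) = (norm z)\<^sup>2"
        using cinner_self[of z] hilbert.ip_self[of z] by (metis norm_of_real abs_power2)
      ultimately have "norm z / norm x \<le> C * sqrt m"
        using z by (simp add: hilbert.ip_scaleR_left hilbert.ip_scaleR_right norm_mult
            norm_divide power2_eq_square)
      then show ?thesis
        using x by (simp add: pos_divide_le_eq flip: z_def)
    qed
  qed
  then show ?thesis by (simp add: s_def m_def)
qed

section \<open>Positive elements of a unital C*-algebra\<close>

lemma star_zero [simp]: "star (0::'a::cstar_algebra) = 0"
  using star_scaleC[of 0 "0::'a"] by simp

lemma star_minus: "star (- x) = - star (x::'a::cstar_algebra)"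
  using star_add[of x "- x"] by (simp add: add_eq_0_iff)

lemma star_diff: "star (x - y) = star x - star (y::'a::cstar_algebra)"
  using star_add[of x "- y"] by (simp add: star_minus)

lemma star_scaleR: "star (r *\<^sub>R x) = r *\<^sub>R star (x::'a::cstar_algebra)"
  by (simp add: scaleR_scaleC star_scaleC)

lemma norm_star: "norm (star x) = norm (x::'a::cstar_algebra)"
proof -
  have le: "norm y \<le> norm (star y)" for y :: 'a
  proof (cases "y = 0")
    case False
    have "norm y * norm y \<le> norm (star y) * norm y"
      using cstar_identity[of y] norm_mult_ineq[of "star y" y] by (simp add: power2_eq_square)
    then show ?thesis using False by simp
  qed simp
  show ?thesis using le[of x] le[of "star x"] by (simp add: star_star)
qed

lemma norm_self_adjoint_square: "star x = x \<Longrightarrow> norm (x * x) = (norm (x::'a::cstar_algebra))\<^sup>2"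
  using cstar_identity[of x] by simp

lemma bounded_linear_star: "bounded_linear (star :: 'a::cstar_algebra \<Rightarrow> 'a)"
  by (rule bounded_linear_intro[of _ 1]) (simp_all add: star_add star_scaleR norm_star)

text \<open>The unitization of every C*-algebra is an instance, which reduces the general case to
  this class.\<close>

class unital_cstar_algebra = cstar_algebra + real_normed_algebra_1

lemma star_one [simp]: "star (1::'u::unital_cstar_algebra) = 1"
  using star_mult[of "star (1::'u::unital_cstar_algebra)" 1] by (simp add: star_star)

lemma star_power: "star (x ^ k) = star (x::'u::unital_cstar_algebra) ^ k"
  by (induction k) (simp_all add: star_mult power_commutes)

lemma star_sqrt_series:
  assumes "star t = t" "norm (t::'u::unital_cstar_algebra) \<le> 1"
  shows "star (sqrt_series t) = sqrt_series t"
proof -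
  have "(\<lambda>k. sqrt_coeff k *\<^sub>R t ^ k) sums star (sqrt_series t)"
    using bounded_linear_sqrt_series[OF assms(2) bounded_linear_star] assms(1) by (simp add: star_power)
  then show ?thesis by (simp add: sqrt_series_def sums_iff)
qed

text \<open>The element \<open>k + i l\<close> is unitary.\<close>

lemma norm_le_one_of_square_sum:
  assumes "star k = k" "star l = l" "k * l = l * k" "k * k + l * l = (1::'u::unital_cstar_algebra)"
  shows "norm k \<le> 1"
proof -
  define u where "u = k + \<i> *\<^sub>C l"
  have su: "star u = k - \<i> *\<^sub>C l"
    by (simp add: u_def star_add star_scaleC assms scaleC_minus_left)
  have "star u * u = k * k + l * l"
    unfolding su by (simp add: u_def algebra_simps scaleC_mult_left scaleC_mult_right scaleC_scaleC
        scaleC_minus_left scaleC_diff_right assms(3))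
  then have "(norm u)\<^sup>2 = 1" using cstar_identity[of u] assms by simp
  then have "norm u = 1" using norm_ge_zero[of u] by (auto simp: power2_eq_1_iff simp del: norm_ge_zero)
  moreover from this have "norm (star u) = 1" by (simp add: norm_star)
  moreover have "k = (1/2) *\<^sub>R (u + star u)" by (simp add: su) (simp add: u_def scaleR_2[symmetric])
  ultimately show ?thesis using norm_triangle_ineq[of u "star u"] by simp
qed

text \<open>With \<open>r\<close> the root of \<open>1 - k * k\<close>, the element
  \<open>r + i k\<close> is unitary. Hence \<open>norm r \<le> 1\<close>, and
  \<open>1 - k * k\<close> is the square of \<open>r\<close>.\<close>

lemma norm_one_minus_square_le:
  assumes k: "star k = k" "norm (k::'u::unital_cstar_algebra) \<le> 1"
  shows "norm (1 - k * k) \<le> 1"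
proof -
  let ?r = "sqrt_series (k * k)"
  have n: "norm (k * k) \<le> 1" using k by (simp add: norm_self_adjoint_square power_le_one)
  have r: "star ?r = ?r" "?r * ?r = 1 - k * k" "k * ?r = ?r * k"
    by (rule star_sqrt_series[OF _ n], simp add: star_mult k, rule sqrt_series_square[OF n],
        rule sqrt_series_commute[OF n], simp add: mult.assoc)
  then have "norm ?r \<le> 1"
    using k by (intro norm_le_one_of_square_sum[of ?r k]) auto
  then have "norm (?r * ?r) \<le> 1" using r(1) by (simp add: norm_self_adjoint_square power_le_one)
  then show ?thesis by (simp add: r)
qed

section \<open>The cone of squares of self-adjoint elements\<close>

text \<open>A notion of positivity without spectra, accessible to norm estimates. For embedded
  elements \<open>cstar_positive_iff\<close> identifies it with positivity of the spectrum.\<close>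

definition cpos :: "'u::unital_cstar_algebra \<Rightarrow> bool" where
  "cpos h \<longleftrightarrow> (\<exists>k. star k = k \<and> h = k * k)"

lemma cpos_star: "cpos h \<Longrightarrow> star h = h"
  by (auto simp: cpos_def star_mult)

lemma cpos_square: "star k = k \<Longrightarrow> cpos (k * k)"
  by (auto simp: cpos_def)

lemma cpos_scaleR: "cpos h \<Longrightarrow> 0 \<le> r \<Longrightarrow> cpos (r *\<^sub>R h)"
  unfolding cpos_def
proof (elim exE conjE)
  fix k assume "star k = k" "h = k * k" "0 \<le> r"
  then show "\<exists>k. star k = k \<and> r *\<^sub>R h = k * k"
    by (intro exI[of _ "sqrt r *\<^sub>R k"]) (simp add: star_scaleR)
qed

text \<open>The series at \<open>1 - h / T\<close> yields a self-adjoint root \<open>s\<close> of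
  \<open>h / T\<close> with \<open>norm (1 - s) \<le> 1\<close>. This is again the hypothesis, so
  \<open>s\<close> has a self-adjoint root and is positive.\<close>

lemma cpos_sqrtI:
  assumes h: "star h = h" and T: "norm (T *\<^sub>R 1 - h) \<le> T"
  shows "\<exists>k. cpos k \<and> k * k = h \<and> (\<forall>y. y * h = h * y \<longrightarrow> y * k = k * y)"
proof (cases "T = 0")
  case True
  have "cpos 0" using cpos_square[of 0] by simp
  then show ?thesis using True T by (intro exI[of _ 0]) auto
next
  case False
  then have T0: "T > 0" using T norm_ge_zero[of "T *\<^sub>R 1 - h"] by linarith
  have main: "\<exists>s. star s = s \<and> s * s = g \<and> norm (1 - s) \<le> 1 \<and> (\<forall>y. y * g = g * y \<longrightarrow> y * s = s * y)"
    if g: "star g = g" "norm (1 - g) \<le> 1" for g :: "'u::unital_cstar_algebra"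
  proof (intro exI[of _ "sqrt_series (1 - g)"] conjI allI impI)
    show "star (sqrt_series (1 - g)) = sqrt_series (1 - g)"
      using g by (intro star_sqrt_series) (simp_all add: star_diff)
    show "sqrt_series (1 - g) * sqrt_series (1 - g) = g"
      using g by (simp add: sqrt_series_square)
    show "norm (1 - sqrt_series (1 - g)) \<le> 1"
      using norm_one_diff_sqrt_series[OF g(2)] by simp
    show "y * sqrt_series (1 - g) = sqrt_series (1 - g) * y" if "y * g = g * y" for y
      using that by (intro sqrt_series_commute[OF g(2)]) (simp add: algebra_simps)
  qed
  define g where "g = (1 / T) *\<^sub>R h"
  have "1 - g = (1 / T) *\<^sub>R (T *\<^sub>R 1 - h)" using T0 by (simp add: g_def scaleR_diff_right)
  then have g: "star g = g" "norm (1 - g) \<le> 1"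
    using T T0 h by (simp_all add: star_scaleR g_def)
  from main[OF g] obtain s where s: "star s = s" "s * s = g" "norm (1 - s) \<le> 1"
    and comm: "\<And>y. y * g = g * y \<Longrightarrow> y * s = s * y" by blast
  from main[OF s(1,3)] have "cpos s" by (metis cpos_def)
  then have "cpos (sqrt T *\<^sub>R s)" using T0 by (intro cpos_scaleR) auto
  moreover have "(sqrt T *\<^sub>R s) * (sqrt T *\<^sub>R s) = h" using T0 by (simp add: s g_def)
  moreover have "y * (sqrt T *\<^sub>R s) = (sqrt T *\<^sub>R s) * y" if "y * h = h * y" for y
    using comm[of y] that by (simp add: g_def)
  ultimately show ?thesis by blast
qed

lemma cposI: "star h = h \<Longrightarrow> norm (T *\<^sub>R 1 - h) \<le> T \<Longrightarrow> cpos h"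
  using cpos_sqrtI[of h T] cpos_square cpos_star by metis

text \<open>After scaling this is \<open>norm_one_minus_square_le\<close>. Together with
  \<open>cposI\<close> it describes positivity by balls centred at multiples of 1, so that closure
  under sums becomes the triangle inequality.\<close>

lemma cposD:
  assumes "cpos h" "norm h \<le> T"
  shows "norm (T *\<^sub>R 1 - h) \<le> T"
proof (cases "T = 0")
  case True
  then show ?thesis using assms by simp
next
  case False
  then have T: "T > 0" using assms norm_ge_zero[of h] by linarith
  obtain k where k: "star k = k" "h = k * k" using assms by (auto simp: cpos_def)
  define l where "l = (1 / sqrt T) *\<^sub>R k"
  have ll: "l * l = (1 / T) *\<^sub>R h" using T by (simp add: l_def k)
  have l: "star l = l" by (simp add: l_def star_scaleR k)
  have "(norm l)\<^sup>2 = norm h / T" using norm_self_adjoint_square[OF l] T by (simp add: ll)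
  then have "(norm l)\<^sup>2 \<le> 1" using assms T by simp
  then have "norm (1 - l * l) \<le> 1"
    using l by (intro norm_one_minus_square_le) (simp_all add: power2_le_iff_abs_le abs_square_le_1)
  moreover have "T *\<^sub>R 1 - h = T *\<^sub>R (1 - l * l)" using T by (simp add: ll scaleR_diff_right)
  ultimately show ?thesis using T by simp
qed

lemma cpos_sqrt:
  "cpos h \<Longrightarrow> \<exists>k. cpos k \<and> k * k = h \<and> (\<forall>y. y * h = h * y \<longrightarrow> y * k = k * y)"
  using cpos_sqrtI[OF cpos_star cposD[OF _ order_refl]] by blast

lemma cpos_add:
  assumes "cpos g" "cpos h"
  shows "cpos (g + h)"
proof (rule cposI)
  show "star (g + h) = g + h" using assms by (simp add: star_add cpos_star)
  have eq: "(norm g + norm h) *\<^sub>R 1 - (g + h) = (norm g *\<^sub>R 1 - g) + (norm h *\<^sub>R 1 - h)"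
    by (simp add: scaleR_add_left)
  show "norm ((norm g + norm h) *\<^sub>R 1 - (g + h)) \<le> norm g + norm h"
    unfolding eq
    using norm_triangle_ineq[of "norm g *\<^sub>R 1 - g" "norm h *\<^sub>R 1 - h"]
      cposD[OF assms(1) order_refl] cposD[OF assms(2) order_refl] by linarith
qed

lemma cpos_scalar: "0 \<le> r \<Longrightarrow> cpos (r *\<^sub>R 1)"
  using cpos_square[of 1] cpos_scaleR[of 1 r] by simp

lemma cpos_norm_diff: "star h = h \<Longrightarrow> norm h \<le> T \<Longrightarrow> cpos (T *\<^sub>R 1 - h)"
  by (rule cposI[of _ T]) (simp_all add: star_diff star_scaleR)

text \<open>Write \<open>h = k * k\<close> and \<open>c - h = l * l\<close> with commuting
  \<open>k\<close> and \<open>l\<close>; divided by \<open>sqrt c\<close>, their squares sum to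
  1.\<close>

lemma norm_le_of_cpos:
  assumes h: "cpos h" and c: "cpos (c *\<^sub>R 1 - h)" "0 < c"
  shows "norm h \<le> c"
proof -
  obtain k where k: "star k = k" "h = k * k" using h by (auto simp: cpos_def)
  obtain l where l: "cpos l" "l * l = c *\<^sub>R 1 - h" and comm: "\<And>y. y * (c *\<^sub>R 1 - h) = (c *\<^sub>R 1 - h) * y \<Longrightarrow> y * l = l * y"
    using cpos_sqrt[OF c(1)] by blast
  have kl: "k * l = l * k" by (rule comm) (simp add: k algebra_simps)
  define r where "r = 1 / sqrt c"
  have r: "r * r = 1 / c" using c by (simp add: r_def)
  have "norm (r *\<^sub>R k) \<le> 1"
  proof (rule norm_le_one_of_square_sum)
    show "(r *\<^sub>R k) * (r *\<^sub>R k) + (r *\<^sub>R l) * (r *\<^sub>R l) = 1"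
      using c by (simp add: r l(2) flip: k(2) scaleR_add_right)
  qed (simp_all add: star_scaleR k l cpos_star kl)
  then have "(r * norm k)\<^sup>2 \<le> 1" using c by (intro power_le_one) (simp_all add: r_def)
  then have "(norm k)\<^sup>2 \<le> c" using c by (simp add: power_mult_distrib power2_eq_square[of r] r)
  then show ?thesis using k norm_self_adjoint_square[of k] by simp
qed

text \<open>For every \<open>e > 0\<close> the element \<open>e - h\<close> is positive, so
  \<open>norm h \<le> e\<close>.\<close>

lemma cpos_antisym:
  assumes "cpos h" "cpos (- h)"
  shows "h = 0"
proof -
  have "norm h \<le> 0 + e" if "e > 0" for e
    using norm_le_of_cpos[OF assms(1) _ that] cpos_add[OF cpos_scalar[of e] assms(2)] that by simp
  then have "norm h \<le> 0" by (rule field_le_epsilon)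
  then show ?thesis by simp
qed

section \<open>Positivity and invertibility\<close>

definition invertible_elt :: "'u::unital_cstar_algebra \<Rightarrow> bool" where
  "invertible_elt x \<longleftrightarrow> (\<exists>p. x * p = 1 \<and> p * x = 1)"

lemma invertible_eltI: "x * p = 1 \<Longrightarrow> q * x = 1 \<Longrightarrow> invertible_elt x"
  unfolding invertible_elt_def by (metis mult.assoc mult_1 mult_1_right)

lemma invertible_elt_of_commuting_product:
  assumes "x * y = w" "y * x = w" "invertible_elt w"
  shows "invertible_elt x"
proof -
  obtain p where "w * p = 1" "p * w = 1" using assms(3) by (auto simp: invertible_elt_def)
  then show ?thesis using assms by (intro invertible_eltI[of x "y * p" "p * y"]) (metis mult.assoc)+
qed

lemma invertible_elt_scaleR:
  assumes "invertible_elt x" "r \<noteq> 0"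
  shows "invertible_elt (r *\<^sub>R x)"
proof -
  obtain p where "x * p = 1" "p * x = 1" using assms(1) by (auto simp: invertible_elt_def)
  then show ?thesis using assms(2) by (intro invertible_eltI[of _ "(1 / r) *\<^sub>R p" "(1 / r) *\<^sub>R p"]) simp_all
qed

text \<open>The Neumann series.\<close>

lemma invertible_elt_one_minus:
  assumes "norm t < 1"
  shows "invertible_elt (1 - t)"
proof -
  have s: "summable (\<lambda>k. t ^ k)"
    by (rule summable_comparison_test'[OF summable_geometric[of "norm t"]])
      (use assms in \<open>simp_all add: norm_power_ineq\<close>)
  define S where "S = (\<Sum>k. t ^ k)"
  have "S = 1 + (\<Sum>k. t ^ Suc k)"
    using suminf_split_head[OF s] by (simp add: S_def)
  moreover have "(\<Sum>k. t ^ Suc k) = t * S" "(\<Sum>k. t ^ Suc k) = S * t"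
    unfolding S_def using suminf_mult[OF s, of t] suminf_mult2[OF s, of t] by (simp_all add: power_commutes)
  ultimately have "S = 1 + t * S" "S = 1 + S * t" by simp_all
  then show ?thesis by (intro invertible_eltI[of _ S S]) (simp_all add: algebra_simps)
qed

text \<open>By \<open>cposD\<close>, \<open>h + r\<close> differs from \<open>norm h + r\<close> by
  at most \<open>norm h\<close>, which is strictly smaller; the Neumann series applies.\<close>

lemma invertible_elt_cpos_add:
  assumes "cpos h" "0 < r"
  shows "invertible_elt (h + r *\<^sub>R 1)"
proof -
  define T where "T = norm h + r"
  have T: "T > 0" using assms(2) norm_ge_zero[of h] by (simp add: T_def add_nonneg_pos)
  define t where "t = (1 / T) *\<^sub>R (norm h *\<^sub>R 1 - h)"
  have "norm t \<le> norm h / T"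
    using cposD[OF assms(1) order_refl] T by (simp add: t_def divide_right_mono)
  also have "\<dots> < 1" using T assms(2) by (simp add: T_def)
  finally have "invertible_elt (T *\<^sub>R (1 - t))"
    using T by (intro invertible_elt_scaleR invertible_elt_one_minus) auto
  moreover have "T *\<^sub>R (1 - t) = h + r *\<^sub>R 1"
    using T by (simp add: t_def scaleR_diff_right) (simp add: T_def algebra_simps)
  ultimately show ?thesis by simp
qed

text \<open>For nonreal \<open>z\<close> put \<open>g = h - Re z\<close> and
  \<open>b = Im z\<close>. Then \<open>(g - i b) (g + i b) = g\<^sup>2 + b\<^sup>2\<close>, which is
  invertible because \<open>g\<^sup>2\<close> is positive.\<close>

lemma cpos_imp_invertible_elt:
  fixes h :: "'u::unital_cstar_algebra"
  assumes h: "cpos h" and z: "\<not> 0 \<le> z"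
  shows "invertible_elt (h - z *\<^sub>C 1)"
proof (cases "Im z = 0")
  case True
  then have "Re z < 0" using z by (simp add: less_eq_complex_def)
  moreover have "z = of_real (Re z)" using True by (simp add: complex_eq_iff)
  then have "h - z *\<^sub>C 1 = h + (- Re z) *\<^sub>R 1" by (metis diff_conv_add_uminus scaleR_minus_left scaleR_scaleC)
  ultimately show ?thesis using invertible_elt_cpos_add[OF h, of "- Re z"] by simp
next
  case False
  define g where "g = h - Re z *\<^sub>R 1"
  define b where "b = Im z"
  have "z *\<^sub>C (1::'u) = Re z *\<^sub>R 1 + b *\<^sub>R (\<i> *\<^sub>C 1)"
  proof -
    have "z = of_real (Re z) + of_real b * \<i>" by (simp add: complex_eq_iff b_def)
    then have "z *\<^sub>C (1::'u) = (of_real (Re z) + of_real b * \<i>) *\<^sub>C 1" by simp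
    then show ?thesis by (simp only: scaleR_scaleC scaleC_scaleC scaleC_add_left)
  qed
  then have eq: "h - z *\<^sub>C 1 = g - b *\<^sub>R (\<i> *\<^sub>C 1)" by (simp add: g_def)
  have g: "cpos (g * g)" using h by (intro cpos_square) (simp add: g_def star_diff star_scaleR cpos_star)
  let ?e = "b *\<^sub>R (\<i> *\<^sub>C (1::'u))"
  have ge: "g * ?e = ?e * g" by (simp add: scaleC_mult_left scaleC_mult_right)
  have ee: "?e * ?e = - (b\<^sup>2 *\<^sub>R 1)"
    by (simp add: scaleC_mult_left scaleC_mult_right scaleC_scaleC scaleC_scaleR scaleC_minus_left power2_eq_square)
  have "(g - ?e) * (g + ?e) = g * g + b\<^sup>2 *\<^sub>R 1" "(g + ?e) * (g - ?e) = g * g + b\<^sup>2 *\<^sub>R 1"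
    using ge ee by (simp_all add: distrib_left distrib_right left_diff_distrib right_diff_distrib
        del: mult_scaleR_left mult_scaleR_right)
  moreover have "invertible_elt (g * g + b\<^sup>2 *\<^sub>R 1)"
    using False by (intro invertible_elt_cpos_add[OF g]) (simp add: b_def)
  ultimately show ?thesis unfolding eq by (rule invertible_elt_of_commuting_product)
qed

text \<open>Lower \<open>r\<close> as long as \<open>h + r\<close> is positive: at a positive infimum the element \<open>h + r\<close> is
  positive and invertible, so a little more can be subtracted.\<close>

lemma invertible_elt_imp_cpos:
  assumes h: "star h = h" and inv: "\<And>r. 0 < r \<Longrightarrow> invertible_elt (h + r *\<^sub>R 1)"
  shows "cpos h"
proof -
  define \<Lambda> where "\<Lambda> = {r. 0 \<le> r \<and> cpos (h + r *\<^sub>R 1)}"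
  have "cpos (norm h *\<^sub>R 1 - (- h))" using h by (intro cpos_norm_diff) (simp_all add: star_minus)
  then have ne: "\<Lambda> \<noteq> {}" by (auto simp: \<Lambda>_def add.commute intro!: exI[of _ "norm h"])
  have bdd: "bdd_below \<Lambda>" by (auto simp: \<Lambda>_def)
  define r where "r = Inf \<Lambda>"
  have r0: "0 \<le> r" unfolding r_def by (rule cInf_greatest[OF ne]) (simp add: \<Lambda>_def)
  have above: "cpos (h + (r + e) *\<^sub>R 1)" if e: "e > 0" for e
  proof -
    obtain q where q: "q \<in> \<Lambda>" "q < r + e"
      using cInf_lessD[OF ne, of "r + e"] e by (auto simp: r_def)
    have "cpos ((h + q *\<^sub>R 1) + (r + e - q) *\<^sub>R 1)"
      by (rule cpos_add[OF _ cpos_scalar]) (use q in \<open>auto simp: \<Lambda>_def\<close>)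
    then show ?thesis by (simp add: algebra_simps)
  qed
  define g where "g = h + r *\<^sub>R 1"
  have sg: "star g = g" by (simp add: g_def star_add star_scaleR h)
  \<comment> \<open>Positivity passes to the infimum because the norm condition of
    \<open>cposI\<close> is closed; the constant \<open>norm g + 1\<close> fits all shifts up to
    1.\<close>
  have "cpos g"
  proof (rule cposI[OF sg])
    show "norm ((norm g + 1) *\<^sub>R 1 - g) \<le> norm g + 1"
    proof (rule field_le_epsilon)
      fix e :: real assume e: "e > 0"
      define d where "d = min e 1"
      have d: "0 < d" "d \<le> e" "d \<le> 1" using e by (auto simp: d_def)
      have "cpos (g + d *\<^sub>R 1)" using above[OF d(1)] by (simp add: g_def algebra_simps)
      moreover have "norm (g + d *\<^sub>R 1) \<le> norm g + 1"
        using norm_triangle_ineq[of g "d *\<^sub>R 1"] d by simp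
      ultimately have "norm ((norm g + 1) *\<^sub>R 1 - (g + d *\<^sub>R 1)) \<le> norm g + 1" by (rule cposD)
      moreover have "(norm g + 1) *\<^sub>R 1 - g = ((norm g + 1) *\<^sub>R 1 - (g + d *\<^sub>R 1)) + d *\<^sub>R 1" by simp
      ultimately show "norm ((norm g + 1) *\<^sub>R 1 - g) \<le> norm g + 1 + e"
        using norm_triangle_ineq[of "(norm g + 1) *\<^sub>R 1 - (g + d *\<^sub>R 1)" "d *\<^sub>R 1"] d by simp
    qed
  qed
  have "r = 0"
  proof (rule ccontr)
    assume "r \<noteq> 0"
    then have r: "r > 0" using r0 by simp
    obtain p where p: "g * p = 1" "p * g = 1" using inv[OF r] by (auto simp: g_def invertible_elt_def)
    have sp: "star p = p"
    proof -
      have "star p * g = 1" using p(1) sg by (metis star_mult star_one)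
      then show ?thesis using p by (metis mult.assoc mult_1 mult_1_right)
    qed
    obtain q where q: "cpos q" "q * q = g" and commq: "\<And>y. y * g = g * y \<Longrightarrow> y * q = q * y"
      using cpos_sqrt[OF \<open>cpos g\<close>] by blast
    \<comment> \<open>The second bound makes \<open>1 - e p\<close> positive, the first keeps
      \<open>r - e\<close> nonnegative. Then \<open>h + r - e = g (1 - e p)\<close> is the square of
      \<open>q l\<close>, against the choice of \<open>r\<close>.\<close>
    define e where "e = min r (1 / (norm p + 1))"
    have np: "norm p + 1 > 0" by (simp add: add_nonneg_pos)
    have e: "0 < e" "e \<le> r" using r np by (simp_all add: e_def)
    have "e * norm p \<le> (1 / (norm p + 1)) * norm p" by (intro mult_right_mono) (auto simp: e_def)
    also have "\<dots> \<le> 1" using np by (simp add: field_simps)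
    finally have "norm (1 *\<^sub>R 1 - (1 - e *\<^sub>R p)) \<le> 1" using e by simp
    moreover have "star (1 - e *\<^sub>R p) = 1 - e *\<^sub>R p" by (simp add: star_diff star_scaleR sp)
    ultimately obtain l where l: "cpos l" "l * l = 1 - e *\<^sub>R p"
      and comml: "\<And>y. y * (1 - e *\<^sub>R p) = (1 - e *\<^sub>R p) * y \<Longrightarrow> y * l = l * y"
      using cpos_sqrtI by blast
    have "p * q = q * p" by (rule commq) (simp add: p)
    then have ql: "q * l = l * q" by (intro comml) (simp add: algebra_simps)
    have "star (q * l) = q * l" by (simp add: star_mult q l cpos_star ql)
    then have "cpos ((q * l) * (q * l))" by (rule cpos_square)
    also have "(q * l) * (q * l) = (q * q) * (l * l)" using ql by (metis mult.assoc)
    also have "\<dots> = h + (r - e) *\<^sub>R 1" by (simp add: q l p right_diff_distrib) (simp add: g_def algebra_simps)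
    finally have "r - e \<in> \<Lambda>" using e by (simp add: \<Lambda>_def)
    then have "r \<le> r - e" unfolding r_def by (rule cInf_lower[OF _ bdd])
    then show False using e by simp
  qed
  then show ?thesis using \<open>cpos g\<close> by (simp add: g_def)
qed

text \<open>The products \<open>x y\<close> and \<open>y x\<close> have the same nonzero spectrum:
  if \<open>p\<close> inverts \<open>x y + r\<close>, then \<open>(1 - y p x) / r\<close> inverts
  \<open>y x + r\<close>.\<close>

lemma invertible_elt_swap:
  assumes "invertible_elt (x * y + r *\<^sub>R 1)" "r \<noteq> 0"
  shows "invertible_elt (y * x + r *\<^sub>R 1)"
proof -
  obtain p where p: "(x * y + r *\<^sub>R 1) * p = 1" "p * (x * y + r *\<^sub>R 1) = 1"
    using assms(1) by (auto simp: invertible_elt_def)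
  let ?q = "(1 / r) *\<^sub>R (1 - y * p * x)"
  have "(y * x + r *\<^sub>R 1) * (1 - y * p * x) = y * x + r *\<^sub>R 1 - y * ((x * y + r *\<^sub>R 1) * p) * x"
    by (simp add: algebra_simps)
  moreover have "(1 - y * p * x) * (y * x + r *\<^sub>R 1) = y * x + r *\<^sub>R 1 - y * (p * (x * y + r *\<^sub>R 1)) * x"
    by (simp add: algebra_simps)
  ultimately show ?thesis using assms(2) unfolding p
    by (intro invertible_eltI[of _ ?q ?q]) simp_all
qed

text \<open>The argument of Fukamiya, Kelley and Vaught.\<close>

lemma cpos_star_mult: "cpos (star x * (x::'u::unital_cstar_algebra))"
proof -
  define y where "y = star x * x"
  have sy: "star y = y" by (simp add: y_def star_mult star_star)
  obtain m where m: "cpos m" "m * m = y * y" and commm: "\<And>z. z * (y * y) = (y * y) * z \<Longrightarrow> z * m = m * z"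
    using cpos_sqrt[OF cpos_square[OF sy]] by blast
  have ym: "y * m = m * y" by (rule commm) (simp add: mult.assoc)
  \<comment> \<open>\<open>m\<close> is the absolute value of \<open>y\<close>, and
    \<open>u\<close>, \<open>v\<close> are twice its positive and negative parts. The aim is
    \<open>v = 0\<close>.\<close>
  define u v where "u = m + y" and "v = m - y"
  have uv: "u * v = 0" "v * u = 0" by (simp_all add: u_def v_def algebra_simps m ym)
  have sv: "star v = v" by (simp add: v_def star_diff sy m cpos_star)
  have "cpos v"
  proof (rule invertible_elt_imp_cpos[OF sv])
    fix r :: real assume r: "r > 0"
    \<comment> \<open>Because \<open>u v = 0\<close> and \<open>u + v = 2 m\<close>, the product is
      \<open>2 r m + r\<^sup>2\<close>, invertible by the positivity of \<open>m\<close>.\<close>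
    have prod: "(v + r *\<^sub>R 1) * (u + r *\<^sub>R 1) = (2 * r) *\<^sub>R (m + (r / 2) *\<^sub>R 1)"
      "(u + r *\<^sub>R 1) * (v + r *\<^sub>R 1) = (2 * r) *\<^sub>R (m + (r / 2) *\<^sub>R 1)"
    proof -
      have "r *\<^sub>R (u + v) = (2 * r) *\<^sub>R m" by (simp add: u_def v_def scaleR_2[symmetric] mult.commute flip: scaleR_2)
      then show "(v + r *\<^sub>R 1) * (u + r *\<^sub>R 1) = (2 * r) *\<^sub>R (m + (r / 2) *\<^sub>R 1)"
        "(u + r *\<^sub>R 1) * (v + r *\<^sub>R 1) = (2 * r) *\<^sub>R (m + (r / 2) *\<^sub>R 1)"
        by (simp_all add: distrib_left distrib_right uv scaleR_add_right add_ac)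
    qed
    show "invertible_elt (v + r *\<^sub>R 1)"
      using invertible_elt_of_commuting_product[OF prod] r
        invertible_elt_scaleR[OF invertible_elt_cpos_add[OF m(1)], of "r / 2" "2 * r"] by simp
  qed
  then obtain q where q: "cpos q" "q * q = v" using cpos_sqrt by blast
  have "star (q * v) = q * v" by (simp add: star_mult sv q cpos_star flip: q(2)) (simp add: mult.assoc)
  then have "cpos ((q * v) * (q * v))" by (rule cpos_square)
  also have "(q * v) * (q * v) = v * v * v" unfolding q(2)[symmetric] by (simp add: mult.assoc)
  finally have v3: "cpos (v * v * v)" .
  define w where "w = x * v"
  have ww: "star w * w = - ((1/2) *\<^sub>R (v * v * v))"
  proof -
    have "y = (1/2) *\<^sub>R (u - v)" by (simp add: u_def v_def scaleR_2[symmetric])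
    moreover have "star w * w = v * y * v" by (simp add: w_def y_def star_mult sv mult.assoc)
    ultimately show ?thesis by (simp add: right_diff_distrib left_diff_distrib uv)
  qed
  \<comment> \<open>The real and imaginary parts of \<open>w\<close>. Twice the sum of their squares
    is \<open>w * star w + star w * w\<close>, so the negativity of \<open>star w * w\<close> makes
    \<open>w * star w\<close> positive.\<close>
  define c d where "c = (1/2) *\<^sub>R (w + star w)" and "d = (1/2) *\<^sub>R (\<i> *\<^sub>C (star w - w))"
  have "cpos (c * c)" "cpos (d * d)"
    by (intro cpos_square; simp add: c_def d_def star_add star_diff star_scaleR star_scaleC star_star
        add.commute scaleC_diff_right scaleC_minus_left)+
  moreover have "w * star w = 2 *\<^sub>R (c * c + d * d) + (1/2) *\<^sub>R (v * v * v)"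
  proof -
    have cc: "4 *\<^sub>R (c * c) = (w + star w) * (w + star w)" by (simp add: c_def)
    have dd: "4 *\<^sub>R (d * d) = - ((star w - w) * (star w - w))"
      by (simp add: d_def scaleC_mult_left scaleC_mult_right scaleC_scaleC scaleC_scaleR scaleC_minus_left)
    have "2 *\<^sub>R (2 *\<^sub>R (c * c + d * d)) = 4 *\<^sub>R (c * c) + 4 *\<^sub>R (d * d)" by (simp add: scaleR_add_right)
    also have "\<dots> = 2 *\<^sub>R (w * star w + star w * w)"
      unfolding cc dd scaleR_2 by (simp add: algebra_simps)
    finally have "2 *\<^sub>R (c * c + d * d) = w * star w + star w * w"
      by (simp only: scaleR_cancel_left) simp
    then show ?thesis using ww by simp
  qed
  ultimately have "cpos (w * star w)"
    using v3 by (simp add: cpos_add cpos_scaleR)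
  \<comment> \<open>Interchanging the factors transfers positivity to \<open>star w * w\<close>.
    That element is minus half of \<open>v * v * v\<close>, so the cube is both positive and
    negative.\<close>
  then have "invertible_elt (star w * w + r *\<^sub>R 1)" if "r > 0" for r
    using invertible_elt_swap[of w "star w" r] invertible_elt_cpos_add that by auto
  then have "cpos (star w * w)"
    by (intro invertible_elt_imp_cpos) (simp add: star_mult star_star)
  then have "cpos (2 *\<^sub>R (star w * w))" by (rule cpos_scaleR) simp
  then have "v * v * v = 0" using ww by (intro cpos_antisym v3) simp
  then have "(v * v) * (v * v) = 0" by (simp flip: mult.assoc)
  then have "v = 0"
    using norm_self_adjoint_square[of "v * v"] norm_self_adjoint_square[OF sv] by (simp add: star_mult sv)
  then show ?thesis using m(1) by (simp add: v_def y_def)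
qed

text \<open>The constructed root \<open>k\<close> commutes with any other root \<open>t\<close>. For
  \<open>d = k - t\<close> the positive elements \<open>d k d\<close> and \<open>d t d\<close> sum
  to zero, so both vanish and \<open>d\<^sup>3 = 0\<close>.\<close>

lemma cpos_sqrt_unique:
  assumes s: "cpos s" "cpos s'" and eq: "s * s = s' * s'"
  shows "s = s'"
proof -
  have "cpos (s * s)" by (rule cpos_square[OF cpos_star[OF s(1)]])
  then obtain k where k: "cpos k" "k * k = s * s"
    and comm: "\<And>y. y * (s * s) = (s * s) * y \<Longrightarrow> y * k = k * y"
    using cpos_sqrt by blast
  have "k = t" if t: "cpos t" "t * t = s * s" for t
  proof -
    have tk: "t * k = k * t" by (rule comm) (simp flip: t(2) add: mult.assoc)
    define d where "d = k - t"
    have sd: "star d = d" by (simp add: d_def star_diff k t cpos_star)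
    have conj: "cpos (d * g * d)" if g: "cpos g" for g
    proof -
      obtain l where l: "star l = l" "g = l * l" using g by (auto simp: cpos_def)
      have "d * g * d = star (l * d) * (l * d)" by (simp add: star_mult sd l mult.assoc)
      then show ?thesis by (simp add: cpos_star_mult)
    qed
    have "d * (k + t) = 0" by (simp add: d_def algebra_simps k t tk)
    then have "d * k * d + d * t * d = 0" by (metis distrib_left distrib_right mult_zero_left)
    then have neg: "d * t * d = - (d * k * d)" by (simp add: add_eq_0_iff)
    have "d * k * d = 0"
      using conj[OF k(1)] conj[OF t(1)] by (intro cpos_antisym) (simp_all add: neg)
    moreover from this neg have "d * t * d = 0" by simp
    moreover have "d * d * d = d * k * d - d * t * d"
      by (subst (2) d_def) (simp add: right_diff_distrib left_diff_distrib)
    ultimately have "(d * d) * (d * d) = 0" by (simp flip: mult.assoc)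
    then have "d = 0"
      using norm_self_adjoint_square[of "d * d"] norm_self_adjoint_square[OF sd] by (simp add: star_mult sd)
    then show ?thesis by (simp add: d_def)
  qed
  then show ?thesis using s eq by metis
qed

section \<open>The unitization\<close>

text \<open>Left multiplication by \<open>x + c 1\<close>. Its operator norm on the algebra is the
  source of the C*-norm on the unitization.\<close>

definition unit_act :: "'a::cstar_algebra \<times> complex \<Rightarrow> 'a \<Rightarrow> 'a" where
  "unit_act p y = fst p * y + snd p *\<^sub>C y"

definition unit_star :: "'a::cstar_algebra \<times> complex \<Rightarrow> 'a \<times> complex" where
  "unit_star p = (star (fst p), cnj (snd p))"

text \<open>The second argument of the maximum matters only if the algebra has a unit \<open>e\<close>: then
  \<open>(- e, 1)\<close> acts as zero.\<close>

definition unit_norm :: "'a::cstar_algebra \<times> complex \<Rightarrow> real" where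
  "unit_norm p = max (onorm (unit_act p)) (cmod (snd p))"

lemma bounded_linear_unit_act: "bounded_linear (unit_act p)"
  unfolding unit_act_def by (intro bounded_linear_add bounded_linear_mult_right bounded_linear_scaleC)

lemma unit_act_add: "unit_act (p + q) y = unit_act p y + unit_act q y"
  by (simp add: unit_act_def algebra_simps scaleC_add_left)

lemma unit_act_mult: "unit_act (unitization_mult p q) y = unit_act p (unit_act q y)"
  by (simp add: unit_act_def unitization_mult_def algebra_simps scaleC_add_right scaleC_mult_left
      scaleC_mult_right scaleC_scaleC)

lemma star_unit_act_mult: "star (unit_act p y) * z = star y * unit_act (unit_star p) z"
  by (simp add: unit_act_def unit_star_def star_add star_mult star_scaleC algebra_simps
      scaleC_mult_left scaleC_mult_right)

text \<open>The norm is attained in the direction of \<open>star x\<close>, by the C*-identity.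
  Hence the embedding into the unitization is isometric.\<close>

lemma onorm_mult_left: "onorm (\<lambda>y. x * y) = norm (x::'a::cstar_algebra)"
proof (rule antisym)
  show "onorm (\<lambda>y. x * y) \<le> norm x" by (rule onorm_bound) (simp_all add: norm_mult_ineq)
  have "norm x * norm x = norm (x * star x)"
    using cstar_identity[of "star x"] by (simp add: star_star norm_star power2_eq_square)
  also have "\<dots> \<le> onorm (\<lambda>y. x * y) * norm x"
    using onorm[OF bounded_linear_mult_right, of x "star x"] by (simp add: norm_star)
  finally show "norm x \<le> onorm (\<lambda>y. x * y)"
    by (cases "x = 0") (auto simp: onorm_zero)
qed

lemma onorm_unit_act_mult_le:
  "onorm (unit_act (unitization_mult p q)) \<le> onorm (unit_act p) * onorm (unit_act q)"
proof -
  have "unit_act (unitization_mult p q) = unit_act p \<circ> unit_act q"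
    by (simp add: fun_eq_iff unit_act_mult)
  then show ?thesis using onorm_compose[OF bounded_linear_unit_act bounded_linear_unit_act] by metis
qed

text \<open>The C*-identity of the algebra is applied to \<open>unit_act q y\<close>: its squared
  norm is that of \<open>star y\<close> times the action of \<open>star q * q\<close> on
  \<open>y\<close>.\<close>

lemma onorm_unit_act_star_mult:
  "onorm (unit_act (unitization_mult (unit_star p) p)) = (onorm (unit_act p))\<^sup>2"
proof -
  have ge: "(onorm (unit_act q))\<^sup>2 \<le> onorm (unit_act (unitization_mult (unit_star q) q))"
    for q :: "'a \<times> complex"
  proof -
    let ?Q = "onorm (unit_act (unitization_mult (unit_star q) q))"
    have Q: "0 \<le> ?Q" by (rule onorm_pos_le[OF bounded_linear_unit_act])
    have "onorm (unit_act q) \<le> sqrt ?Q"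
    proof (rule onorm_bound)
      fix y
      have "(norm (unit_act q y))\<^sup>2 = norm (star y * unit_act (unitization_mult (unit_star q) q) y)"
        by (simp add: star_unit_act_mult unit_act_mult flip: cstar_identity)
      also have "\<dots> \<le> norm y * (?Q * norm y)"
        by (rule order_trans[OF norm_mult_ineq])
          (simp add: norm_star mult_left_mono onorm[OF bounded_linear_unit_act])
      also have "\<dots> = (sqrt ?Q * norm y)\<^sup>2" using Q by (simp add: power_mult_distrib power2_eq_square[of "norm y"])
      finally show "norm (unit_act q y) \<le> sqrt ?Q * norm y"
        by (rule power2_le_imp_le) (simp add: Q)
    qed (simp add: Q)
    then have "(onorm (unit_act q))\<^sup>2 \<le> (sqrt ?Q)\<^sup>2"
      by (intro power_mono onorm_pos_le[OF bounded_linear_unit_act])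
    then show ?thesis using Q by simp
  qed
  have le: "onorm (unit_act q) \<le> onorm (unit_act (unit_star q))" for q :: "'a \<times> complex"
  proof (cases "onorm (unit_act q) = 0")
    case False
    then have pos: "0 < onorm (unit_act q)"
      using onorm_pos_le[OF bounded_linear_unit_act, of q] by simp
    have "onorm (unit_act q) * onorm (unit_act q) \<le> onorm (unit_act (unit_star q)) * onorm (unit_act q)"
      using ge[of q] onorm_unit_act_mult_le[of "unit_star q" q] by (simp add: power2_eq_square)
    then show ?thesis using pos by simp
  qed (simp add: onorm_pos_le[OF bounded_linear_unit_act])
  have "onorm (unit_act (unit_star p)) = onorm (unit_act p)"
    using le[of p] le[of "unit_star p"] by (simp add: unit_star_def star_star)
  then show ?thesis
    using ge[of p] onorm_unit_act_mult_le[of "unit_star p" p] by (simp add: power2_eq_square)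
qed

lemma cmod_snd_le_unit_norm: "cmod (snd p) \<le> unit_norm p"
  by (simp add: unit_norm_def)

lemma unit_norm_le: "unit_norm p \<le> norm (fst p) + cmod (snd p)"
proof -
  have "onorm (unit_act p) \<le> norm (fst p) + cmod (snd p)"
  proof (rule onorm_bound)
    fix y
    have "norm (unit_act p y) \<le> norm (fst p * y) + norm (snd p *\<^sub>C y)"
      unfolding unit_act_def by (rule norm_triangle_ineq)
    also have "\<dots> \<le> norm (fst p) * norm y + cmod (snd p) * norm y"
      by (intro add_mono norm_mult_ineq) (simp add: norm_scaleC)
    finally show "norm (unit_act p y) \<le> (norm (fst p) + cmod (snd p)) * norm y"
      by (simp add: distrib_right)
  qed simp
  then show ?thesis by (simp add: unit_norm_def)
qed

text \<open>Together with \<open>cmod_snd_le_unit_norm\<close> and \<open>unit_norm_le\<close> this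
  makes \<open>unit_norm\<close> equivalent to the sum of the component norms, from which
  completeness is inherited.\<close>

lemma norm_fst_le_unit_norm: "norm (fst p) \<le> 2 * unit_norm p"
proof -
  have "onorm (\<lambda>y. fst p * y) \<le> onorm (unit_act p) + cmod (snd p)"
  proof (rule onorm_bound)
    fix y
    have "fst p * y = unit_act p y - snd p *\<^sub>C y" by (simp add: unit_act_def)
    then have "norm (fst p * y) \<le> norm (unit_act p y) + norm (snd p *\<^sub>C y)"
      using norm_triangle_ineq4[of "unit_act p y" "snd p *\<^sub>C y"] by simp
    also have "\<dots> \<le> onorm (unit_act p) * norm y + cmod (snd p) * norm y"
      by (intro add_mono onorm bounded_linear_unit_act) (simp add: norm_scaleC)
    finally show "norm (fst p * y) \<le> (onorm (unit_act p) + cmod (snd p)) * norm y"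
      by (simp add: distrib_right)
  qed (simp add: onorm_pos_le[OF bounded_linear_unit_act])
  then show ?thesis by (simp add: onorm_mult_left unit_norm_def)
qed

lemma unit_norm_nonneg: "0 \<le> unit_norm p"
  using cmod_snd_le_unit_norm[of p] norm_ge_zero order_trans by blast

lemma unit_norm_eq_zero: "unit_norm p = 0 \<longleftrightarrow> p = 0"
proof
  assume "unit_norm p = 0"
  then show "p = 0"
    using norm_fst_le_unit_norm[of p] cmod_snd_le_unit_norm[of p] by (simp add: prod_eq_iff)
next
  assume "p = 0"
  then show "unit_norm p = 0"
    using unit_norm_le[of p] unit_norm_nonneg[of p] by simp
qed

lemma unit_norm_triangle: "unit_norm (p + q) \<le> unit_norm p + unit_norm q"
proof -
  have "unit_act (p + q) = (\<lambda>y. unit_act p y + unit_act q y)" by (simp add: fun_eq_iff unit_act_add)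
  then have "onorm (unit_act (p + q)) \<le> onorm (unit_act p) + onorm (unit_act q)"
    using onorm_triangle[OF bounded_linear_unit_act bounded_linear_unit_act] by metis
  moreover have "cmod (snd (p + q)) \<le> cmod (snd p) + cmod (snd q)" by (simp add: norm_triangle_ineq)
  ultimately show ?thesis by (auto simp: unit_norm_def)
qed

lemma unit_norm_scaleC: "unit_norm (c *\<^sub>C fst p, c * snd p) = cmod c * unit_norm p"
proof -
  have "unit_act (c *\<^sub>C fst p, c * snd p) y = c *\<^sub>C unit_act p y" for y
    by (simp add: unit_act_def scaleC_add_right scaleC_mult_left scaleC_scaleC)
  then have "onorm (unit_act (c *\<^sub>C fst p, c * snd p)) = onorm (\<lambda>y. cmod c *\<^sub>R unit_act p y)"
    by (simp add: onorm_def norm_scaleC)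
  then show ?thesis
    by (simp add: unit_norm_def onorm_scaleR[OF bounded_linear_unit_act] norm_mult max_mult_distrib_left)
qed

lemma unit_norm_mult: "unit_norm (unitization_mult p q) \<le> unit_norm p * unit_norm q"
proof -
  have "onorm (unit_act p) * onorm (unit_act q) \<le> unit_norm p * unit_norm q"
    by (intro mult_mono) (auto simp: unit_norm_def onorm_pos_le[OF bounded_linear_unit_act] le_max_iff_disj)
  moreover have "cmod (snd p) * cmod (snd q) \<le> unit_norm p * unit_norm q"
    by (intro mult_mono cmod_snd_le_unit_norm unit_norm_nonneg) simp
  moreover have "cmod (snd (unitization_mult p q)) = cmod (snd p) * cmod (snd q)"
    by (simp add: unitization_mult_def norm_mult)
  ultimately show ?thesis using onorm_unit_act_mult_le[of p q]
    unfolding unit_norm_def[of "unitization_mult p q"] by simp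
qed

lemma unit_norm_star_mult: "unit_norm (unitization_mult (unit_star p) p) = (unit_norm p)\<^sup>2"
proof -
  have "cmod (snd (unitization_mult (unit_star p) p)) = (cmod (snd p))\<^sup>2"
    by (simp add: unitization_mult_def unit_star_def norm_mult power2_eq_square)
  moreover have "(max a b)\<^sup>2 = max (a\<^sup>2) (b\<^sup>2)" if "0 \<le> a" "0 \<le> b" for a b :: real
    using that by (auto simp: max_def power2_le_iff_abs_le)
  ultimately show ?thesis
    by (simp add: unit_norm_def onorm_unit_act_star_mult onorm_pos_le[OF bounded_linear_unit_act])
qed

lemma unit_norm_one: "unit_norm (0::'a::cstar_algebra, 1) = 1"
proof -
  have "unit_act (0, 1) = (\<lambda>y::'a. y)" by (simp add: fun_eq_iff unit_act_def)
  then show ?thesis by (simp add: unit_norm_def max_absorb2[OF onorm_id_le])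
qed

text \<open>A separate type, because the product type already carries a different norm.\<close>

typedef (overloaded) 'a unitization = "UNIV :: ('a::cstar_algebra \<times> complex) set"
  morphisms pair_of_unitization unitization_of_pair ..

setup_lifting type_definition_unitization

instantiation unitization :: (cstar_algebra) real_normed_algebra_1
begin

lift_definition norm_unitization :: "'a unitization \<Rightarrow> real" is unit_norm .
lift_definition minus_unitization :: "'a unitization \<Rightarrow> 'a unitization \<Rightarrow> 'a unitization" is "(-)" .
lift_definition uminus_unitization :: "'a unitization \<Rightarrow> 'a unitization" is uminus .
lift_definition zero_unitization :: "'a unitization" is 0 .
lift_definition one_unitization :: "'a unitization" is "(0, 1)" .
lift_definition plus_unitization :: "'a unitization \<Rightarrow> 'a unitization \<Rightarrow> 'a unitization" is "(+)" .
lift_definition scaleR_unitization :: "real \<Rightarrow> 'a unitization \<Rightarrow> 'a unitization" is "(*\<^sub>R)" .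
lift_definition times_unitization :: "'a unitization \<Rightarrow> 'a unitization \<Rightarrow> 'a unitization"
  is unitization_mult .

definition dist_unitization :: "'a unitization \<Rightarrow> 'a unitization \<Rightarrow> real" where
  "dist_unitization a b = norm (a - b)"

definition uniformity_unitization :: "('a unitization \<times> 'a unitization) filter" where
  "uniformity_unitization = (INF e\<in>{0 <..}. principal {(x, y). dist x y < e})"

definition open_unitization :: "'a unitization set \<Rightarrow> bool" where
  "open_unitization S = (\<forall>x\<in>S. \<forall>\<^sub>F (x', y) in uniformity. x' = x \<longrightarrow> y \<in> S)"

definition sgn_unitization :: "'a unitization \<Rightarrow> 'a unitization" where
  "sgn_unitization x = inverse (norm x) *\<^sub>R x"

instance
proof
  fix a b c :: "'a unitization" and r s :: real
  show "dist a b = norm (a - b)" by (rule dist_unitization_def)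
  show "(uniformity :: ('a unitization \<times> 'a unitization) filter)
      = (INF e\<in>{0 <..}. principal {(x, y). dist x y < e})"
    by (rule uniformity_unitization_def)
  show "open S = (\<forall>x\<in>S. \<forall>\<^sub>F (x', y) in uniformity. x' = x \<longrightarrow> y \<in> S)" for S :: "'a unitization set"
    by (rule open_unitization_def)
  show "sgn a = inverse (norm a) *\<^sub>R a" by (rule sgn_unitization_def)
  show "a + b + c = a + (b + c)" "a + b = b + a" "0 + a = a" "- a + a = 0" "a - b = a + - b"
    by (transfer; simp add: add_ac)+
  show "r *\<^sub>R (a + b) = r *\<^sub>R a + r *\<^sub>R b" "(r + s) *\<^sub>R a = r *\<^sub>R a + s *\<^sub>R a"
    "r *\<^sub>R s *\<^sub>R a = (r * s) *\<^sub>R a" "1 *\<^sub>R a = a"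
    by (transfer; simp add: algebra_simps)+
  show "(norm a = 0) = (a = 0)" by transfer (rule unit_norm_eq_zero)
  show "norm (a + b) \<le> norm a + norm b" by transfer (rule unit_norm_triangle)
  show "norm (r *\<^sub>R a) = \<bar>r\<bar> * norm a"
  proof transfer
    fix r and a :: "'a \<times> complex"
    have "r *\<^sub>R a = (of_real r *\<^sub>C fst a, of_real r * snd a)"
      by (simp add: prod_eq_iff scaleR_scaleC scaleR_conv_of_real)
    then show "unit_norm (r *\<^sub>R a) = \<bar>r\<bar> * unit_norm a" by (simp add: unit_norm_scaleC)
  qed
  show "a * b * c = a * (b * c)" "(a + b) * c = a * c + b * c" "a * (b + c) = a * b + a * c"
    "r *\<^sub>R a * b = r *\<^sub>R (a * b)" "a * r *\<^sub>R b = r *\<^sub>R (a * b)" "1 * a = a" "a * 1 = a"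
    by (transfer; simp add: unitization_mult_def prod_eq_iff algebra_simps scaleC_add_right scaleC_add_left
      scaleC_mult_left scaleC_mult_right scaleC_scaleC scaleR_scaleC scaleR_conv_of_real)+
  show "norm (a * b) \<le> norm a * norm b" by transfer (rule unit_norm_mult)
  show "norm (1 :: 'a unitization) = 1" by transfer (rule unit_norm_one)
  show "(0 :: 'a unitization) \<noteq> 1" by transfer (simp add: prod_eq_iff)
qed

end

instance unitization :: (cstar_algebra) banach
proof
  fix X :: "nat \<Rightarrow> 'a unitization" assume X: "Cauchy X"
  let ?p = "\<lambda>n. pair_of_unitization (X n)"
  have fst_le: "dist (fst (?p m)) (fst (?p n)) \<le> 2 * dist (X m) (X n)" for m n
    using norm_fst_le_unit_norm[of "?p m - ?p n"]
    by (simp add: dist_norm norm_unitization.rep_eq minus_unitization.rep_eq)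
  have snd_le: "dist (snd (?p m)) (snd (?p n)) \<le> dist (X m) (X n)" for m n
    using cmod_snd_le_unit_norm[of "?p m - ?p n"]
    by (simp add: dist_norm norm_unitization.rep_eq minus_unitization.rep_eq)
  have "Cauchy (\<lambda>n. fst (?p n))"
  proof (rule metric_CauchyI)
    fix e :: real assume "0 < e"
    then obtain M where M: "\<forall>m\<ge>M. \<forall>n\<ge>M. dist (X m) (X n) < e / 2"
      using metric_CauchyD[OF X, of "e / 2"] by auto
    show "\<exists>M. \<forall>m\<ge>M. \<forall>n\<ge>M. dist (fst (?p m)) (fst (?p n)) < e"
    proof (intro exI[of _ M] allI impI)
      fix m n assume "M \<le> m" "M \<le> n"
      then have "dist (X m) (X n) < e / 2" using M by blast
      then show "dist (fst (?p m)) (fst (?p n)) < e" using fst_le[of m n] by linarith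
    qed
  qed
  then obtain x where x: "(\<lambda>n. fst (?p n)) \<longlonglongrightarrow> x"
    using Cauchy_convergent convergent_def by blast
  have "Cauchy (\<lambda>n. snd (?p n))"
    using X snd_le unfolding Cauchy_def by (meson le_less_trans)
  then obtain c where c: "(\<lambda>n. snd (?p n)) \<longlonglongrightarrow> c"
    using Cauchy_convergent convergent_def by blast
  have "(\<lambda>n. norm (fst (?p n) - x) + cmod (snd (?p n) - c)) \<longlonglongrightarrow> 0 + 0"
    using x c by (intro tendsto_add) (simp_all add: tendsto_norm_zero_iff LIM_zero_iff)
  then have lim: "(\<lambda>n. norm (fst (?p n) - x) + cmod (snd (?p n) - c)) \<longlonglongrightarrow> 0" by simp
  have "norm (dist (X n) (unitization_of_pair (x, c))) \<le> norm (fst (?p n) - x) + cmod (snd (?p n) - c)" for n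
    using unit_norm_le[of "?p n - (x, c)"] unit_norm_nonneg[of "?p n - (x, c)"]
    by (simp add: dist_norm norm_unitization.rep_eq minus_unitization.rep_eq unitization_of_pair_inverse)
  then have "(\<lambda>n. dist (X n) (unitization_of_pair (x, c))) \<longlonglongrightarrow> 0"
    by (intro Lim_null_comparison[OF _ lim] always_eventually allI)
  then have "X \<longlonglongrightarrow> unitization_of_pair (x, c)" by (rule iffD2[OF tendsto_dist_iff])
  then show "convergent X" by (auto simp: convergent_def)
qed

instantiation unitization :: (cstar_algebra) cstar_algebra
begin

lift_definition scaleC_unitization :: "complex \<Rightarrow> 'a unitization \<Rightarrow> 'a unitization"
  is "\<lambda>c p. (c *\<^sub>C fst p, c * snd p)" .
lift_definition star_unitization :: "'a unitization \<Rightarrow> 'a unitization" is unit_star .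

instance
proof
  fix a b :: "'a unitization" and c d :: complex and r :: real
  show "c *\<^sub>C (a + b) = c *\<^sub>C a + c *\<^sub>C b" "(c + d) *\<^sub>C a = c *\<^sub>C a + d *\<^sub>C a"
    "c *\<^sub>C d *\<^sub>C a = (c * d) *\<^sub>C a" "r *\<^sub>R a = of_real r *\<^sub>C a"
    by (transfer; simp add: prod_eq_iff scaleC_add_right scaleC_add_left scaleC_scaleC algebra_simps
      scaleR_scaleC scaleR_conv_of_real)+
  show "norm (c *\<^sub>C a) = cmod c * norm a" by transfer (rule unit_norm_scaleC)
  show "(c *\<^sub>C a) * b = c *\<^sub>C (a * b)" "a * (c *\<^sub>C b) = c *\<^sub>C (a * b)"
    by (transfer; simp add: unitization_mult_def prod_eq_iff algebra_simps scaleC_add_right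
      scaleC_mult_left scaleC_mult_right scaleC_scaleC)+
  show "star (star a) = a" "star (a + b) = star a + star b" "star (c *\<^sub>C a) = cnj c *\<^sub>C star a"
    "star (a * b) = star b * star a"
    by (transfer; simp add: unit_star_def unitization_mult_def prod_eq_iff star_star star_add star_scaleC
      star_mult algebra_simps)+
  show "norm (star a * a) = (norm a)\<^sup>2" by transfer (rule unit_norm_star_mult)
qed

end

instance unitization :: (cstar_algebra) unital_cstar_algebra ..

lift_definition embed :: "'a::cstar_algebra \<Rightarrow> 'a unitization" is "\<lambda>x. (x, 0)" .

text \<open>A character whose kernel is the embedded algebra; it shows that the root of an embedded
  element is embedded.\<close>

lift_definition scalar_part :: "'a::cstar_algebra unitization \<Rightarrow> complex" is snd .

lemma embed_mult: "embed (x * y) = embed x * embed y"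
  by transfer (simp add: unitization_mult_def)

lemma embed_diff: "embed (x - y) = embed x - embed y"
  by transfer simp

lemma embed_star: "embed (star x) = star (embed x)"
  by transfer (simp add: unit_star_def)

lemma embed_inject: "embed x = embed y \<longleftrightarrow> x = y"
  by transfer simp

lemma norm_embed: "norm (embed x) = norm x"
proof transfer
  fix x :: 'a
  have "unit_act (x, 0) = (\<lambda>y. x * y)" by (simp add: fun_eq_iff unit_act_def)
  then show "unit_norm (x, 0) = norm x" by (simp add: unit_norm_def onorm_mult_left max_absorb1)
qed

lemma scalar_part_mult: "scalar_part (a * b) = scalar_part a * scalar_part b"
  by transfer (simp add: unitization_mult_def)

lemma scalar_part_embed: "scalar_part (embed x) = 0"
  by transfer simp

lemma scalar_part_eq_zeroD: "scalar_part a = 0 \<Longrightarrow> \<exists>x. a = embed x"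
  by transfer (metis prod.collapse)

lemma cstar_spectrum_iff: "z \<in> cstar_spectrum x \<longleftrightarrow> \<not> invertible_elt (embed x - z *\<^sub>C 1)"
proof -
  have eq: "unitization_of_pair (x, - z) = embed x - z *\<^sub>C 1"
    by (simp add: pair_of_unitization_inject[symmetric] unitization_of_pair_inverse minus_unitization.rep_eq
        embed.rep_eq scaleC_unitization.rep_eq one_unitization.rep_eq)
  have inv: "invertible_elt (unitization_of_pair q) \<longleftrightarrow>
      (\<exists>p. unitization_mult q p = (0, 1) \<and> unitization_mult p q = (0, 1))" for q :: "'a \<times> complex"
  proof -
    have "invertible_elt a \<longleftrightarrow> (\<exists>p. unitization_mult (pair_of_unitization a) p = (0, 1)
        \<and> unitization_mult p (pair_of_unitization a) = (0, 1))" for a :: "'a unitization"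
      unfolding invertible_elt_def by transfer simp
    then show ?thesis by (simp add: unitization_of_pair_inverse)
  qed
  show ?thesis by (simp only: eq[symmetric] inv mem_Collect_eq cstar_spectrum_def)
qed

text \<open>Forwards, invertibility at the negative reals suffices by
  \<open>invertible_elt_imp_cpos\<close>; backwards, \<open>cpos_imp_invertible_elt\<close> excludes
  every point that is not a nonnegative real.\<close>

lemma cstar_positive_iff: "cstar_positive x \<longleftrightarrow> cpos (embed x)"
proof
  assume x: "cstar_positive x"
  show "cpos (embed x)"
  proof (rule invertible_elt_imp_cpos)
    show "star (embed x) = embed x"
      using x by (simp add: cstar_positive_def flip: embed_star)
    fix r :: real assume "0 < r"
    then have "- complex_of_real r \<notin> cstar_spectrum x"
      using x by (auto simp: cstar_positive_def less_eq_complex_def)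
    then show "invertible_elt (embed x + r *\<^sub>R 1)"
      by (simp add: cstar_spectrum_iff scaleC_minus_left scaleR_scaleC)
  qed
next
  assume x: "cpos (embed x)"
  then have "star x = x" using cpos_star[OF x] by (simp add: embed_inject flip: embed_star)
  moreover have "0 \<le> z" if "z \<in> cstar_spectrum x" for z
    using that cpos_imp_invertible_elt[OF x, of z] by (metis cstar_spectrum_iff)
  ultimately show "cstar_positive x" by (simp add: cstar_positive_def)
qed

lemma cstar_sqrt:
  assumes "cstar_positive b"
  shows cstar_positive_cstar_sqrt: "cstar_positive (cstar_sqrt b)"
    and cstar_sqrt_square: "cstar_sqrt b * cstar_sqrt b = b"
proof -
  obtain k where k: "cpos k" "k * k = embed b"
    using cpos_sqrt assms by (auto simp: cstar_positive_iff)
  \<comment> \<open>The character sends \<open>k * k = embed b\<close> to zero, hence also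
    \<open>k\<close>.\<close>
  have "scalar_part k * scalar_part k = 0"
    by (simp add: scalar_part_embed k flip: scalar_part_mult)
  then obtain s where s: "k = embed s" using scalar_part_eq_zeroD[of k] by auto
  have s': "cstar_positive s \<and> s * s = b"
    using k by (simp add: s cstar_positive_iff embed_inject flip: embed_mult)
  have "cstar_sqrt b = s" unfolding cstar_sqrt_def
  proof (rule the_equality[of "\<lambda>s. cstar_positive s \<and> s * s = b", OF s'])
    fix t assume "cstar_positive t \<and> t * t = b"
    then show "t = s"
      using cpos_sqrt_unique[of "embed t" "embed s"] s'
      by (simp add: cstar_positive_iff embed_inject flip: embed_mult)
  qed
  then show "cstar_positive (cstar_sqrt b)" "cstar_sqrt b * cstar_sqrt b = b" using s' by simp_all
qed

section \<open>Norming states\<close>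

definition sublinear :: "('v::real_vector \<Rightarrow> real) \<Rightarrow> bool" where
  "sublinear p \<longleftrightarrow> (\<forall>x y. p (x + y) \<le> p x + p y) \<and> (\<forall>r x. 0 \<le> r \<longrightarrow> p (r *\<^sub>R x) = r * p x)"

lemma sublinear_add: "sublinear p \<Longrightarrow> p (x + y) \<le> p x + p y"
  by (simp add: sublinear_def)

lemma sublinear_scaleR: "sublinear p \<Longrightarrow> 0 \<le> r \<Longrightarrow> p (r *\<^sub>R x) = r * p x"
  by (simp add: sublinear_def)

lemma sublinear_zero: "sublinear p \<Longrightarrow> p 0 = 0"
  using sublinear_scaleR[of p 0 0] by simp

lemma sublinear_minus: "sublinear p \<Longrightarrow> - p (- x) \<le> p x"
  using sublinear_add[of p x "- x"] by (simp add: sublinear_zero)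

lemma sublinearI:
  assumes add: "\<And>x y. p (x + y) \<le> p x + p y" and zero: "p 0 = 0"
    and scale: "\<And>r x. 0 < r \<Longrightarrow> p (r *\<^sub>R x) \<le> r * p x"
  shows "sublinear p"
  unfolding sublinear_def
proof (intro conjI allI impI add)
  fix r :: real and x assume "0 \<le> r"
  show "p (r *\<^sub>R x) = r * p x"
  proof (cases "r = 0")
    case True
    then show ?thesis by (simp add: zero)
  next
    case False
    then have r: "r > 0" using \<open>0 \<le> r\<close> by simp
    have "p ((1 / r) *\<^sub>R (r *\<^sub>R x)) \<le> (1 / r) * p (r *\<^sub>R x)" using r by (intro scale) simp
    then have "r * p x \<le> p (r *\<^sub>R x)" using r by (simp add: field_simps)
    then show ?thesis using scale[OF r, of x] by simp
  qed
qed

text \<open>A sublinear functional below \<open>p\<close> with value at most \<open>- p y\<close> at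
  \<open>- y\<close>. It is both the obstruction to minimality of a nonlinear \<open>p\<close> and
  the means to prescribe a value.\<close>

definition lower_along :: "('v::real_vector \<Rightarrow> real) \<Rightarrow> 'v \<Rightarrow> 'v \<Rightarrow> real" where
  "lower_along p y x = (INF t\<in>{0..}. p (x + t *\<^sub>R y) - t * p y)"

context
  fixes p :: "'v::real_vector \<Rightarrow> real"
  assumes p: "sublinear p"
begin

lemma bdd_below_lower_along: "bdd_below ((\<lambda>t. p (x + t *\<^sub>R y) - t * p y) ` {0..})"
proof (rule bdd_belowI2)
  fix t :: real assume "t \<in> {0..}"
  then have "t * p y = p ((x + t *\<^sub>R y) + (- x))" by (simp add: sublinear_scaleR[OF p])
  also have "\<dots> \<le> p (x + t *\<^sub>R y) + p (- x)" by (rule sublinear_add[OF p])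
  finally show "- p (- x) \<le> p (x + t *\<^sub>R y) - t * p y" by simp
qed

lemma lower_along_le: "0 \<le> t \<Longrightarrow> lower_along p y x \<le> p (x + t *\<^sub>R y) - t * p y"
  unfolding lower_along_def by (rule cINF_lower[OF bdd_below_lower_along]) simp

lemma lower_along_greatest:
  "(\<And>t. 0 \<le> t \<Longrightarrow> K \<le> p (x + t *\<^sub>R y) - t * p y) \<Longrightarrow> K \<le> lower_along p y x"
  unfolding lower_along_def by (rule cINF_greatest) auto

lemma sublinear_lower_along: "sublinear (lower_along p y)"
proof (rule sublinearI)
  fix x z
  have "lower_along p y (x + z) - (p (x + s *\<^sub>R y) - s * p y) \<le> lower_along p y z" if s: "0 \<le> s" for s
  proof (rule lower_along_greatest)
    fix t :: real assume "0 \<le> t"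
    then have "lower_along p y (x + z) \<le> p ((x + z) + (s + t) *\<^sub>R y) - (s + t) * p y"
      using s by (intro lower_along_le) simp
    also have "(x + z) + (s + t) *\<^sub>R y = (x + s *\<^sub>R y) + (z + t *\<^sub>R y)" by (simp add: algebra_simps)
    also have "p \<dots> \<le> p (x + s *\<^sub>R y) + p (z + t *\<^sub>R y)" by (rule sublinear_add[OF p])
    finally show "lower_along p y (x + z) - (p (x + s *\<^sub>R y) - s * p y) \<le> p (z + t *\<^sub>R y) - t * p y"
      by (simp add: algebra_simps)
  qed
  then have "lower_along p y (x + z) - lower_along p y z \<le> p (x + s *\<^sub>R y) - s * p y" if "0 \<le> s" for s
    using that by (smt (verit))
  then have "lower_along p y (x + z) - lower_along p y z \<le> lower_along p y x"
    by (rule lower_along_greatest)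
  then show "lower_along p y (x + z) \<le> lower_along p y x + lower_along p y z" by simp
next
  have "0 \<le> lower_along p y 0"
    by (rule lower_along_greatest) (simp add: sublinear_scaleR[OF p])
  moreover have "lower_along p y 0 \<le> 0"
    using lower_along_le[of 0 y 0] by (simp add: sublinear_zero[OF p])
  ultimately show "lower_along p y 0 = 0" by simp
next
  fix r :: real and x assume r: "0 < r"
  have "lower_along p y (r *\<^sub>R x) / r \<le> lower_along p y x"
  proof (rule lower_along_greatest)
    fix t :: real assume t: "0 \<le> t"
    have "lower_along p y (r *\<^sub>R x) \<le> p (r *\<^sub>R x + (r * t) *\<^sub>R y) - (r * t) * p y"
      using r t by (intro lower_along_le) simp
    also have "r *\<^sub>R x + (r * t) *\<^sub>R y = r *\<^sub>R (x + t *\<^sub>R y)" by (simp add: scaleR_add_right)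
    also have "p \<dots> = r * p (x + t *\<^sub>R y)" using r by (simp add: sublinear_scaleR[OF p])
    finally show "lower_along p y (r *\<^sub>R x) / r \<le> p (x + t *\<^sub>R y) - t * p y"
      using r by (simp add: field_simps)
  qed
  then show "lower_along p y (r *\<^sub>R x) \<le> r * lower_along p y x" using r by (simp add: field_simps)
qed

lemma lower_along_le_self: "lower_along p y x \<le> p x"
  using lower_along_le[of 0 y x] by simp

lemma lower_along_minus: "lower_along p y (- y) \<le> - p y"
  using lower_along_le[of 1 y "- y"] by (simp add: sublinear_zero[OF p])

end

text \<open>Minimality forces \<open>lower_along q y = q\<close>, so \<open>q\<close> is odd; a
  subadditive odd functional is additive.\<close>

lemma minimal_sublinear_linear:
  assumes q: "sublinear q" and min: "\<And>q'. sublinear q' \<Longrightarrow> q' \<le> q \<Longrightarrow> q' = q"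
  shows "linear q"
proof -
  have neg: "q (- y) = - q y" for y
  proof -
    have "lower_along q y = q"
      by (intro min sublinear_lower_along[OF q]) (simp add: le_fun_def lower_along_le_self[OF q])
    then have "q (- y) \<le> - q y" using lower_along_minus[OF q, of y] by simp
    then show ?thesis using sublinear_minus[OF q, of "- y"] by simp
  qed
  show ?thesis
  proof (rule linearI)
    fix x y
    have "- q (x + y) \<le> - q x - q y"
      using sublinear_add[OF q, of "- x" "- y"] neg[of "x + y"] neg[of x] neg[of y] by simp
    then show "q (x + y) = q x + q y" using sublinear_add[OF q, of x y] by simp
    fix r :: real
    show "q (r *\<^sub>R x) = r *\<^sub>R q x"
    proof (cases "0 \<le> r")
      case True
      then show ?thesis by (simp add: sublinear_scaleR[OF q])
    next
      case False
      then have "q ((- r) *\<^sub>R x) = (- r) * q x" by (intro sublinear_scaleR[OF q]) simp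
      then show ?thesis using neg[of "r *\<^sub>R x"] by simp
    qed
  qed
qed

lemma exists_linear_below_sublinear:
  fixes p :: "'v::real_vector \<Rightarrow> real"
  assumes p: "sublinear p"
  shows "\<exists>f. linear f \<and> (\<forall>x. f x \<le> p x)"
proof -
  define A where "A = {q. sublinear q \<and> q \<le> p}"
  \<comment> \<open>The reversed order, for which a maximal element is a minimal sublinear
    functional.\<close>
  let ?R = "\<lambda>q q' :: 'v \<Rightarrow> real. q' \<le> q"
  have "\<exists>m\<in>A. \<forall>a\<in>A. ?R m a \<longrightarrow> a = m"
  proof (rule predicate_Zorn)
    show "partial_order_on A (relation_of ?R A)"
      by (rule partial_order_on_relation_ofI) auto
    fix Ch assume "Ch \<in> Chains (relation_of ?R A)"
    then have Ch: "Ch \<subseteq> A" and total: "\<And>q q'. q \<in> Ch \<Longrightarrow> q' \<in> Ch \<Longrightarrow> q \<le> q' \<or> q' \<le> q"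
      by (auto simp: Chains_def relation_of_def)
    show "\<exists>u\<in>A. \<forall>q\<in>Ch. ?R q u"
    proof (cases "Ch = {}")
      case True
      then show ?thesis using p by (auto simp: A_def)
    next
      case False
      define u where "u = (\<lambda>x. INF q\<in>Ch. q x)"
      have sub: "sublinear q" and le: "q x \<le> p x" if "q \<in> Ch" for q x
        using that Ch by (auto simp: A_def le_fun_def)
      have bdd: "bdd_below ((\<lambda>q. q x) ` Ch)" for x
      proof (rule bdd_belowI2)
        fix q assume "q \<in> Ch"
        then show "- p (- x) \<le> q x" using sublinear_minus[OF sub, of q x] le[of q "- x"] by simp
      qed
      have u_le: "u x \<le> q x" if "q \<in> Ch" for q x
        unfolding u_def by (rule cINF_lower[OF bdd that])
      have u_greatest: "K \<le> u x" if "\<And>q. q \<in> Ch \<Longrightarrow> K \<le> q x" for K x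
        unfolding u_def by (rule cINF_greatest[OF False that])
      have "sublinear u"
      proof (rule sublinearI)
        fix x y
        have pair: "u (x + y) \<le> q x + q' y" if qq: "q \<in> Ch" "q' \<in> Ch" for q q'
        proof -
          \<comment> \<open>The smaller of two functionals in the chain bounds both at once; this is
            where subadditivity of the infimum uses the chain.\<close>
          obtain w where w: "w \<in> Ch" "w \<le> q" "w \<le> q'" using total[OF qq] qq by blast
          have "u (x + y) \<le> w (x + y)" by (rule u_le[OF w(1)])
          also have "\<dots> \<le> w x + w y" by (rule sublinear_add[OF sub[OF w(1)]])
          also have "\<dots> \<le> q x + q' y" using w by (intro add_mono) (auto simp: le_fun_def)
          finally show ?thesis .
        qed
        have "u (x + y) - q x \<le> u y" if "q \<in> Ch" for q
          using pair[OF that] by (intro u_greatest) (simp add: diff_le_eq add.commute)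
        then have "u (x + y) - u y \<le> u x" by (intro u_greatest) (simp add: algebra_simps)
        then show "u (x + y) \<le> u x + u y" by simp
      next
        have "u 0 \<ge> 0" by (intro u_greatest) (simp add: sublinear_zero[OF sub])
        moreover obtain q where "q \<in> Ch" using False by blast
        then have "u 0 \<le> 0" using u_le[of q 0] by (simp add: sublinear_zero[OF sub])
        ultimately show "u 0 = 0" by simp
      next
        fix r :: real and x assume r: "0 < r"
        have "u (r *\<^sub>R x) / r \<le> u x"
        proof (rule u_greatest)
          fix q assume q: "q \<in> Ch"
          show "u (r *\<^sub>R x) / r \<le> q x"
            using u_le[OF q, of "r *\<^sub>R x"] r by (simp add: sublinear_scaleR[OF sub[OF q]] field_simps)
        qed
        then show "u (r *\<^sub>R x) \<le> r * u x" using r by (simp add: field_simps)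
      qed
      moreover have "u \<le> p"
      proof -
        obtain q where "q \<in> Ch" using False by blast
        then show ?thesis using u_le[of q] le[of q] by (auto simp: le_fun_def intro: order_trans)
      qed
      ultimately show ?thesis using u_le by (intro bexI[of _ u]) (auto simp: A_def le_fun_def)
    qed
  qed
  then obtain m where m: "m \<in> A" and min: "\<And>q. q \<in> A \<Longrightarrow> q \<le> m \<Longrightarrow> q = m" by blast
  have "linear m"
    using m min by (intro minimal_sublinear_linear) (auto simp: A_def intro: order_trans)
  then show ?thesis using m by (auto simp: A_def le_fun_def)
qed

text \<open>A linear functional below \<open>lower_along norm x0\<close> is at most
  \<open>- norm x0\<close> at \<open>- x0\<close>, which forces equality at
  \<open>x0\<close>.\<close>

lemma norming_functional_exists:
  fixes x0 :: "'v::real_normed_vector"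
  shows "\<exists>f. linear f \<and> (\<forall>x. f x \<le> norm x) \<and> f x0 = norm x0"
proof -
  have n: "sublinear (norm :: 'v \<Rightarrow> real)" by (simp add: sublinear_def norm_triangle_ineq)
  obtain f where f: "linear f" "\<And>x. f x \<le> lower_along norm x0 x"
    using exists_linear_below_sublinear[OF sublinear_lower_along[OF n]] by blast
  have le: "f x \<le> norm x" for x
    using f(2)[of x] lower_along_le_self[OF n, of x0 x] by simp
  have "f (- x0) \<le> - norm x0"
    using f(2)[of "- x0"] lower_along_minus[OF n, of x0] by simp
  then have "f x0 = norm x0" using le[of x0] linear_neg[OF f(1), of x0] by simp
  then show ?thesis using f(1) le by blast
qed

section \<open>States and their forms\<close>

text \<open>It lets one functional norm both 1 and \<open>h\<close>: norming \<open>1 + h\<close> is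
  enough. The essential bound \<open>norm h \<le> norm (1 + h) - 1\<close> comes from the positivity
  of \<open>norm (1 + h) - (1 + h)\<close>.\<close>

lemma norm_one_add_cpos:
  fixes h :: "'u::unital_cstar_algebra"
  assumes h: "cpos h"
  shows "norm (1 + h) = 1 + norm h"
proof -
  define N where "N = norm (1 + h)"
  have "cpos (N *\<^sub>R 1 - (1 + h))"
    using h by (intro cpos_norm_diff) (simp_all add: N_def star_add cpos_star)
  then have diff: "cpos ((N - 1) *\<^sub>R 1 - h)" by (simp add: scaleR_diff_left algebra_simps)
  have N1: "cpos ((N - 1) *\<^sub>R (1::'u))" using cpos_add[OF diff h] by simp
  have "1 \<le> N"
  proof (rule ccontr)
    assume N: "\<not> 1 \<le> N"
    have "cpos (- ((N - 1) *\<^sub>R (1::'u)))" using cpos_scalar[of "- (N - 1)"] N by (simp add: scaleR_diff_left)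
    then show False using cpos_antisym[OF N1] N by simp
  qed
  moreover have "norm h \<le> N - 1"
  proof (cases "N = 1")
    case True
    then have "h = 0" using diff h by (intro cpos_antisym) simp_all
    then show ?thesis using True by simp
  next
    case False
    then show ?thesis using norm_le_of_cpos[OF h diff] \<open>1 \<le> N\<close> by simp
  qed
  ultimately show ?thesis using norm_triangle_ineq[of 1 h] by (simp add: N_def)
qed

text \<open>Only the real part of a state is kept, since the Hahn-Banach argument is real;
  \<open>gns\<close> restores the complex values.\<close>

locale cstar_state =
  fixes \<phi> :: "'u::unital_cstar_algebra \<Rightarrow> real"
  assumes \<phi>_linear: "linear \<phi>"
    and \<phi>_star: "\<phi> (star x) = \<phi> x"
    and \<phi>_star_mult_nonneg: "0 \<le> \<phi> (star x * x)"
    and \<phi>_one: "\<phi> 1 = 1"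

lemma norming_state_exists:
  fixes h :: "'u::unital_cstar_algebra"
  assumes h: "cpos h"
  shows "\<exists>\<phi>. cstar_state \<phi> \<and> \<phi> h = norm h"
proof -
  obtain f :: "'u \<Rightarrow> real" where f: "linear f" "\<And>x. f x \<le> norm x" "f (1 + h) = norm (1 + h)"
    using norming_functional_exists by blast
  have "f 1 + f h = 1 + norm h"
    using f(3) by (simp add: linear_add[OF f(1)] norm_one_add_cpos[OF h])
  then have f1: "f 1 = 1" and fh: "f h = norm h" using f(2)[of 1] f(2)[of h] by simp_all
  \<comment> \<open>Symmetrization provides invariance under \<open>star\<close> and changes nothing
    on self-adjoint elements.\<close>
  define \<phi> where "\<phi> = (\<lambda>x. f ((1/2) *\<^sub>R (x + star x)))"
  have sa: "\<phi> x = f x" if "star x = x" for x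
    using that by (simp add: \<phi>_def flip: scaleR_2)
  \<comment> \<open>A functional bounded by the norm with value 1 at the unit is positive: its value
    at \<open>norm g - g\<close> is at most \<open>norm g\<close> by \<open>cposD\<close>.\<close>
  have pos: "0 \<le> f g" if "cpos g" for g
  proof -
    have "f (norm g *\<^sub>R 1 - g) \<le> norm g"
      using f(2) cposD[OF that order_refl] by (rule order_trans)
    then show ?thesis by (simp add: linear_diff[OF f(1)] linear_cmul[OF f(1)] f1)
  qed
  have "cstar_state \<phi>"
  proof (rule cstar_state.intro)
    show "linear \<phi>"
      by (rule linearI) (simp_all add: \<phi>_def star_add star_scaleR linear_add[OF f(1)] linear_cmul[OF f(1)]
          add_divide_distrib algebra_simps)
    show "\<phi> (star x) = \<phi> x" for x by (simp add: \<phi>_def star_star add.commute)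
    show "0 \<le> \<phi> (star x * x)" for x
      using pos[OF cpos_star_mult] by (simp add: sa star_mult star_star)
    show "\<phi> 1 = 1" by (simp add: sa f1)
  qed
  moreover have "\<phi> h = norm h" by (simp add: sa cpos_star[OF h] fh)
  ultimately show ?thesis by blast
qed

context cstar_state
begin

text \<open>The complex value \<open>\<phi> z - i \<phi> (i z)\<close> at
  \<open>z = star v * u\<close>, which is complex linear in \<open>z\<close>.\<close>

definition gns :: "'u \<Rightarrow> 'u \<Rightarrow> complex" where
  "gns u v = Complex (\<phi> (star v * u)) (- \<phi> (\<i> *\<^sub>C (star v * u)))"

lemma \<phi>_simps: "\<phi> (x + y) = \<phi> x + \<phi> y" "\<phi> (x - y) = \<phi> x - \<phi> y" "\<phi> (- x) = - \<phi> x" "\<phi> (r *\<^sub>R x) = r * \<phi> x"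
  using \<phi>_linear by (simp_all add: linear_add linear_diff linear_neg linear_cmul)

lemma \<phi>_scaleC: "\<phi> (c *\<^sub>C x) = Re c * \<phi> x + Im c * \<phi> (\<i> *\<^sub>C x)"
proof -
  have "c *\<^sub>C x = (of_real (Re c) + of_real (Im c) * \<i>) *\<^sub>C x"
    by (metis complex_eq mult.commute)
  also have "\<dots> = Re c *\<^sub>R x + Im c *\<^sub>R (\<i> *\<^sub>C x)"
    by (simp only: scaleC_add_left scaleR_scaleC scaleC_scaleC)
  finally show ?thesis by (simp add: \<phi>_simps)
qed

lemma csemi_inner_gns: "csemi_inner gns"
proof
  fix x y z :: 'u and c :: complex
  have "star (\<i> *\<^sub>C (star y * x)) = - (\<i> *\<^sub>C (star x * y))"
    by (simp add: star_scaleC star_mult star_star scaleC_minus_left)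
  then have "\<phi> (\<i> *\<^sub>C (star x * y)) = - \<phi> (\<i> *\<^sub>C (star y * x))"
    using \<phi>_star[of "\<i> *\<^sub>C (star y * x)"] by (simp add: \<phi>_simps)
  moreover have "\<phi> (star x * y) = \<phi> (star y * x)"
    using \<phi>_star[of "star y * x"] by (simp add: star_mult star_star)
  ultimately show "gns x y = cnj (gns y x)" by (simp add: gns_def complex_eq_iff)
  show "gns (x + y) z = gns x z + gns y z"
    by (simp add: gns_def complex_eq_iff distrib_left scaleC_add_right \<phi>_simps)
  have "\<i> *\<^sub>C (c *\<^sub>C (star y * x)) = (\<i> * c) *\<^sub>C (star y * x)" by (simp add: scaleC_scaleC)
  then show "gns (c *\<^sub>C x) y = c * gns x y"
    by (simp add: gns_def complex_eq_iff scaleC_mult_right \<phi>_scaleC[of c] \<phi>_scaleC[of "\<i> * c"])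
  show "0 \<le> Re (gns x x)" by (simp add: gns_def \<phi>_star_mult_nonneg)
qed

sublocale gns: csemi_inner gns
  by (rule csemi_inner_gns)

lemma cpos_conj_nonneg:
  assumes "cpos g"
  shows "0 \<le> \<phi> (star u * (g * u))"
proof -
  obtain k where "star k = k" "g = k * k" using assms by (auto simp: cpos_def)
  then have "star u * (g * u) = star (k * u) * (k * u)" by (simp add: star_mult mult.assoc)
  then show ?thesis by (simp add: \<phi>_star_mult_nonneg)
qed

text \<open>The element \<open>(norm c)\<^sup>2 - star c * c\<close> is positive, and a state is
  nonnegative on its conjugates by \<open>u\<close>.\<close>

lemma sn_mult_le: "gns.sn (c * u) \<le> norm c * gns.sn u"
proof -
  have "cpos ((norm c)\<^sup>2 *\<^sub>R 1 - star c * c)"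
    by (rule cpos_norm_diff) (simp_all add: star_mult star_star cstar_identity)
  from cpos_conj_nonneg[OF this, of u]
  have "\<phi> (star u * (star c * c * u)) \<le> (norm c)\<^sup>2 * \<phi> (star u * u)"
    by (simp add: left_diff_distrib right_diff_distrib \<phi>_simps)
  then have "(gns.sn (c * u))\<^sup>2 \<le> (norm c * gns.sn u)\<^sup>2"
    by (simp add: gns.sn_squared power_mult_distrib) (simp add: gns_def star_mult mult.assoc)
  then show ?thesis by (rule power2_le_imp_le) simp
qed

lemma clinear_map_mult: "clinear_map (\<lambda>u::'u. c * u)"
  by (simp add: clinear_map_def distrib_left scaleC_mult_right)

text \<open>\<open>a\<close> and \<open>s\<close> act on the algebra by left multiplication. The
  vector 1 has seminorm 1, and the commutator of the two maps sends it to
  \<open>a s - s a\<close>.\<close>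

lemma state_commutator_bound:
  assumes C: "matrix_commutator_bound C" and a: "norm a \<le> 1" and s: "cpos s"
    and y: "gns.sn y \<le> 1"
  shows "cmod (gns (a * s - s * a) y) \<le> C * sqrt (norm (a * (s * s) - (s * s) * a))"
proof -
  have "cmod (gns (a * (s * 1) - s * (a * 1)) y) \<le> C * sqrt (norm (a * (s * s) - (s * s) * a))"
  proof (rule gns.scaled_commutator_bound[OF C, where L = "norm s + 1" and A = "\<lambda>u. a * u" and S = "\<lambda>u. s * u"])
    show "gns.sn (a * x) \<le> gns.sn x" for x
      using sn_mult_le[of a x] mult_right_mono[OF a, of "gns.sn x"] by simp
    show "gns (s * x) y = gns x (s * y)" for x y
      by (simp add: gns_def star_mult cpos_star[OF s] mult.assoc)
    show "0 \<le> Re (gns (s * x) x)" for x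
      using cpos_conj_nonneg[OF s, of x] by (simp add: gns_def)
    show "Re (gns (s * x) x) \<le> (norm s + 1) * Re (gns x x)" for x
    proof -
      have "cpos ((norm s + 1) *\<^sub>R 1 - s)" by (rule cpos_norm_diff[OF cpos_star[OF s]]) simp
      from cpos_conj_nonneg[OF this, of x] show ?thesis
        by (simp add: gns_def left_diff_distrib right_diff_distrib \<phi>_simps)
    qed
    show "gns.sn (a * (s * (s * u)) - s * (s * (a * u))) \<le> norm (a * (s * s) - (s * s) * a) * gns.sn u" for u
      using sn_mult_le[of "a * (s * s) - (s * s) * a" u] by (simp add: left_diff_distrib mult.assoc)
    show "gns.sn 1 \<le> 1" by (simp add: gns.sn_def gns_def \<phi>_one)
  qed (use y in \<open>simp_all add: clinear_map_mult add_nonneg_pos\<close>)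
  then show ?thesis by simp
qed

end

lemma unital_cstar_commutator_bound:
  fixes a s :: "'u::unital_cstar_algebra"
  assumes C: "matrix_commutator_bound C" and a: "norm a \<le> 1" and s: "cpos s"
  shows "norm (a * s - s * a) \<le> C * sqrt (norm (a * (s * s) - (s * s) * a))"
proof -
  define z where "z = a * s - s * a"
  obtain \<phi> where st: "cstar_state \<phi>" and \<phi>: "\<phi> (star z * z) = norm (star z * z)"
    using norming_state_exists[OF cpos_star_mult] by blast
  interpret cstar_state \<phi> by (rule st)
  have zz: "Re (gns z z) = (norm z)\<^sup>2" by (simp add: gns_def \<phi> cstar_identity)
  show ?thesis
  proof (cases "z = 0")
    case True
    then show ?thesis using matrix_commutator_bound_nonneg[OF C] by (simp flip: z_def)
  next
    case False
    let ?y = "(1 / norm z) *\<^sub>R z"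
    have "gns.sn ?y = 1"
      using False by (simp add: gns.sn_def gns.ip_scaleR_left gns.ip_scaleR_right zz power2_eq_square)
    then have "cmod (gns z ?y) \<le> C * sqrt (norm (a * (s * s) - (s * s) * a))"
      unfolding z_def by (intro state_commutator_bound[OF C a s]) simp
    moreover have "gns z z = of_real ((norm z)\<^sup>2)" using gns.ip_self[of z] by (simp only: zz)
    then have "cmod (gns z ?y) = norm z"
      using False by (simp add: gns.ip_scaleR_right norm_mult norm_divide power2_eq_square)
    ultimately show ?thesis by (simp add: z_def)
  qed
qed

theorem cstar_commutator_bound:
  fixes a b :: "'a::cstar_algebra"
  assumes C: "matrix_commutator_bound C" and a: "norm a \<le> 1" and b: "cstar_positive b"
  shows "norm (a * cstar_sqrt b - cstar_sqrt b * a) \<le> C * sqrt (norm (a * b - b * a))"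
proof -
  let ?s = "cstar_sqrt b"
  have "cpos (embed ?s)" using cstar_positive_cstar_sqrt[OF b] by (simp add: cstar_positive_iff)
  moreover have "norm (embed a) \<le> 1" using a by (simp add: norm_embed)
  ultimately have "norm (embed a * embed ?s - embed ?s * embed a)
      \<le> C * sqrt (norm (embed a * (embed ?s * embed ?s) - (embed ?s * embed ?s) * embed a))"
    by (intro unital_cstar_commutator_bound[OF C])
  then show ?thesis
    by (simp add: norm_embed cstar_sqrt_square[OF b] flip: embed_mult embed_diff)
qed

theorem corollary5p4:
  fixes C :: real
  assumes "\<And>(n::nat) (a::complex mat) (b::complex mat).
      a \<in> carrier_mat n n \<Longrightarrow> b \<in> carrier_mat n n \<Longrightarrow> mat_opnorm a \<le> 1 \<Longrightarrow> mat_psd b \<Longrightarrow>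
      mat_opnorm (a * mat_sqrt b - mat_sqrt b * a) \<le> C * sqrt (mat_opnorm (a * b - b * a))"
  shows "(\<forall>(a :: 'h::complex_hilbert \<Rightarrow> 'h) b.
           bounded_clinear a \<and> bounded_clinear b \<and> onorm a \<le> 1 \<and> op_positive b \<longrightarrow>
           onorm (\<lambda>x. a (op_sqrt b x) - op_sqrt b (a x))
             \<le> C * sqrt (onorm (\<lambda>x. a (b x) - b (a x))))
       \<and> (\<forall>(a :: 'a::cstar_algebra) b.
           norm a \<le> 1 \<and> cstar_positive b \<longrightarrow>
           norm (a * cstar_sqrt b - cstar_sqrt b * a) \<le> C * sqrt (norm (a * b - b * a)))"
proof -
  have "matrix_commutator_bound C"
    using assms unfolding matrix_commutator_bound_def by blast
  then show ?thesis using hilbert_commutator_bound cstar_commutator_bound by blast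
qed

end
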